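(* Let $a,b\subseteq\omega$ be such that $a\oplus b$ is $ITRM$-random. Then $a$ is $ITRM$-random and $b$ is $ITRM$-random relative to $a$.
   Context: An infinite time register machine ($ITRM$) has finitely many registers, each holding a natural number, and runs a program of the same kind as a classical unlimited register machine (with an additional instruction querying membership of a number in an oracle), but in transfinite ordinal time: successor steps are as for register machines; at limit times the active program line is the limit inferior of earlier program lines and each register holds the limit inferior of its earlier contents, reset to $0$ if that limit inferior is infinite. $a\oplus b=\{2i\mid i\in a\}\cup\{2j+1\mid j\in b\}$. $X\subseteq\mathfrak{P}(\omega)$ is $ITRM$-decidable iff some program $P$, with any oracle $x$, halts with output $1$ if $x\in X$ and $0$ otherwise; $X$ is $ITRM$-decidable in the oracle $y$ iff some program $P$, with oracle $x\oplus y$, halts with output $1$ if $x\in X$ and $0$ otherwise, for every $x$. $x$ is $ITRM$-random iff no $ITRM$-decidable meager set contains $x$; $x$ is $ITRM$-random relative to $y$ iff no meager set $X\ni x$ is $ITRM$-decidable in the oracle $y$. *)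

theory Defs
  imports "HOL-Analysis.Analysis" "HOL-Library.Extended_Nat"
begin

section \<open>Infinite time register machines\<close>

text \<open>
  \<open>Zero i\<close>, \<open>Succ i\<close> and \<open>Copy i j\<close> set register \<open>i\<close> to \<open>0\<close>, increment register \<open>i\<close>, and copy
  register \<open>i\<close> to register \<open>j\<close>.  \<open>Jump i j q\<close> continues at line \<open>q\<close> if registers \<open>i\<close> and \<open>j\<close> agree.
  \<open>Oracle i\<close> replaces the content of register \<open>i\<close> by the truth value of its membership in the
  oracle.
\<close>

datatype instr =
    Zero nat
  | Succ nat
  | Copy nat nat
  | Jump nat nat nat
  | Oracle nat

type_synonym program = "instr list"

text \<open>
  The active program line and the register contents.  A program mentions only finitely many
  registers; all others keep their initial value \<open>0\<close> throughout.
\<close>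

type_synonym config = "nat \<times> (nat \<Rightarrow> nat)"

fun exec_instr :: "nat set \<Rightarrow> instr \<Rightarrow> config \<Rightarrow> config" where
  "exec_instr x (Zero i) (l, R) = (Suc l, R(i := 0))"
| "exec_instr x (Succ i) (l, R) = (Suc l, R(i := Suc (R i)))"
| "exec_instr x (Copy i j) (l, R) = (Suc l, R(j := R i))"
| "exec_instr x (Jump i j q) (l, R) = (if R i = R j then q else Suc l, R)"
| "exec_instr x (Oracle i) (l, R) = (Suc l, R(i := (if R i \<in> x then 1 else 0)))"

text \<open>
  Ordinal time is represented by the elements of the field of a (reflexive) well-order \<open>r\<close>.
\<close>

definition is_pred :: "'t rel \<Rightarrow> 't \<Rightarrow> 't \<Rightarrow> bool" where
  "is_pred r s t \<longleftrightarrow> s \<in> underS r t \<and> (\<forall>u\<in>underS r t. (u, s) \<in> r)"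

definition is_limit :: "'t rel \<Rightarrow> 't \<Rightarrow> bool" where
  "is_limit r t \<longleftrightarrow> t \<in> Field r \<and> underS r t \<noteq> {} \<and> (\<nexists>s. is_pred r s t)"

definition liminf_at :: "'t rel \<Rightarrow> 't \<Rightarrow> ('t \<Rightarrow> nat) \<Rightarrow> enat" where
  "liminf_at r t f = (SUP s\<in>underS r t. INF u\<in>{u \<in> underS r t. (s, u) \<in> r}. enat (f u))"

definition limit_value :: "'t rel \<Rightarrow> 't \<Rightarrow> ('t \<Rightarrow> nat) \<Rightarrow> nat" where
  "limit_value r t f = (case liminf_at r t f of enat n \<Rightarrow> n | \<infinity> \<Rightarrow> 0)"

text \<open>
  The line number is below \<open>length P\<close> at every time that has a successor, so its limit inferior is
  always finite and the reset in \<open>limit_value\<close> only concerns registers.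
\<close>

definition itrm_computation :: "'t rel \<Rightarrow> program \<Rightarrow> nat set \<Rightarrow> ('t \<Rightarrow> config) \<Rightarrow> bool" where
  "itrm_computation r P x c \<longleftrightarrow>
     Well_order r \<and>
     (\<forall>t\<in>Field r. underS r t = {} \<longrightarrow> c t = (0, \<lambda>_. 0)) \<and>
     (\<forall>s t. is_pred r s t \<longrightarrow>
        fst (c s) < length P \<and> c t = exec_instr x (P ! fst (c s)) (c s)) \<and>
     (\<forall>t. is_limit r t \<longrightarrow>
        c t = (limit_value r t (\<lambda>s. fst (c s)), \<lambda>i. limit_value r t (\<lambda>s. snd (c s) i)))"

text \<open>
  The machine halts when the active line is not a line of the program; the output is the content
  of register \<open>0\<close> at that time.
\<close>

definition itrm_halts_along :: "'t rel \<Rightarrow> program \<Rightarrow> nat set \<Rightarrow> nat \<Rightarrow> bool" where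
  "itrm_halts_along r P x k \<longleftrightarrow>
     (\<exists>c t. itrm_computation r P x c \<and> t \<in> Field r \<and> (\<forall>s\<in>Field r. (s, t) \<in> r) \<and>
        length P \<le> fst (c t) \<and> snd (c t) 0 = k)"

text \<open>
  HOL cannot quantify over well-orders of arbitrary types inside a definition.  Well-orders on
  \<open>nat\<close>, which represent the countable ordinals, lose nothing: a computation that halts at some
  ordinal time halts with the same output at a countable one.  See \<open>itrm_computesI\<close> and
  \<open>itrm_computes_iff\<close> below, where time is taken from an arbitrary (infinite) type \<open>'t\<close>.
\<close>

definition itrm_computes :: "program \<Rightarrow> nat set \<Rightarrow> nat \<Rightarrow> bool" where
  "itrm_computes P x k \<longleftrightarrow> (\<exists>r :: nat rel. itrm_halts_along r P x k)"

lemma enat_le_liminf_at: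
  assumes "underS r t \<noteq> {}"
  shows "enat n \<le> liminf_at r t f \<longleftrightarrow>
    (\<exists>s\<in>underS r t. \<forall>u\<in>underS r t. (s, u) \<in> r \<longrightarrow> n \<le> f u)"
proof (cases n)
  case 0
  then show ?thesis using assms by (auto simp: zero_enat_def[symmetric])
next
  case (Suc m)
  have eq: "enat n \<le> z \<longleftrightarrow> enat m < z" for z
    using Suc by (metis Suc_ile_eq)
  have "enat n \<le> liminf_at r t f \<longleftrightarrow>
      (\<exists>s\<in>underS r t. enat n \<le> (INF u\<in>{u \<in> underS r t. (s, u) \<in> r}. enat (f u)))"
    unfolding eq liminf_at_def by (simp add: less_SUP_iff)
  then show ?thesis by (auto simp: le_INF_iff)
qed

lemma enat_eqI:
  assumes "\<And>n. enat n \<le> a \<longleftrightarrow> enat n \<le> b"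
  shows "a = b"
proof (rule ccontr)
  assume "a \<noteq> b"
  then consider "a < b" | "b < a" by fastforce
  then show False
  proof cases
    case 1
    then obtain m where "a = enat m" by (cases a) auto
    with 1 assms[of "Suc m"] show False by (simp add: Suc_ile_eq)
  next
    case 2
    then obtain m where "b = enat m" by (cases b) auto
    with 2 assms[of "Suc m"] show False by (simp add: Suc_ile_eq)
  qed
qed

lemma countable_closure:
  fixes F :: "nat \<Rightarrow> 't \<Rightarrow> 't \<Rightarrow> 't"
  obtains H where "countable H" "a \<in> H" "\<And>i s t. s \<in> H \<Longrightarrow> t \<in> H \<Longrightarrow> F i s t \<in> H"
proof -
  define G where "G A = A \<union> (\<Union>i. (\<lambda>(s, t). F i s t) ` (A \<times> A))" for A
  define H where "H = (\<Union>n. (G ^^ n) {a})"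
  have cnt: "countable ((G ^^ n) {a})" for n
    by (induction n) (auto simp: G_def)
  have mono: "(G ^^ m) {a} \<subseteq> (G ^^ n) {a}" if "m \<le> n" for m n
    using that by (induction n rule: dec_induct) (auto simp: G_def)
  show thesis
  proof
    show "countable H" using cnt by (auto simp: H_def)
    show "a \<in> H" unfolding H_def by (rule UN_I[of 0]) auto
    fix i s t assume "s \<in> H" "t \<in> H"
    then obtain m n where "s \<in> (G ^^ m) {a}" "t \<in> (G ^^ n) {a}" by (auto simp: H_def)
    then have "s \<in> (G ^^ max m n) {a}" "t \<in> (G ^^ max m n) {a}"
      using mono[of m "max m n"] mono[of n "max m n"] by auto
    then have "F i s t \<in> (G ^^ Suc (max m n)) {a}"
      by (auto simp: G_def)
    then show "F i s t \<in> H" unfolding H_def by blast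
  qed
qed

lemma itrm_halts_along_countable:
  fixes r :: "'t rel"
  assumes "itrm_halts_along r P x k"
  obtains r' :: "'t rel" where "countable (Field r')" "itrm_halts_along r' P x k"
proof -
  obtain c m where comp: "itrm_computation r P x c" and m: "m \<in> Field r"
    and m_max: "\<And>s. s \<in> Field r \<Longrightarrow> (s, m) \<in> r"
    and out: "length P \<le> fst (c m)" "snd (c m) 0 = k"
    using assms unfolding itrm_halts_along_def by blast
  have wo: "Well_order r" using comp by (simp add: itrm_computation_def)
  then interpret W: wo_rel r by (simp add: wo_rel_def)
  define v where "v j s = (case j of 0 \<Rightarrow> fst (c s) | Suc i \<Rightarrow> snd (c s) i)" for j s
  have v: "v 0 = (\<lambda>s. fst (c s))" "v (Suc i) = (\<lambda>s. snd (c s) i)" for i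
    by (auto simp: v_def)
  define thr where "thr t j n =
    (SOME s. s \<in> underS r t \<and> (\<forall>u\<in>underS r t. (s, u) \<in> r \<longrightarrow> n \<le> v j u))" for t j n
  define wit where "wit s t j n = (SOME u. u \<in> underS r t \<and> (s, u) \<in> r \<and> v j u < n)" for s t j n
  define F where "F i s t = (case prod_decode i of
      (0, q) \<Rightarrow> (case q of 0 \<Rightarrow> (SOME u. is_pred r t u) | Suc _ \<Rightarrow> (SOME u. is_pred r u t))
    | (Suc 0, q) \<Rightarrow> (case prod_decode q of (j, n) \<Rightarrow> thr t j n)
    | (Suc (Suc _), q) \<Rightarrow> (case prod_decode q of (j, n) \<Rightarrow> wit s t j n))" for i s t
  obtain H0 where H0: "countable H0" "m \<in> H0"
    and cl: "\<And>i s t. s \<in> H0 \<Longrightarrow> t \<in> H0 \<Longrightarrow> F i s t \<in> H0"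
    using countable_closure[of m F] by blast
  define H where "H = H0 \<inter> Field r"
  define r' where "r' = Restr r H"
  have HF: "H \<subseteq> Field r" by (auto simp: H_def)
  have Fr': "Field r' = H"
    unfolding r'_def using HF W.REFL by (rule Refl_Field_Restr2[rotated])
  have wo': "Well_order r'" unfolding r'_def using wo by (rule Well_order_Restr)
  have uF: "u \<in> Field r" if "u \<in> underS r t" for u t
    using that by (auto simp: underS_def Field_def)
  have uS': "underS r' t = underS r t \<inter> H" if "t \<in> H" for t
    using that by (auto simp: r'_def underS_def)
  have r'_iff: "(s, t) \<in> r' \<longleftrightarrow> (s, t) \<in> r" if "s \<in> H" "t \<in> H" for s t
    using that by (simp add: r'_def)
  have pred_unique: "s = s'" if "is_pred r s t" "is_pred r s' t" for s s' t
    using that W.ANTISYM by (auto simp: is_pred_def antisym_def)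
  have succ_unique: "t = t'" if "is_pred r s t" "is_pred r s t'" for s t t'
  proof (rule ccontr)
    assume ne: "t \<noteq> t'"
    have "t \<in> Field r" "t' \<in> Field r" using that by (auto simp: is_pred_def underS_def Field_def)
    then have "t \<in> underS r t' \<or> t' \<in> underS r t" using ne W.TOTALS by (auto simp: underS_def)
    with that show False using W.ANTISYM by (auto simp: is_pred_def underS_def antisym_def)
  qed
  have succ_ex: "\<exists>u. is_pred r s u" if "s \<in> underS r t" for s t
  proof -
    define A where "A = {u \<in> Field r. s \<in> underS r u}"
    have A: "A \<subseteq> Field r" "A \<noteq> {}"
      using that by (auto simp: A_def underS_def Field_def)
    define u where "u = W.minim A"
    have u: "u \<in> A" "\<And>b. b \<in> A \<Longrightarrow> (u, b) \<in> r"
      using A by (auto simp: u_def W.minim_in W.minim_least)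
    have "(w, s) \<in> r" if w: "w \<in> underS r u" for w
    proof (rule ccontr)
      assume n: "(w, s) \<notin> r"
      have wF: "w \<in> Field r" using w uF by blast
      have sF: "s \<in> Field r" using u(1) uF by (auto simp: A_def)
      from n wF sF have "(s, w) \<in> r" using W.TOTALS by blast
      moreover have "s \<noteq> w" using n wF W.REFL by (auto simp: refl_on_def)
      ultimately have "w \<in> A" using wF by (auto simp: A_def underS_def)
      then have "(u, w) \<in> r" by (rule u(2))
      with w show False using W.ANTISYM by (auto simp: underS_def antisym_def)
    qed
    then have "is_pred r s u" using u(1) by (auto simp: is_pred_def A_def)
    then show ?thesis ..
  qed
  have cl_succ: "u \<in> H" if "s \<in> H" "is_pred r s u" for s u
  proof -
    have "(SOME u. is_pred r s u) = u" using that succ_unique by blast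
    then have "u \<in> H0" using cl[of s s "prod_encode (0, 0)"] that by (simp add: F_def H_def)
    then show ?thesis using that(2) by (auto simp: H_def is_pred_def underS_def Field_def)
  qed
  have cl_pred: "s \<in> H" if "t \<in> H" "is_pred r s t" for s t
  proof -
    have "(SOME u. is_pred r u t) = s" using that pred_unique by blast
    then have "s \<in> H0" using cl[of t t "prod_encode (0, Suc 0)"] that by (simp add: F_def H_def)
    then show ?thesis using that(2) by (auto simp: H_def is_pred_def underS_def Field_def)
  qed
  have cl_thr: "\<exists>s\<in>underS r t \<inter> H. \<forall>u\<in>underS r t. (s, u) \<in> r \<longrightarrow> n \<le> v j u"
    if "t \<in> H" "\<exists>s\<in>underS r t. \<forall>u\<in>underS r t. (s, u) \<in> r \<longrightarrow> n \<le> v j u" for t j n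
  proof -
    have *: "thr t j n \<in> underS r t \<and> (\<forall>u\<in>underS r t. (thr t j n, u) \<in> r \<longrightarrow> n \<le> v j u)"
      unfolding thr_def by (rule someI_ex) (use that(2) in blast)
    have "thr t j n \<in> H0"
      using cl[of t t "prod_encode (Suc 0, prod_encode (j, n))"] that(1) by (simp add: F_def H_def)
    then have "thr t j n \<in> H" using * uF by (auto simp: H_def)
    with * show ?thesis by blast
  qed
  have cl_wit: "\<exists>u\<in>underS r t \<inter> H. (s, u) \<in> r \<and> v j u < n"
    if "t \<in> H" "s \<in> H" "\<exists>u\<in>underS r t. (s, u) \<in> r \<and> v j u < n" for s t j n
  proof -
    have *: "wit s t j n \<in> underS r t \<and> (s, wit s t j n) \<in> r \<and> v j (wit s t j n) < n"
      unfolding wit_def by (rule someI_ex) (use that(3) in blast)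
    have "wit s t j n \<in> H0"
      using cl[of s t "prod_encode (Suc (Suc 0), prod_encode (j, n))"] that(1,2)
      by (simp add: F_def H_def)
    then have "wit s t j n \<in> H" using * uF by (auto simp: H_def)
    with * show ?thesis by blast
  qed
  have ne': "underS r t \<inter> H \<noteq> {}" if "t \<in> H" "underS r t \<noteq> {}" for t
    using cl_thr[of t 0 0] that by auto
  have pred': "is_pred r' s t \<longleftrightarrow> is_pred r s t" if t: "t \<in> H" for s t
  proof
    assume p: "is_pred r s t"
    then have "s \<in> H" using t cl_pred by blast
    then show "is_pred r' s t" using p t by (auto simp: is_pred_def uS' r'_iff)
  next
    assume p: "is_pred r' s t"
    then have s: "s \<in> H" "s \<in> underS r t" using t by (auto simp: is_pred_def uS')
    then obtain u where u: "is_pred r s u" using succ_ex by blast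
    have uH: "u \<in> H" using cl_succ s u by blast
    have "u = t"
    proof (rule ccontr)
      assume "u \<noteq> t"
      moreover have "(u, t) \<in> r \<or> (t, u) \<in> r" using uH t HF W.TOTALS by blast
      ultimately have "u \<in> underS r t \<or> t \<in> underS r u" by (auto simp: underS_def)
      then show False
      proof
        assume "u \<in> underS r t"
        then have "(u, s) \<in> r" using p uH t s(1) by (auto simp: is_pred_def uS' r'_iff)
        with u show False using W.ANTISYM by (auto simp: is_pred_def underS_def antisym_def)
      next
        assume "t \<in> underS r u"
        then have "(t, s) \<in> r" using u by (auto simp: is_pred_def)
        with s show False using W.ANTISYM by (auto simp: underS_def antisym_def)
      qed
    qed
    with u show "is_pred r s t" by simp
  qed
  have lim': "limit_value r' t (v j) = limit_value r t (v j)"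
    if t: "t \<in> H" "underS r t \<noteq> {}" for t j
  proof -
    have "liminf_at r' t (v j) = liminf_at r t (v j)"
    proof (rule enat_eqI)
      fix n
      have "(\<exists>s\<in>underS r t \<inter> H. \<forall>u\<in>underS r t \<inter> H. (s, u) \<in> r' \<longrightarrow> n \<le> v j u) \<longleftrightarrow>
            (\<exists>s\<in>underS r t. \<forall>u\<in>underS r t. (s, u) \<in> r \<longrightarrow> n \<le> v j u)" (is "?L \<longleftrightarrow> ?R")
      proof
        assume ?L
        then obtain s where s: "s \<in> underS r t" "s \<in> H"
          and le: "\<And>u. u \<in> underS r t \<inter> H \<Longrightarrow> (s, u) \<in> r \<Longrightarrow> n \<le> v j u"
          by (auto simp: r'_iff)
        have "\<not> (\<exists>u\<in>underS r t. (s, u) \<in> r \<and> v j u < n)"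
          using cl_wit[OF t(1) s(2)] le by (meson not_le)
        then show ?R using s(1) by (meson not_le)
      next
        assume ?R
        from cl_thr[OF t(1) this] show ?L by (auto simp: r'_def)
      qed
      then show "enat n \<le> liminf_at r' t (v j) \<longleftrightarrow> enat n \<le> liminf_at r t (v j)"
        using t ne' by (simp add: enat_le_liminf_at uS')
    qed
    then show ?thesis by (simp add: limit_value_def)
  qed
  have "itrm_computation r' P x c"
    unfolding itrm_computation_def
  proof (intro conjI ballI allI impI)
    show "Well_order r'" by (rule wo')
  next
    fix t assume "t \<in> Field r'" "underS r' t = {}"
    then have "t \<in> Field r" "underS r t = {}" using ne' HF by (auto simp: Fr' uS')
    then show "c t = (0, \<lambda>_. 0)" using comp by (simp add: itrm_computation_def)
  next
    fix s t assume p: "is_pred r' s t"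
    then have "t \<in> H" unfolding is_pred_def underS_def Fr'[symmetric] by (auto simp: Field_def)
    with p have p': "is_pred r s t" by (simp add: pred')
    then show "fst (c s) < length P" "c t = exec_instr x (P ! fst (c s)) (c s)"
      using comp by (auto simp: itrm_computation_def)
  next
    fix t assume l: "is_limit r' t"
    then have t: "t \<in> H" by (simp add: is_limit_def Fr')
    have l': "is_limit r t" using l t HF by (auto simp: is_limit_def Fr' pred' uS')
    have ne: "underS r t \<noteq> {}" using l' by (simp add: is_limit_def)
    have "c t = (limit_value r t (v 0), \<lambda>i. limit_value r t (v (Suc i)))"
      using comp l' by (simp add: itrm_computation_def v)
    also have "\<dots> = (limit_value r' t (v 0), \<lambda>i. limit_value r' t (v (Suc i)))"
      using lim'[OF t ne] by simp
    finally show "c t = (limit_value r' t (\<lambda>s. fst (c s)), \<lambda>i. limit_value r' t (\<lambda>s. snd (c s) i))"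
      by (simp add: v)
  qed
  moreover have "m \<in> H" using H0 m by (simp add: H_def)
  moreover have "\<forall>s\<in>H. (s, m) \<in> r'" using \<open>m \<in> H\<close> m_max HF by (auto simp: r'_iff)
  ultimately have "itrm_halts_along r' P x k"
    unfolding itrm_halts_along_def Fr' using out by blast
  moreover have "countable (Field r')" using H0 by (simp add: Fr' H_def)
  ultimately show thesis by (rule that[rotated])
qed

lemma itrm_halts_along_dir_image:
  fixes r :: "'s rel" and f :: "'s \<Rightarrow> 't"
  assumes "itrm_halts_along r P x k" and inj: "inj_on f (Field r)"
  shows "itrm_halts_along (dir_image r f) P x k"
proof -
  obtain c m where comp: "itrm_computation r P x c" and m: "m \<in> Field r"
    and m_max: "\<And>s. s \<in> Field r \<Longrightarrow> (s, m) \<in> r"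
    and out: "length P \<le> fst (c m)" "snd (c m) 0 = k"
    using assms unfolding itrm_halts_along_def by blast
  have wo: "Well_order r" using comp by (simp add: itrm_computation_def)
  define r' where "r' = dir_image r f"
  define d where "d = (\<lambda>t. c (inv_into (Field r) f t))"
  have d: "d (f t) = c t" if "t \<in> Field r" for t using that inj by (simp add: d_def)
  have Fr': "Field r' = f ` Field r" by (simp add: r'_def dir_image_Field)
  have wo': "Well_order r'" unfolding r'_def using wo inj by (rule Well_order_dir_image)
  have uF: "u \<in> Field r" if "u \<in> underS r t" for u t
    using that by (auto simp: underS_def Field_def)
  have r'_iff: "(f s, f t) \<in> r' \<longleftrightarrow> (s, t) \<in> r" if "s \<in> Field r" "t \<in> Field r" for s t
  proof
    assume "(f s, f t) \<in> r'"
    then obtain a b where ab: "(a, b) \<in> r" "f s = f a" "f t = f b"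
      by (auto simp: r'_def dir_image_def)
    then have "a \<in> Field r" "b \<in> Field r" by (auto simp: Field_def)
    with ab that inj have "s = a" "t = b" by (auto dest: inj_onD)
    with ab show "(s, t) \<in> r" by simp
  qed (auto simp: r'_def dir_image_def)
  have uS': "underS r' (f t) = f ` underS r t" if t: "t \<in> Field r" for t
  proof (intro equalityI subsetI)
    fix u' assume u': "u' \<in> underS r' (f t)"
    then have "u' \<in> Field r'" by (auto simp: underS_def Field_def)
    then obtain u where u: "u \<in> Field r" "u' = f u" by (auto simp: Fr')
    with u' t have "u \<in> underS r t" by (auto simp: underS_def r'_iff)
    with u show "u' \<in> f ` underS r t" by blast
  next
    fix u' assume "u' \<in> f ` underS r t"
    then obtain u where u: "u \<in> underS r t" "u' = f u" by blast
    then have "f u \<noteq> f t" using inj t uF by (auto simp: underS_def dest: inj_onD)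
    with u t uF[OF u(1)] show "u' \<in> underS r' (f t)" by (auto simp: underS_def r'_iff)
  qed
  have pred': "is_pred r' (f s) (f t) \<longleftrightarrow> is_pred r s t" if "s \<in> Field r" "t \<in> Field r" for s t
  proof -
    have "f s \<in> f ` underS r t \<longleftrightarrow> s \<in> underS r t"
      using that inj uF by (auto dest: inj_onD)
    then show ?thesis using that uF by (auto simp: is_pred_def uS' r'_iff)
  qed
  have pred_img: "\<exists>s\<in>Field r. s' = f s" if "is_pred r' s' t'" for s' t'
  proof -
    have "s' \<in> Field r'" using that by (auto simp: is_pred_def underS_def Field_def)
    then show ?thesis by (auto simp: Fr')
  qed
  have pred_img2: "\<exists>t\<in>Field r. t' = f t" if "is_pred r' s' t'" for s' t'
  proof -
    have "t' \<in> Field r'" using that by (auto simp: is_pred_def underS_def Field_def)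
    then show ?thesis by (auto simp: Fr')
  qed
  have lim': "limit_value r' (f t) g = limit_value r t h"
    if t: "t \<in> Field r" and gh: "\<And>s. s \<in> Field r \<Longrightarrow> g (f s) = h s" for t g h
  proof -
    have "{u \<in> underS r' (f t). (f s, u) \<in> r'} = f ` {u \<in> underS r t. (s, u) \<in> r}"
      if "s \<in> underS r t" for s
      using that t uF by (auto simp: uS' r'_iff)
    then have "liminf_at r' (f t) g = liminf_at r t h"
      unfolding liminf_at_def uS'[OF t]
      using gh uF by (auto simp: image_image intro!: SUP_cong INF_cong)
    then show ?thesis by (simp add: limit_value_def)
  qed
  have "itrm_computation r' P x d"
    unfolding itrm_computation_def
  proof (intro conjI ballI allI impI)
    show "Well_order r'" by (rule wo')
  next
    fix t' assume "t' \<in> Field r'" "underS r' t' = {}"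
    then show "d t' = (0, \<lambda>_. 0)" using comp d by (auto simp: itrm_computation_def Fr' uS')
  next
    fix s' t' assume p: "is_pred r' s' t'"
    then obtain s t where st: "s \<in> Field r" "t \<in> Field r" "s' = f s" "t' = f t"
      using pred_img pred_img2 by blast
    with p have "is_pred r s t" by (simp add: pred')
    then show "fst (d s') < length P" "d t' = exec_instr x (P ! fst (d s')) (d s')"
      using comp st d by (auto simp: itrm_computation_def)
  next
    fix t' assume l: "is_limit r' t'"
    then obtain t where t: "t \<in> Field r" "t' = f t" by (auto simp: is_limit_def Fr')
    have "\<not> is_pred r s t" for s
      using l t pred'[of s t] uF by (auto simp: is_limit_def is_pred_def)
    then have "is_limit r t" using l t by (auto simp: is_limit_def uS')
    then show "d t' = (limit_value r' t' (\<lambda>s. fst (d s)), \<lambda>i. limit_value r' t' (\<lambda>s. snd (d s) i))"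
      using comp t d
        lim'[OF t(1), of "\<lambda>s. fst (d s)" "\<lambda>s. fst (c s)"]
        lim'[OF t(1), of "\<lambda>s. snd (d s) i" "\<lambda>s. snd (c s) i" for i]
      by (simp add: itrm_computation_def)
  qed
  moreover have "f m \<in> Field r'" using m by (simp add: Fr')
  moreover have "\<forall>s\<in>Field r'. (s, f m) \<in> r'" using m m_max by (auto simp: Fr' r'_iff)
  ultimately show ?thesis
    unfolding itrm_halts_along_def r'_def[symmetric] using out d[OF m] by metis
qed

lemma itrm_computesI:
  fixes r :: "'t rel"
  assumes "itrm_halts_along r P x k"
  shows "itrm_computes P x k"
proof -
  obtain r' :: "'t rel" where r': "countable (Field r')" "itrm_halts_along r' P x k"
    using itrm_halts_along_countable[OF assms] .
  have "inj_on (to_nat_on (Field r')) (Field r')" using r'(1) by (rule inj_on_to_nat_on)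
  with r'(2) have "itrm_halts_along (dir_image r' (to_nat_on (Field r'))) P x k"
    by (rule itrm_halts_along_dir_image)
  then show ?thesis unfolding itrm_computes_def by blast
qed

lemma itrm_computes_iff:
  assumes "infinite (UNIV :: 't set)"
  shows "itrm_computes P x k \<longleftrightarrow> (\<exists>r :: 't rel. itrm_halts_along r P x k)"
proof
  assume "itrm_computes P x k"
  then obtain r :: "nat rel" where "itrm_halts_along r P x k" by (auto simp: itrm_computes_def)
  moreover obtain f :: "nat \<Rightarrow> 't" where "inj f" using infinite_countable_subset[OF assms] by blast
  ultimately show "\<exists>r :: 't rel. itrm_halts_along r P x k"
    using itrm_halts_along_dir_image[of r P x k f] by (meson inj_on_subset subset_UNIV)
qed (use itrm_computesI in blast)

section \<open>Decidability and randomness\<close>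

definition join :: "nat set \<Rightarrow> nat set \<Rightarrow> nat set" where
  "join a b = {2 * i | i. i \<in> a} \<union> {2 * j + 1 | j. j \<in> b}"

definition itrm_decidable :: "nat set set \<Rightarrow> bool" where
  "itrm_decidable X \<longleftrightarrow> (\<exists>P. \<forall>x. itrm_computes P x (if x \<in> X then 1 else 0))"

definition itrm_decidable_in :: "nat set \<Rightarrow> nat set set \<Rightarrow> bool" where
  "itrm_decidable_in y X \<longleftrightarrow> (\<exists>P. \<forall>x. itrm_computes P (join x y) (if x \<in> X then 1 else 0))"

text \<open>The power set of \<open>\<omega>\<close>, identified with \<open>2\<^sup>\<omega>\<close> via characteristic functions.\<close>

definition cantor_topology :: "nat set topology" where
  "cantor_topology = pullback_topology UNIV (\<lambda>x n. n \<in> x)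
     (product_topology (\<lambda>_. discrete_topology (UNIV :: bool set)) UNIV)"

definition nowhere_dense_in :: "'a topology \<Rightarrow> 'a set \<Rightarrow> bool" where
  "nowhere_dense_in T S \<longleftrightarrow> S \<subseteq> topspace T \<and> T interior_of (T closure_of S) = {}"

definition meager_in :: "'a topology \<Rightarrow> 'a set \<Rightarrow> bool" where
  "meager_in T S \<longleftrightarrow> (\<exists>\<N>. countable \<N> \<and> (\<forall>N\<in>\<N>. nowhere_dense_in T N) \<and> S = \<Union>\<N>)"

definition itrm_random :: "nat set \<Rightarrow> bool" where
  "itrm_random x \<longleftrightarrow> \<not> (\<exists>X. itrm_decidable X \<and> meager_in cantor_topology X \<and> x \<in> X)"

definition itrm_random_rel :: "nat set \<Rightarrow> nat set \<Rightarrow> bool" where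
  "itrm_random_rel x y \<longleftrightarrow>
     \<not> (\<exists>X. meager_in cantor_topology X \<and> x \<in> X \<and> itrm_decidable_in y X)"

end

theory Submission
  imports Defs
begin

text \<open>
  Randomness of \<open>a\<close> is easy: if \<open>a\<close> lies in a decidable meager set \<open>X\<close>, then \<open>a \<oplus> b\<close> lies in the
  decidable meager set \<open>{y \<oplus> x | y \<in> X}\<close>.

  If \<open>P\<close> decides the meager set \<open>X \<ni> b\<close> in the oracle \<open>a\<close>, then for \<open>y \<noteq> a\<close> the set \<open>X y\<close> of all \<open>x\<close>
  accepted by \<open>P\<close> in the oracle \<open>x \<oplus> y\<close> may be non-meager, and \<open>P\<close> may fail to halt.  So we consider the
  set \<open>Y\<close> of all \<open>y \<oplus> x\<close> such that \<open>x \<in> X y\<close>, but no finite condition satisfied by \<open>x\<close> forces this in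
  the sense of category.  Since \<open>X a\<close> is meager, no condition forces membership in it, and
  \<open>a \<oplus> b \<in> Y\<close>.  All sections of \<open>Y\<close> are meager, hence so is \<open>Y\<close> by the Kuratowski-Ulam theorem.

  It remains to decide \<open>Y\<close>.  Consider the class of relations generated from computable ones by
  Boolean operations and the quantifier ``on every branch there is an initial segment such that''.
  It is closed under inductive definitions.  Its members are decidable, by a depth-first search in
  which an infinite branch shows up as a register overflow.  It is closed under the forcing relation,
  because the forcing relation for an inductively defined set is again inductively defined.  Finally
  it contains the halting relation of every program: the relation that \<open>P\<close> leads from one configuration
  to another is obtained by iterated inductive definitions, where the iteration is along the set of
  registers allowed to overflow at limit times.  An overflow of a register \<open>j\<close> is preceded by an
  interval without overflows of \<open>j\<close>, so the configuration after it is determined by the relation for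
  one register less.
\<close>

section \<open>Countable ordinal time\<close>

text \<open>\<open>P\<close> is only known to halt in the oracle \<open>a\<close>, so
  \<open>Y\<close> cannot be decided by simulating \<open>P\<close>: the halting of \<open>P\<close>
  has to become part of a decidable question. The class \<open>definable\<close> mediates between
  machines and category. Its quantifier is the dual of the Suslin operation, which preserves the
  Baire property; closure of the class under forcing is an effective form of this fact. The Baire
  property is also what makes meager sections sufficient: a definable set that is not meager is
  comeager in some cylinder, and then one of its sections is not meager. Reachability is not a
  single inductive definition. A limit without overflow can be described positively, by guessing the
  limit state and asking for a run that stays above it and attains each of its components again and
  again. An overflow says that a register finally exceeds every bound for the rest of the approach
  to the limit, so that reachability also occurs negatively; this is why the inductive definition
  has to be iterated.\<close>

typedef ctime = "Field (cardSuc natLeq)"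
  using cardSuc_finite[OF natLeq_Card_order] by (metis Field_natLeq ex_in_conv finite.emptyI infinite_UNIV_nat)

lemma wo_cardSuc_natLeq: "Well_order (cardSuc natLeq)"
  using cardSuc_Card_order[OF natLeq_Card_order] by (simp add: card_order_on_def)

instantiation ctime :: wellorder
begin

definition less_eq_ctime :: "ctime \<Rightarrow> ctime \<Rightarrow> bool" where
  "s \<le> t \<longleftrightarrow> (Rep_ctime s, Rep_ctime t) \<in> cardSuc natLeq"

definition less_ctime :: "ctime \<Rightarrow> ctime \<Rightarrow> bool" where
  "(s::ctime) < t \<longleftrightarrow> s \<le> t \<and> s \<noteq> t"

instance
proof -
  interpret W: wo_rel "cardSuc natLeq :: nat set rel"
    using wo_cardSuc_natLeq by (simp add: wo_rel_def)
  have anti: "s = t" if "s \<le> t" "t \<le> s" for s t :: ctime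
    using that antisymD[OF W.ANTISYM] by (simp add: less_eq_ctime_def Rep_ctime_inject[symmetric])
  show "OFCLASS(ctime, wellorder_class)"
  proof
    fix s t u :: ctime
    show "s < t \<longleftrightarrow> s \<le> t \<and> \<not> t \<le> s" using anti by (auto simp: less_ctime_def)
    show "s \<le> s" using W.REFL Rep_ctime by (auto simp: less_eq_ctime_def refl_on_def)
    show "s \<le> t \<Longrightarrow> t \<le> u \<Longrightarrow> s \<le> u" using W.TRANS by (auto simp: less_eq_ctime_def trans_def)
    show "s \<le> t \<Longrightarrow> t \<le> s \<Longrightarrow> s = t" by (rule anti)
    show "s \<le> t \<or> t \<le> s" using W.TOTALS Rep_ctime by (auto simp: less_eq_ctime_def)
  next
    fix P :: "ctime \<Rightarrow> bool" and a :: ctime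
    assume step: "\<And>x. (\<And>y. y < x \<Longrightarrow> P y) \<Longrightarrow> P x"
    have "wf {(s, t). s < (t::ctime)}"
    proof (rule wf_subset)
      show "wf (inv_image (cardSuc natLeq - Id) Rep_ctime)"
        using W.WF by (rule wf_inv_image)
    qed (auto simp: less_ctime_def less_eq_ctime_def inv_image_def Rep_ctime_inject)
    then show "P a" by (rule wf_induct_rule) (use step in auto)
  qed
qed

end

text \<open>Regularity of \<omega>_1, the order type of \<open>ctime\<close>. It is what makes the
  least strict upper bounds exist in \<open>tsup\<close> and in the collapse of a well-order of
  numbers.\<close>

lemma countable_ctime_bounded:
  fixes A :: "ctime set"
  assumes "countable A"
  shows "\<exists>b. \<forall>a\<in>A. a < b"
proof -
  let ?r = "cardSuc natLeq :: nat set rel"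
  have inf: "infinite (Field natLeq)" by (simp add: Field_natLeq)
  have c: "Card_order ?r" "infinite (Field ?r)"
    using cardSuc_Card_order[OF natLeq_Card_order] cardSuc_finite[OF natLeq_Card_order] inf by auto
  have lim: "\<exists>b. a < b" for a :: ctime
  proof -
    obtain y where "y \<in> Field ?r" "Rep_ctime a \<noteq> y" "(Rep_ctime a, y) \<in> ?r"
      using infinite_Card_order_limit[OF c Rep_ctime] by blast
    then have "a < Abs_ctime y"
      by (auto simp: less_ctime_def less_eq_ctime_def Abs_ctime_inverse)
    then show ?thesis ..
  qed
  have "\<exists>i\<in>Field ?r. Rep_ctime ` A \<subseteq> under ?r i"
  proof (rule cardSuc_UNION[OF natLeq_Card_order inf])
    show "relChain ?r (under ?r)"
      using wo_cardSuc_natLeq unfolding relChain_def under_def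
      by (auto simp: well_order_on_def linear_order_on_def partial_order_on_def preorder_on_def
          dest: transD)
    show "Rep_ctime ` A \<subseteq> (\<Union>i\<in>Field ?r. under ?r i)"
    proof clarify
      fix a :: ctime
      have "(Rep_ctime a, Rep_ctime a) \<in> ?r" using order_refl[of a] unfolding less_eq_ctime_def .
      then show "Rep_ctime a \<in> (\<Union>i\<in>Field ?r. under ?r i)"
        using Rep_ctime[of a] by (auto simp: under_def)
    qed
    have "countable (Rep_ctime ` A)" using assms by simp
    then have "(card_of (Rep_ctime ` A), card_of (UNIV :: nat set)) \<in> ordLeq"
      unfolding countable_def card_of_ordLeq[symmetric] by blast
    then show "(card_of (Rep_ctime ` A), natLeq) \<in> ordLeq"
      using card_of_nat ordLeq_ordIso_trans by blast
  qed
  then obtain i where i: "i \<in> Field ?r" "\<And>a. a \<in> A \<Longrightarrow> (Rep_ctime a, i) \<in> ?r"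
    by (auto simp: under_def)
  then have "a \<le> Abs_ctime i" if "a \<in> A" for a
    using that by (simp add: less_eq_ctime_def Abs_ctime_inverse)
  moreover obtain b where "Abs_ctime i < b" using lim by blast
  ultimately show ?thesis by (meson le_less_trans)
qed

section \<open>Successors, suprema and inferior limits of countable times\<close>

definition tsuc :: "ctime \<Rightarrow> ctime" where
  "tsuc t = (LEAST u. t < u)"

lemma less_tsuc [simp]: "t < tsuc t"
proof -
  obtain b where "t < b" using countable_ctime_bounded[of "{t}"] by auto
  then show ?thesis unfolding tsuc_def by (rule LeastI)
qed

lemma tsuc_le_iff: "tsuc t \<le> u \<longleftrightarrow> t < u"
  by (metis Least_le less_le_trans less_tsuc tsuc_def)

lemma less_tsuc_iff: "s < tsuc t \<longleftrightarrow> s \<le> t"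
  by (meson leD leI tsuc_le_iff)

lemma tsuc_inject [simp]: "tsuc s = tsuc t \<longleftrightarrow> s = t"
  by (metis less_tsuc less_tsuc_iff order_antisym)

definition tlimit :: "ctime \<Rightarrow> bool" where
  "tlimit t \<longleftrightarrow> (\<exists>s. s < t) \<and> (\<forall>s<t. tsuc s < t)"

lemma ctime_cases [case_names zero suc lim]:
  obtains "\<And>s. \<not> s < t" | s where "t = tsuc s" | "tlimit t"
  by (metis antisym_conv2 leI tlimit_def tsuc_le_iff)

lemma not_tlimit_tsuc [simp]: "\<not> tlimit (tsuc s)"
  unfolding tlimit_def by (meson less_irrefl less_tsuc)

lemma tlimit_not_zero: "tlimit t \<Longrightarrow> \<exists>s. s < t"
  by (simp add: tlimit_def)

lemma tlimit_tsuc_less: "tlimit t \<Longrightarrow> s < t \<Longrightarrow> tsuc s < t"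
  by (simp add: tlimit_def)

definition tsup :: "(nat \<Rightarrow> ctime) \<Rightarrow> ctime" where
  "tsup f = (LEAST u. \<forall>k. f k < u)"

lemma less_tsup: "f k < tsup f"
proof -
  obtain b where "\<forall>a\<in>range f. a < b"
    using countable_ctime_bounded[of "range f"] by auto
  then have "\<forall>k. f k < b" by auto
  then have "\<forall>k. f k < tsup f" unfolding tsup_def by (rule LeastI)
  then show ?thesis ..
qed

lemma less_tsupD:
  assumes "s < tsup f"
  obtains k where "s \<le> f k"
proof -
  have "\<not> (\<forall>k. f k < s)"
    using assms not_less_Least unfolding tsup_def by blast
  then show thesis using that by (meson not_less)
qed

lemma tlimit_tsup:
  assumes "\<And>k. f k < f (Suc k)"
  shows "tlimit (tsup f)"
  unfolding tlimit_def
proof (intro conjI allI impI)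
  show "\<exists>s. s < tsup f" using less_tsup by blast
  fix s assume "s < tsup f"
  then obtain k where "s \<le> f k" by (rule less_tsupD)
  then have "tsuc s \<le> f (Suc k)" using assms[of k] by (simp add: tsuc_le_iff)
  then show "tsuc s < tsup f" using less_tsup by (rule le_less_trans)
qed

text \<open>The least \<open>v\<close> with this property is the limit inferior of \<open>f\<close>.
  If there is none, the limit inferior is infinite, and the 0 in \<open>tlim\<close> is the reset of
  an overflowing register.\<close>

definition tcof :: "ctime \<Rightarrow> (ctime \<Rightarrow> nat) \<Rightarrow> nat \<Rightarrow> bool" where
  "tcof t f v \<longleftrightarrow> (\<forall>s<t. \<exists>u\<ge>s. u < t \<and> f u \<le> v)"

definition tlim :: "ctime \<Rightarrow> (ctime \<Rightarrow> nat) \<Rightarrow> nat" where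
  "tlim t f = (if \<exists>v. tcof t f v then LEAST v. tcof t f v else 0)"

lemma tlim_cong:
  assumes "\<And>s. s < t \<Longrightarrow> f s = g s"
  shows "tlim t f = tlim t g"
proof -
  have "tcof t f = tcof t g"
    unfolding tcof_def fun_eq_iff using assms by metis
  then show ?thesis by (simp add: tlim_def)
qed

lemma tlimI:
  assumes "s < t" "\<And>u. s \<le> u \<Longrightarrow> u < t \<Longrightarrow> v \<le> f u"
    and "\<And>s. s < t \<Longrightarrow> \<exists>u\<ge>s. u < t \<and> f u \<le> v"
  shows "tlim t f = v"
proof -
  have v: "tcof t f v" using assms(3) by (simp add: tcof_def)
  have "(LEAST v. tcof t f v) = v"
  proof (rule Least_equality)
    fix w assume "tcof t f w"
    then show "v \<le> w" using assms(1,2) unfolding tcof_def by (meson order_trans)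
  qed (rule v)
  then show ?thesis using v by (auto simp: tlim_def)
qed

text \<open>A limit inferior is at most \<open>v\<close> iff it fails to be at least
  \<open>Suc v\<close>. This removes \<open>enat\<close> and produces the shape of
  \<open>tlim\<close>.\<close>

lemma limit_value_eq:
  assumes "underS r t \<noteq> {}"
  shows "limit_value r t f =
    (if \<exists>v. \<forall>s\<in>underS r t. \<exists>u\<in>underS r t. (s, u) \<in> r \<and> f u \<le> v
     then LEAST v. \<forall>s\<in>underS r t. \<exists>u\<in>underS r t. (s, u) \<in> r \<and> f u \<le> v else 0)"
proof -
  let ?P = "\<lambda>v. \<forall>s\<in>underS r t. \<exists>u\<in>underS r t. (s, u) \<in> r \<and> f u \<le> v"
  have iff: "liminf_at r t f \<le> enat v \<longleftrightarrow> ?P v" for v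
  proof -
    have "liminf_at r t f \<le> enat v \<longleftrightarrow> \<not> enat (Suc v) \<le> liminf_at r t f"
      by (simp add: Suc_ile_eq not_less)
    also have "\<dots> \<longleftrightarrow> ?P v"
      unfolding enat_le_liminf_at[OF assms] by (auto simp: not_less_eq_eq)
    finally show ?thesis .
  qed
  show ?thesis
  proof (cases "liminf_at r t f")
    case (enat n)
    then have "?P v \<longleftrightarrow> n \<le> v" for v using iff[of v] by simp
    then show ?thesis using enat by (auto simp: limit_value_def intro!: Least_equality[symmetric])
  next
    case infinity
    then have "\<not> (\<exists>v. ?P v)" using iff by simp
    then show ?thesis unfolding limit_value_def infinity by (simp only: if_False enat.case)
  qed
qed

section \<open>The canonical run\<close>

definition halted :: "program \<Rightarrow> config \<Rightarrow> bool" where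
  "halted P c \<longleftrightarrow> length P \<le> fst c"

text \<open>Halted configurations are repeated forever, so that the run is defined at all countable
  times and halting is a property of some time.\<close>

definition nxt :: "program \<Rightarrow> nat set \<Rightarrow> config \<Rightarrow> config" where
  "nxt P z c = (if halted P c then c else exec_instr z (P ! fst c) c)"

definition run_fun :: "program \<Rightarrow> nat set \<Rightarrow> (ctime \<Rightarrow> config) \<Rightarrow> ctime \<Rightarrow> config" where
  "run_fun P z f t =
     (if \<forall>s. \<not> s < t then (0, \<lambda>_. 0)
      else if \<exists>s. t = tsuc s then nxt P z (f (THE s. t = tsuc s))
      else (tlim t (\<lambda>s. fst (f s)), \<lambda>i. tlim t (\<lambda>s. snd (f s) i)))"

definition run :: "program \<Rightarrow> nat set \<Rightarrow> ctime \<Rightarrow> config" where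
  "run P z = wfrec {(s, t). s < t} (run_fun P z)"

lemma run_unfold: "run P z t = run_fun P z (run P z) t"
proof -
  have the: "(THE s. tsuc u = tsuc s) = u" for u by auto
  have "run_fun P z (cut f {(s, t). s < t} t) t = run_fun P z f t" for f
  proof (cases t rule: ctime_cases)
    case zero
    then show ?thesis by (simp add: run_fun_def)
  next
    case (suc s)
    then show ?thesis by (simp add: run_fun_def cut_apply the)
  next
    case lim
    have "tlim t (\<lambda>s. fst (cut f {(s, t). s < t} t s)) = tlim t (\<lambda>s. fst (f s))"
      "tlim t (\<lambda>s. snd (cut f {(s, t). s < t} t s) i) = tlim t (\<lambda>s. snd (f s) i)" for i
      by (rule tlim_cong, simp add: cut_apply)+
    then show ?thesis using lim by (auto simp: run_fun_def)
  qed
  then show ?thesis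
    unfolding run_def by (subst wfrec[OF wf]) simp
qed

lemma run_zero: "(\<And>s. \<not> s < t) \<Longrightarrow> run P z t = (0, \<lambda>_. 0)"
  by (simp add: run_unfold[of _ _ t] run_fun_def)

lemma run_tsuc: "run P z (tsuc t) = nxt P z (run P z t)"
proof -
  have "\<not> (\<forall>s. \<not> s < tsuc t)" using less_tsuc by blast
  then show ?thesis unfolding run_unfold[of _ _ "tsuc t"] run_fun_def by auto
qed

lemma run_tlimit:
  "tlimit t \<Longrightarrow> run P z t = (tlim t (\<lambda>s. fst (run P z s)), \<lambda>i. tlim t (\<lambda>s. snd (run P z s) i))"
  using tlimit_not_zero[of t] not_tlimit_tsuc by (auto simp: run_unfold[of _ _ t] run_fun_def)

lemma run_halted:
  assumes "halted P (run P z s)" "s \<le> t"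
  shows "run P z t = run P z s"
  using assms(2)
proof (induction t rule: less_induct)
  case (less t)
  show ?case
  proof (cases t rule: ctime_cases)
    case zero
    then show ?thesis using less.prems by (metis le_less)
  next
    case (suc u)
    show ?thesis
    proof (cases "s = t")
      case False
      then have "s < tsuc u" using suc less.prems by simp
      then have "s \<le> u" by (simp add: less_tsuc_iff)
      then show ?thesis using less.IH[of u] suc assms(1) by (simp add: run_tsuc nxt_def)
    qed simp
  next
    case lim
    show ?thesis
    proof (cases "s = t")
      case False
      then have st: "s < t" using less.prems by simp
      have eq: "run P z u = run P z s" if "s \<le> u" "u < t" for u using less.IH that by blast
      have "tlim t (\<lambda>u. f (run P z u)) = f (run P z s)" for f :: "config \<Rightarrow> nat"
      proof (rule tlimI[OF st])
        fix v assume "v < t"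
        then have "v \<le> max v s" "max v s < t" "run P z (max v s) = run P z s"
          using eq[of "max v s"] st by auto
        then show "\<exists>u\<ge>v. u < t \<and> f (run P z u) \<le> f (run P z s)"
          by (intro exI[of _ "max v s"]) (simp del: max_less_iff_conj)
      next
        fix u assume "s \<le> u" "u < t"
        from eq[OF this] show "f (run P z s) \<le> f (run P z u)" by simp
      qed
      from this[of fst] this[of "\<lambda>c. snd c i" for i] show ?thesis
        using run_tlimit[OF lim, of P z] by (simp add: prod_eq_iff)
    qed simp
  qed
qed

lemma underS_le_on: "underS {(s, t). s \<le> t \<and> t \<le> h} t = (if t \<le> h then {s. s < t} else {})"
  for h :: "'a::order"
  by (auto simp: underS_def)

text \<open>Cut the run at its first halting time. No earlier configuration is halted, as
  \<open>itrm_computation\<close> demands of every predecessor, so this segment is a computation on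
  the well-order of the times up to the cut.\<close>

lemma itrm_computes_if_run:
  assumes "halted P (run P z t)"
  shows "itrm_computes P z (snd (run P z t) 0)"
proof -
  define h where "h = (LEAST t. halted P (run P z t))"
  have h: "halted P (run P z h)" using assms unfolding h_def by (rule LeastI)
  have hl: "\<not> halted P (run P z s)" if "s < h" for s
    using that not_less_Least unfolding h_def by blast
  have ht: "h \<le> t" using assms unfolding h_def by (rule Least_le)
  define r where "r = {(s, t). s \<le> t \<and> t \<le> h}"
  have F: "Field r = {..h}" by (auto simp: r_def Field_def)
  have wo: "Well_order r"
    unfolding well_order_on_def linear_order_on_def partial_order_on_def preorder_on_def F
  proof (intro conjI)
    show "wf (r - Id)"
      by (rule wf_subset[OF wf]) (auto simp: r_def)
  qed (auto simp: r_def refl_on_def trans_def antisym_def total_on_def)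
  have uS: "underS r t = {s. s < t}" if "t \<le> h" for t
    using that by (simp add: r_def underS_le_on)
  have pred: "is_pred r s t \<longleftrightarrow> t = tsuc s \<and> t \<le> h" for s t
  proof
    assume p: "is_pred r s t"
    then have th: "t \<le> h" by (auto simp: is_pred_def underS_def r_def)
    with p have "s < t" "\<And>u. u < t \<Longrightarrow> u \<le> s"
      unfolding is_pred_def uS[OF th] by (auto simp: r_def)
    then have "t = tsuc s" by (metis antisym_conv2 leD less_tsuc tsuc_le_iff)
    with th show "t = tsuc s \<and> t \<le> h" by simp
  next
    assume t: "t = tsuc s \<and> t \<le> h"
    then have "tsuc s \<le> h" by blast
    then have "s < h" by (rule less_le_trans[OF less_tsuc])
    moreover from t have "underS r t = {u. u \<le> s}" using uS[of t] less_tsuc_iff by auto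
    ultimately show "is_pred r s t" unfolding is_pred_def by (auto simp: r_def)
  qed
  have "itrm_computation r P z (run P z)"
    unfolding itrm_computation_def
  proof (intro conjI ballI allI impI)
    fix t assume "t \<in> Field r" "underS r t = {}"
    then show "run P z t = (0, \<lambda>_. 0)" using uS[of t] by (intro run_zero) (simp add: F)
  next
    fix s t assume "is_pred r s t"
    then have "t = tsuc s" "t \<le> h" using pred by blast+
    moreover from this have "s < h" using less_le_trans[OF less_tsuc[of s], of h] by simp
    ultimately show "fst (run P z s) < length P" "run P z t = exec_instr z (P ! fst (run P z s)) (run P z s)"
      using hl[of s] by (simp_all add: halted_def run_tsuc nxt_def)
  next
    fix t assume l: "is_limit r t"
    then have t: "t \<le> h" by (simp add: is_limit_def F)
    have ne: "underS r t \<noteq> {}" using l by (simp add: is_limit_def)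
    have "tlimit t"
    proof (cases t rule: ctime_cases)
      case zero
      then show ?thesis using ne uS[OF t] by auto
    next
      case (suc s)
      then have "is_pred r s t" using pred t by blast
      then show ?thesis using l unfolding is_limit_def by blast
    qed
    moreover have "limit_value r t f = tlim t f" for f
    proof -
      have "(\<forall>s\<in>underS r t. \<exists>u\<in>underS r t. (s, u) \<in> r \<and> f u \<le> v) \<longleftrightarrow> tcof t f v" for v
      proof -
        have "(s, u) \<in> r \<longleftrightarrow> s \<le> u" if "u < t" for s u
          using order_trans[OF less_imp_le[OF that] t] by (simp add: r_def)
        then show ?thesis unfolding uS[OF t] tcof_def by auto
      qed
      then show ?thesis unfolding limit_value_eq[OF ne] tlim_def by (simp only:)
    qed
    ultimately show "run P z t =
        (limit_value r t (\<lambda>s. fst (run P z s)), \<lambda>i. limit_value r t (\<lambda>s. snd (run P z s) i))"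
      by (simp add: run_tlimit)
  qed (rule wo)
  then have "itrm_halts_along r P z (snd (run P z h) 0)"
    unfolding itrm_halts_along_def using h
    by (intro exI[of _ "run P z"] exI[of _ h]) (simp add: F, simp add: r_def halted_def)
  then show ?thesis using itrm_computesI run_halted[OF h ht] by simp
qed

lemma run_if_itrm_computes:
  assumes "itrm_computes P z k"
  obtains t where "halted P (run P z t)" "snd (run P z t) 0 = k"
proof -
  obtain r :: "nat rel" and c m where comp: "itrm_computation r P z c" and m: "m \<in> Field r"
    and out: "length P \<le> fst (c m)" "snd (c m) 0 = k"
    using assms unfolding itrm_computes_def itrm_halts_along_def by blast
  have wo: "Well_order r" using comp by (simp add: itrm_computation_def)
  then interpret W: wo_rel r by (simp add: wo_rel_def)
  \<comment> \<open>The Mostowski collapse of \<open>r\<close>: it maps the times of the given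
    computation onto an initial segment of \<open>ctime\<close>, preserving successors and
    limits.\<close>
  define \<phi> where "\<phi> = wfrec (r - Id) (\<lambda>f t. LEAST u. \<forall>s\<in>underS r t. f s < (u::ctime))"
  have \<phi>: "\<phi> t = (LEAST u. \<forall>s\<in>underS r t. \<phi> s < u)" for t
  proof -
    have "(\<forall>s\<in>underS r t. cut \<phi> (r - Id) t s < u) = (\<forall>s\<in>underS r t. \<phi> s < u)" for u
      by (auto simp: underS_def cut_apply)
    then show ?thesis unfolding \<phi>_def by (subst wfrec[OF W.WF]) simp
  qed
  have \<phi>_less: "\<phi> s < \<phi> t" if "s \<in> underS r t" for s t
  proof -
    obtain b where "\<forall>a\<in>\<phi> ` underS r t. a < b"
      using countable_ctime_bounded[of "\<phi> ` underS r t"] by auto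
    then have "\<forall>s\<in>underS r t. \<phi> s < b" by auto
    then have "\<forall>s\<in>underS r t. \<phi> s < \<phi> t" unfolding \<phi>[of t] by (rule LeastI)
    then show ?thesis using that by blast
  qed
  have uF: "u \<in> Field r" if "u \<in> underS r t" for u t
    using that by (auto simp: underS_def Field_def)
  have tr: "s \<in> underS r u" if "s \<in> underS r t" "t \<in> underS r u" for s t u
    using that transD[OF W.TRANS] antisymD[OF W.ANTISYM] unfolding underS_def by blast
  have \<phi>_down: "\<exists>s\<in>underS r t. \<tau> = \<phi> s" if "\<tau> < \<phi> t" for \<tau> t
    using W.WF that
  proof (induction t rule: wf_induct_rule)
    case (less t)
    have "\<not> (\<forall>s\<in>underS r t. \<phi> s < \<tau>)"
      using less.prems not_less_Least unfolding \<phi>[of t] by blast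
    then obtain s where s: "s \<in> underS r t" "\<tau> \<le> \<phi> s" by (meson not_less)
    show ?case
    proof (cases "\<tau> = \<phi> s")
      case False
      then have "\<tau> < \<phi> s" using s by simp
      moreover have "(s, t) \<in> r - Id" using s by (auto simp: underS_def)
      ultimately obtain u where "u \<in> underS r s" "\<tau> = \<phi> u" using less.IH by blast
      then show ?thesis using s tr by blast
    qed (use s in auto)
  qed
  have \<phi>_le: "\<phi> s \<le> \<phi> u \<longleftrightarrow> (s, u) \<in> r" if "s \<in> Field r" "u \<in> Field r" for s u
  proof
    assume "\<phi> s \<le> \<phi> u"
    then have "u \<notin> underS r s" using \<phi>_less by (meson not_less)
    then show "(s, u) \<in> r" using that W.TOTALS W.REFL by (auto simp: underS_def refl_on_def)
  next
    assume "(s, u) \<in> r"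
    then show "\<phi> s \<le> \<phi> u" using \<phi>_less[of s u] by (cases "s = u") (auto simp: underS_def)
  qed
  have main: "c t = run P z (\<phi> t)" if "t \<in> Field r" for t
    using W.WF that
  proof (induction t rule: wf_induct_rule)
    case (less t)
    have IH: "c s = run P z (\<phi> s)" if "s \<in> underS r t" for s
      using less.IH that uF[OF that] by (auto simp: underS_def)
    consider "underS r t = {}" | s where "is_pred r s t" | "is_limit r t"
      using less.prems by (auto simp: is_limit_def)
    then show ?case
    proof cases
      case 1
      then have "\<not> \<tau> < \<phi> t" for \<tau> using \<phi>_down[of \<tau> t] by auto
      then show ?thesis using comp 1 less.prems by (simp add: itrm_computation_def run_zero)
    next
      case 2
      then have s: "s \<in> underS r t" "\<And>u. u \<in> underS r t \<Longrightarrow> (u, s) \<in> r" by (auto simp: is_pred_def)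
      have "\<phi> t = tsuc (\<phi> s)"
      proof (rule antisym)
        show "tsuc (\<phi> s) \<le> \<phi> t" using \<phi>_less[OF s(1)] by (simp add: tsuc_le_iff)
        have "\<not> tsuc (\<phi> s) < \<phi> t"
        proof
          assume "tsuc (\<phi> s) < \<phi> t"
          then obtain u where "u \<in> underS r t" "tsuc (\<phi> s) = \<phi> u" using \<phi>_down by blast
          then have "tsuc (\<phi> s) \<le> \<phi> s" using s \<phi>_le uF by metis
          then show False using less_tsuc by (meson not_less)
        qed
        then show "\<phi> t \<le> tsuc (\<phi> s)" by simp
      qed
      moreover have "fst (c s) < length P" "c t = exec_instr z (P ! fst (c s)) (c s)"
        using comp 2 by (auto simp: itrm_computation_def)
      ultimately show ?thesis using IH[OF s(1)] by (auto simp: run_tsuc nxt_def halted_def)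
    next
      case 3
      then have ne: "underS r t \<noteq> {}" by (simp add: is_limit_def)
      have lim: "tlimit (\<phi> t)"
        unfolding tlimit_def
      proof (intro conjI allI impI)
        show "\<exists>s. s < \<phi> t" using ne \<phi>_less by blast
        fix \<tau> assume "\<tau> < \<phi> t"
        then obtain s where s: "s \<in> underS r t" "\<tau> = \<phi> s" using \<phi>_down by blast
        then have "\<not> is_pred r s t" using 3 by (auto simp: is_limit_def)
        then obtain u where u: "u \<in> underS r t" "(u, s) \<notin> r" using s by (auto simp: is_pred_def)
        then have "\<phi> s < \<phi> u" using \<phi>_le uF s(1) by (meson not_le)
        then have "tsuc \<tau> \<le> \<phi> u" using s by (simp add: tsuc_le_iff)
        then show "tsuc \<tau> < \<phi> t" using \<phi>_less[OF u(1)] by (rule le_less_trans)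
      qed
      have "limit_value r t (\<lambda>s. f (c s)) = tlim (\<phi> t) (\<lambda>s. f (run P z s))" for f :: "config \<Rightarrow> nat"
      proof -
        have "(\<forall>s\<in>underS r t. \<exists>u\<in>underS r t. (s, u) \<in> r \<and> f (c u) \<le> v) \<longleftrightarrow>
          tcof (\<phi> t) (\<lambda>s. f (run P z s)) v" for v
          unfolding tcof_def
        proof
          assume L: "\<forall>s\<in>underS r t. \<exists>u\<in>underS r t. (s, u) \<in> r \<and> f (c u) \<le> v"
          show "\<forall>s<\<phi> t. \<exists>u\<ge>s. u < \<phi> t \<and> f (run P z u) \<le> v"
          proof (intro allI impI)
            fix \<tau> assume "\<tau> < \<phi> t"
            then obtain s where s: "s \<in> underS r t" "\<tau> = \<phi> s" using \<phi>_down by blast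
            then obtain u where "u \<in> underS r t" "(s, u) \<in> r" "f (c u) \<le> v" using L by blast
            then show "\<exists>u\<ge>\<tau>. u < \<phi> t \<and> f (run P z u) \<le> v"
              using IH \<phi>_le \<phi>_less s uF by metis
          qed
        next
          assume L: "\<forall>s<\<phi> t. \<exists>u\<ge>s. u < \<phi> t \<and> f (run P z u) \<le> v"
          show "\<forall>s\<in>underS r t. \<exists>u\<in>underS r t. (s, u) \<in> r \<and> f (c u) \<le> v"
          proof
            fix s assume s: "s \<in> underS r t"
            then obtain \<tau> where "\<tau> \<ge> \<phi> s" "\<tau> < \<phi> t" "f (run P z \<tau>) \<le> v" using L \<phi>_less by blast
            then show "\<exists>u\<in>underS r t. (s, u) \<in> r \<and> f (c u) \<le> v"
              using IH \<phi>_le \<phi>_down s uF by metis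
          qed
        qed
        then show ?thesis unfolding limit_value_eq[OF ne] tlim_def by (simp only:)
      qed
      from this[of fst] this[of "\<lambda>c. snd c i" for i] show ?thesis
        using comp 3 run_tlimit[OF lim, of P z] by (simp add: itrm_computation_def)
    qed
  qed
  show thesis using that main[OF m] out by (simp add: halted_def)
qed

lemma itrm_computes_iff_run:
  "itrm_computes P z k \<longleftrightarrow> (\<exists>t. halted P (run P z t) \<and> snd (run P z t) 0 = k)"
  using itrm_computes_if_run run_if_itrm_computes by metis

lemma itrm_computes_unique:
  assumes "itrm_computes P z k" "itrm_computes P z k'"
  shows "k = k'"
proof -
  obtain s t where s: "halted P (run P z s)" "snd (run P z s) 0 = k"
    and t: "halted P (run P z t)" "snd (run P z t) 0 = k'"
    using assms by (auto simp: itrm_computes_iff_run)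
  have "run P z s = run P z t"
    using run_halted[OF s(1), of t] run_halted[OF t(1), of s] by (metis linear)
  with s t show ?thesis by simp
qed

section \<open>A structured language for infinite time register machines\<close>

datatype cmd =
    Skip
  | Do instr
  | Seq cmd cmd (infixr ";;" 60)
  | IfEq nat nat cmd cmd
  | WhileNeq nat nat cmd

fun clen :: "cmd \<Rightarrow> nat" where
  "clen Skip = 0"
| "clen (Do I) = 1"
| "clen (a ;; b) = clen a + clen b"
| "clen (IfEq i j a b) = clen a + clen b + 2"
| "clen (WhileNeq i j a) = clen a + 2"

text \<open>A jump is taken on equality, so the else branch comes first; \<open>Jump 0 0\<close> is
  unconditional. The test of a loop is its smallest line, hence the limit inferior of the lines over
  infinitely many iterations: at limit times the loop resumes at its test.\<close>

fun compile :: "cmd \<Rightarrow> nat \<Rightarrow> program" where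
  "compile Skip L = []"
| "compile (Do I) L = [I]"
| "compile (a ;; b) L = compile a L @ compile b (L + clen a)"
| "compile (IfEq i j a b) L =
     Jump i j (L + 2 + clen b) # compile b (L + 1) @
     Jump 0 0 (L + 2 + clen b + clen a) # compile a (L + 2 + clen b)"
| "compile (WhileNeq i j a) L =
     Jump i j (L + 2 + clen a) # compile a (L + 1) @ [Jump 0 0 L]"

lemma length_compile [simp]: "length (compile c L) = clen c"
  by (induction c arbitrary: L) auto

text \<open>The limit inferior over \<omega> successive segments of a run, where \<open>A k\<close>
  is the set of values in segment \<open>k\<close>; 0 is again the overflow value.\<close>

definition slim :: "(nat \<Rightarrow> nat set) \<Rightarrow> nat" where
  "slim A = (if \<exists>v. \<exists>\<^sub>\<infinity>k. \<exists>a\<in>A k. a \<le> v then LEAST v. \<exists>\<^sub>\<infinity>k. \<exists>a\<in>A k. a \<le> v else 0)"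

text \<open>
  The set argument of \<open>exec\<close> and \<open>iter\<close> collects the register contents at all times from the start
  of the execution up to, but excluding, its end: this is what the limits of enclosing loops depend
  on.  \<open>iter\<close> describes transfinitely many iterations of a loop body.
\<close>

inductive exec :: "nat set \<Rightarrow> cmd \<Rightarrow> (nat \<Rightarrow> nat) \<Rightarrow> (nat \<Rightarrow> nat) set \<Rightarrow> (nat \<Rightarrow> nat) \<Rightarrow> bool"
  and iter :: "nat set \<Rightarrow> nat \<Rightarrow> nat \<Rightarrow> cmd \<Rightarrow> (nat \<Rightarrow> nat) \<Rightarrow> (nat \<Rightarrow> nat) set \<Rightarrow> (nat \<Rightarrow> nat) \<Rightarrow> bool"
  for z where
  exec_Skip: "exec z Skip R {} R"
| exec_Do: "(\<And>i j q. I \<noteq> Jump i j q) \<Longrightarrow> exec z (Do I) R {R} (snd (exec_instr z I (0, R)))"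
| exec_Seq: "exec z a R M S \<Longrightarrow> exec z b S N T \<Longrightarrow> exec z (a ;; b) R (M \<union> N) T"
| exec_IfT: "R i = R j \<Longrightarrow> exec z a R M S \<Longrightarrow> exec z (IfEq i j a b) R (insert R M) S"
| exec_IfF: "R i \<noteq> R j \<Longrightarrow> exec z b R M S \<Longrightarrow> exec z (IfEq i j a b) R (insert R (insert S M)) S"
| exec_While: "iter z i j a R M S \<Longrightarrow> S i = S j \<Longrightarrow> exec z (WhileNeq i j a) R (insert S M) S"
| iter_refl: "iter z i j a R {} R"
| iter_body: "R i \<noteq> R j \<Longrightarrow> exec z a R M S \<Longrightarrow> iter z i j a R (insert R (insert S M)) S"
| iter_trans: "iter z i j a R M S \<Longrightarrow> iter z i j a S N T \<Longrightarrow> iter z i j a R (M \<union> N) T"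
| iter_lim: "(\<And>k. iter z i j a (f k) (M k) (f (Suc k))) \<Longrightarrow> (\<And>k. M k \<noteq> {}) \<Longrightarrow>
    iter z i j a (f 0) (\<Union>k. M k) (\<lambda>n. slim (\<lambda>k. (\<lambda>S. S n) ` M k))"

section \<open>Correctness of the compiler\<close>

definition at_line :: "program \<Rightarrow> cmd \<Rightarrow> nat \<Rightarrow> bool" where
  "at_line P c L \<longleftrightarrow> L + clen c \<le> length P \<and> (\<forall>i<clen c. P ! (L + i) = compile c L ! i)"

lemma at_line_Seq:
  assumes "at_line P (a ;; b) L"
  shows "at_line P a L" "at_line P b (L + clen a)"
proof -
  show "at_line P a L" using assms by (auto simp: at_line_def nth_append)
  have "P ! (L + clen a + i) = compile b (L + clen a) ! i" if "i < clen b" for i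
  proof -
    have "P ! (L + (clen a + i)) = compile (a ;; b) L ! (clen a + i)"
      using assms that unfolding at_line_def by (metis clen.simps(3) nat_add_left_cancel_less)
    then show ?thesis by (simp add: nth_append add.assoc)
  qed
  then show "at_line P b (L + clen a)" using assms by (simp add: at_line_def)
qed

lemma at_line_If:
  assumes "at_line P (IfEq i j a b) L"
  shows "L < length P" "P ! L = Jump i j (L + 2 + clen b)" "at_line P b (L + 1)"
    "L + 1 + clen b < length P" "P ! (L + 1 + clen b) = Jump 0 0 (L + 2 + clen b + clen a)"
    "at_line P a (L + 2 + clen b)"
proof -
  have *: "P ! (L + k) = compile (IfEq i j a b) L ! k" if "k < clen a + clen b + 2" for k
    using assms that unfolding at_line_def by simp
  show "L < length P" "L + 1 + clen b < length P" using assms by (auto simp: at_line_def)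
  show "P ! L = Jump i j (L + 2 + clen b)" using *[of 0] by simp
  show "P ! (L + 1 + clen b) = Jump 0 0 (L + 2 + clen b + clen a)"
    using *[of "1 + clen b"] by (simp add: nth_append)
  have "P ! (L + 1 + k) = compile b (L + 1) ! k" if "k < clen b" for k
    using *[of "1 + k"] that by (simp add: nth_append)
  then show "at_line P b (L + 1)" using assms by (simp add: at_line_def)
  have "P ! (L + 2 + clen b + k) = compile a (L + 2 + clen b) ! k" if "k < clen a" for k
    using *[of "2 + clen b + k"] that by (simp add: nth_append algebra_simps)
  then show "at_line P a (L + 2 + clen b)" using assms by (simp add: at_line_def)
qed

lemma at_line_While:
  assumes "at_line P (WhileNeq i j a) L"
  shows "L < length P" "P ! L = Jump i j (L + 2 + clen a)" "at_line P a (L + 1)"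
    "L + 1 + clen a < length P" "P ! (L + 1 + clen a) = Jump 0 0 L"
proof -
  have *: "P ! (L + k) = compile (WhileNeq i j a) L ! k" if "k < clen a + 2" for k
    using assms that unfolding at_line_def by simp
  show "L < length P" "L + 1 + clen a < length P" using assms by (auto simp: at_line_def)
  show "P ! L = Jump i j (L + 2 + clen a)" using *[of 0] by simp
  show "P ! (L + 1 + clen a) = Jump 0 0 L"
    using *[of "1 + clen a"] by (simp add: nth_append)
  have "P ! (L + 1 + k) = compile a (L + 1) ! k" if "k < clen a" for k
    using *[of "1 + k"] that by (simp add: nth_append)
  then show "at_line P a (L + 1)" using assms by (simp add: at_line_def)
qed

text \<open>Quantifying over all start times makes such segments composable. The visited lines are
  tracked in order to locate the active line at limits of loops.\<close>

definition goes :: "program \<Rightarrow> nat set \<Rightarrow> nat set \<Rightarrow> config \<Rightarrow> (nat \<Rightarrow> nat) set \<Rightarrow> config \<Rightarrow> bool" where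
  "goes P z Ls c M d \<longleftrightarrow> (\<forall>s. run P z s = c \<longrightarrow> (\<exists>t\<ge>s. run P z t = d \<and>
     fst ` run P z ` {s..<t} \<subseteq> Ls \<and> snd ` run P z ` {s..<t} = M))"

lemma goes_refl: "goes P z Ls c {} c"
  unfolding goes_def by (auto intro!: exI[of _ "_::ctime"])

lemma goes_trans:
  assumes "goes P z Ls c M d" "goes P z Ls d N e"
  shows "goes P z Ls c (M \<union> N) e"
  unfolding goes_def
proof (intro allI impI)
  fix s assume "run P z s = c"
  then obtain t where t: "s \<le> t" "run P z t = d" "fst ` run P z ` {s..<t} \<subseteq> Ls"
      "snd ` run P z ` {s..<t} = M"
    using assms(1) unfolding goes_def by blast
  then obtain u where u: "t \<le> u" "run P z u = e" "fst ` run P z ` {t..<u} \<subseteq> Ls"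
      "snd ` run P z ` {t..<u} = N"
    using assms(2) unfolding goes_def by blast
  have "{s..<u} = {s..<t} \<union> {t..<u}" using t(1) u(1) by auto
  then show "\<exists>t\<ge>s. run P z t = e \<and> fst ` run P z ` {s..<t} \<subseteq> Ls \<and> snd ` run P z ` {s..<t} = M \<union> N"
    using t u by (intro exI[of _ u]) (auto simp: image_Un)
qed

lemma goes_mono: "goes P z Ls c M d \<Longrightarrow> Ls \<subseteq> Ls' \<Longrightarrow> goes P z Ls' c M d"
  unfolding goes_def using order_trans by fast

lemma goes_step:
  assumes "l < length P" "exec_instr z (P ! l) (l, R) = d" "l \<in> Ls"
  shows "goes P z Ls (l, R) {R} d"
  unfolding goes_def
proof (intro allI impI)
  fix s assume "run P z s = (l, R)"
  moreover have "{s..<tsuc s} = {s}" using less_tsuc_iff[of _ s] by force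
  ultimately show "\<exists>t\<ge>s. run P z t = d \<and> fst ` run P z ` {s..<t} \<subseteq> Ls \<and> snd ` run P z ` {s..<t} = {R}"
    using assms less_imp_le[OF less_tsuc]
    by (intro exI[of _ "tsuc s"]) (simp add: run_tsuc nxt_def halted_def)
qed

lemma tsup_partition:
  assumes t: "\<And>k. t k < t (Suc k)" and u: "t k \<le> u" "u < tsup t"
  shows "\<exists>l\<ge>k. u \<in> {t l..<t (Suc l)}"
proof -
  have mono: "t k \<le> t l" if "k \<le> l" for k l
    using that by (rule lift_Suc_mono_le[rotated]) (use t less_imp_le in blast)
  obtain n where "u \<le> t n" using u(2) by (rule less_tsupD)
  then have n: "u < t (Suc n)" using t le_less_trans by blast
  define l where "l = (LEAST l. u < t (Suc l))"
  have l: "u < t (Suc l)" unfolding l_def using n by (rule LeastI)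
  have kl: "k \<le> l" using l u(1) mono[of "Suc l" k] by (meson leI le_less_trans less_irrefl not_less_eq_eq)
  have "t l \<le> u"
  proof (cases "l = k")
    case False
    then obtain l' where l': "l = Suc l'" using kl by (cases l) auto
    then have "\<not> u < t (Suc l')" using not_less_Least[of l' "\<lambda>l. u < t (Suc l)"] unfolding l_def by simp
    then show ?thesis using l' by simp
  qed (use u in simp)
  then show ?thesis using l kl by auto
qed

lemma tlim_tsup:
  assumes t: "\<And>k. t k < t (Suc k)" and A: "\<And>k. f ` {t k..<t (Suc k)} = A k"
  shows "tlim (tsup t) f = slim A"
proof -
  have mono: "t k \<le> t l" if "k \<le> l" for k l
    using that by (rule lift_Suc_mono_le[rotated]) (use t less_imp_le in blast)
  have "tcof (tsup t) f v \<longleftrightarrow> (\<exists>\<^sub>\<infinity>k. \<exists>a\<in>A k. a \<le> v)" for v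
  proof
    assume L: "tcof (tsup t) f v"
    show "\<exists>\<^sub>\<infinity>k. \<exists>a\<in>A k. a \<le> v"
      unfolding INFM_nat_le
    proof
      fix k
      obtain u where u: "t k \<le> u" "u < tsup t" "f u \<le> v"
        using L less_tsup[of t k] unfolding tcof_def by blast
      then obtain l where "l \<ge> k" "u \<in> {t l..<t (Suc l)}" using tsup_partition[of t, OF t] by blast
      then show "\<exists>l\<ge>k. \<exists>a\<in>A l. a \<le> v" using u A[of l] by blast
    qed
  next
    assume R: "\<exists>\<^sub>\<infinity>k. \<exists>a\<in>A k. a \<le> v"
    show "tcof (tsup t) f v"
      unfolding tcof_def
    proof (intro allI impI)
      fix s assume "s < tsup t"
      then obtain k where k: "s \<le> t k" by (rule less_tsupD)
      obtain l a where l: "l \<ge> k" "a \<in> A l" "a \<le> v" using R unfolding INFM_nat_le by blast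
      then obtain u where "u \<in> {t l..<t (Suc l)}" "a = f u" using A[of l] by blast
      then show "\<exists>u\<ge>s. u < tsup t \<and> f u \<le> v"
        using k l mono[of k l] less_tsup[of t "Suc l"] by (intro exI[of _ u]) auto
    qed
  qed
  then have "tcof (tsup t) f = (\<lambda>v. \<exists>\<^sub>\<infinity>k. \<exists>a\<in>A k. a \<le> v)" by (rule ext)
  then show ?thesis unfolding tlim_def slim_def by (simp only:)
qed

text \<open>Each segment starts at line \<open>L\<close> and meets no smaller one, so the limit line
  is \<open>L\<close>. As \<open>M k\<close> is nonempty, every segment takes positive time, and the
  supremum of the segments is a limit time.\<close>

lemma goes_lim:
  assumes g: "\<And>k. goes P z Ls (L, f k) (M k) (L, f (Suc k))" and M: "\<And>k. M k \<noteq> {}"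
    and L: "\<And>l. l \<in> Ls \<Longrightarrow> L \<le> l"
  shows "goes P z Ls (L, f 0) (\<Union>k. M k) (L, \<lambda>n. slim (\<lambda>k. (\<lambda>S. S n) ` M k))"
  unfolding goes_def
proof (intro allI impI)
  fix s assume s: "run P z s = (L, f 0)"
  define nx where "nx k s = (SOME t. s \<le> t \<and> run P z t = (L, f (Suc k)) \<and>
     fst ` run P z ` {s..<t} \<subseteq> Ls \<and> snd ` run P z ` {s..<t} = M k)" for k s
  have nx: "s \<le> nx k s \<and> run P z (nx k s) = (L, f (Suc k)) \<and>
     fst ` run P z ` {s..<nx k s} \<subseteq> Ls \<and> snd ` run P z ` {s..<nx k s} = M k"
    if "run P z s = (L, f k)" for k s
    unfolding nx_def by (rule someI_ex) (use g[of k] that in \<open>unfold goes_def, blast\<close>)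
  define t where "t = rec_nat s nx"
  have t_simps: "t 0 = s" "t (Suc k) = nx k (t k)" for k by (simp_all add: t_def)
  have rt: "run P z (t k) = (L, f k)" for k
    by (induction k) (use s nx in \<open>auto simp: t_simps\<close>)
  have seg: "fst ` run P z ` {t k..<t (Suc k)} \<subseteq> Ls" "snd ` run P z ` {t k..<t (Suc k)} = M k" for k
    using nx[OF rt[of k]] by (auto simp: t_simps)
  have t: "t k < t (Suc k)" for k
    using seg(2)[of k] M[of k] by (metis atLeastLessThan_empty image_empty leI)
  have lim: "tlimit (tsup t)" using t by (rule tlimit_tsup)
  have line: "tlim (tsup t) (\<lambda>u. fst (run P z u)) = L"
  proof (subst tlim_tsup[where f = "\<lambda>u. fst (run P z u)" and t = t, OF t refl])
    have "L \<le> a" if "a \<in> (\<lambda>u. fst (run P z u)) ` {t k..<t (Suc k)}" for a k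
      using that seg(1)[of k] L by auto
    moreover have "L \<in> (\<lambda>u. fst (run P z u)) ` {t k..<t (Suc k)}" for k
      using rt[of k] t[of k] by (intro image_eqI[of _ _ "t k"]) auto
    ultimately have "(\<exists>\<^sub>\<infinity>k. \<exists>a\<in>(\<lambda>u. fst (run P z u)) ` {t k..<t (Suc k)}. a \<le> v) \<longleftrightarrow> L \<le> v" for v
      unfolding INFM_nat_le by (meson order_refl order_trans)
    then show "slim (\<lambda>k. (\<lambda>u. fst (run P z u)) ` {t k..<t (Suc k)}) = L"
      unfolding slim_def by (auto intro!: Least_equality)
  qed
  have reg: "tlim (tsup t) (\<lambda>u. snd (run P z u) n) = slim (\<lambda>k. (\<lambda>S. S n) ` M k)" for n
    by (rule tlim_tsup[where t = t, OF t]) (simp add: seg(2)[symmetric] image_image)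
  have un: "{s..<tsup t} = (\<Union>k. {t k..<t (Suc k)})"
  proof (intro equalityI subsetI)
    fix u assume "u \<in> {s..<tsup t}"
    then show "u \<in> (\<Union>k. {t k..<t (Suc k)})"
      using tsup_partition[of t 0 u, OF t] by (auto simp: t_simps)
  next
    fix u assume "u \<in> (\<Union>k. {t k..<t (Suc k)})"
    then obtain k where k: "t k \<le> u" "u < t (Suc k)" by auto
    moreover have "t 0 \<le> t k" by (rule lift_Suc_mono_le) (use t less_imp_le in auto)
    ultimately show "u \<in> {s..<tsup t}" using less_tsup[of t "Suc k"] by (auto simp: t_simps)
  qed
  have "s \<le> tsup t" using less_tsup[of t 0] by (simp add: t_simps)
  moreover have "run P z (tsup t) = (L, \<lambda>n. slim (\<lambda>k. (\<lambda>S. S n) ` M k))"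
    unfolding run_tlimit[OF lim] line reg ..
  moreover have "fst ` run P z ` {s..<tsup t} \<subseteq> Ls" "snd ` run P z ` {s..<tsup t} = (\<Union>k. M k)"
    unfolding un using seg by (auto simp: image_UN)
  ultimately show "\<exists>u\<ge>s. run P z u = (L, \<lambda>n. slim (\<lambda>k. (\<lambda>S. S n) ` M k)) \<and>
      fst ` run P z ` {s..<u} \<subseteq> Ls \<and> snd ` run P z ` {s..<u} = (\<Union>k. M k)" by blast
qed

lemma compile_correct:
  "exec z c R M S \<Longrightarrow> at_line P c L \<Longrightarrow> goes P z {L..<L + clen c} (L, R) M (L + clen c, S)"
  "iter z i j a R M S \<Longrightarrow> at_line P (WhileNeq i j a) L \<Longrightarrow>
     goes P z {L..<L + 2 + clen a} (L, R) M (L, S)"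
proof (induction arbitrary: L and L rule: exec_iter.inducts)
  case (exec_Skip R)
  show ?case using goes_refl by simp
next
  case (exec_Do I R)
  then have P: "L < length P" "P ! L = I" by (auto simp: at_line_def)
  have "exec_instr z I (L, R) = (Suc L, snd (exec_instr z I (0, R)))"
    using exec_Do(1) by (cases I) auto
  then show ?case using P by (intro goes_step) auto
next
  case (exec_Seq a R M S b N T)
  note at = at_line_Seq[OF exec_Seq.prems]
  from exec_Seq(2)[OF at(1)] exec_Seq(4)[OF at(2)] show ?case
    by (intro goes_trans[of _ _ _ _ M "(L + clen a, S)"]) (auto elim!: goes_mono simp: add.assoc)
next
  case (exec_IfT R i j a M S b)
  note at = at_line_If[OF exec_IfT.prems]
  have "goes P z {L..<L + clen (IfEq i j a b)} (L, R) {R} (L + 2 + clen b, R)"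
    using at exec_IfT by (intro goes_step) auto
  moreover have "goes P z {L..<L + clen (IfEq i j a b)} (L + 2 + clen b, R) M (L + clen (IfEq i j a b), S)"
    using exec_IfT(3)[OF at(6)] by (auto elim!: goes_mono simp: algebra_simps)
  ultimately have "goes P z {L..<L + clen (IfEq i j a b)} (L, R) ({R} \<union> M) (L + clen (IfEq i j a b), S)"
    by (rule goes_trans)
  then show ?case by simp
next
  case (exec_IfF R i j b M S a)
  note at = at_line_If[OF exec_IfF.prems]
  have "goes P z {L..<L + clen (IfEq i j a b)} (L, R) {R} (L + 1, R)"
    using at exec_IfF by (intro goes_step) auto
  moreover have "goes P z {L..<L + clen (IfEq i j a b)} (L + 1, R) M (L + 1 + clen b, S)"
    using exec_IfF(3)[OF at(3)] by (auto elim!: goes_mono simp: algebra_simps)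
  moreover have "goes P z {L..<L + clen (IfEq i j a b)} (L + 1 + clen b, S) {S} (L + clen (IfEq i j a b), S)"
    using at by (intro goes_step) auto
  ultimately have "goes P z {L..<L + clen (IfEq i j a b)} (L, R) ({R} \<union> (M \<union> {S})) (L + clen (IfEq i j a b), S)"
    by (intro goes_trans)
  then show ?case by (simp add: insert_commute)
next
  case (exec_While i j a R M S)
  note at = at_line_While[OF exec_While.prems]
  have "goes P z {L..<L + clen (WhileNeq i j a)} (L, R) M (L, S)"
    using exec_While(2)[OF exec_While.prems] by (simp add: algebra_simps)
  moreover have "goes P z {L..<L + clen (WhileNeq i j a)} (L, S) {S} (L + clen (WhileNeq i j a), S)"
    using at exec_While by (intro goes_step) auto
  ultimately have "goes P z {L..<L + clen (WhileNeq i j a)} (L, R) (M \<union> {S}) (L + clen (WhileNeq i j a), S)"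
    by (rule goes_trans)
  then show ?case by simp
next
  case (iter_refl i j a R)
  show ?case by (rule goes_refl)
next
  case (iter_body R i j a M S)
  note at = at_line_While[OF iter_body.prems]
  have "goes P z {L..<L + 2 + clen a} (L, R) {R} (L + 1, R)"
    using at iter_body by (intro goes_step) auto
  moreover have "goes P z {L..<L + 2 + clen a} (L + 1, R) M (L + 1 + clen a, S)"
    using iter_body(3)[OF at(3)] by (auto elim!: goes_mono)
  moreover have "goes P z {L..<L + 2 + clen a} (L + 1 + clen a, S) {S} (L, S)"
    using at by (intro goes_step) auto
  ultimately have "goes P z {L..<L + 2 + clen a} (L, R) ({R} \<union> (M \<union> {S})) (L, S)"
    by (intro goes_trans)
  then show ?case by (simp add: insert_commute)
next
  case (iter_trans i j a R M S N T)
  show ?case using goes_trans[OF iter_trans(2,4)] iter_trans.prems by blast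
next
  case (iter_lim i j a f M)
  show ?case by (rule goes_lim) (use iter_lim in auto)
qed

lemma itrm_computes_compile:
  assumes "exec z c (\<lambda>_. 0) M R"
  shows "itrm_computes (compile c 0) z (R 0)"
proof -
  have "at_line (compile c 0) c 0" by (simp add: at_line_def)
  from compile_correct(1)[OF assms this]
  have g: "goes (compile c 0) z {0..<clen c} (0, \<lambda>_. 0) M (clen c, R)" by simp
  define t :: ctime where "t = (LEAST t. True)"
  have "\<not> s < t" for s unfolding t_def using not_less_Least by blast
  then have "run (compile c 0) z t = (0, \<lambda>_. 0)" by (rule run_zero)
  then obtain u where "run (compile c 0) z u = (clen c, R)"
    using g[unfolded goes_def, rule_format, of t] by metis
  then show ?thesis
    using itrm_computes_if_run[of "compile c 0" z u] by (simp add: halted_def)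
qed

section \<open>Functions computed by commands\<close>

text \<open>\<open>I\<close> has to hold at every moment and not just at the end, because the
  register contents at limits of an enclosing loop depend on all intermediate values.\<close>

definition wp :: "nat set \<Rightarrow> ((nat \<Rightarrow> nat) \<Rightarrow> bool) \<Rightarrow> cmd \<Rightarrow> ((nat \<Rightarrow> nat) \<Rightarrow> bool) \<Rightarrow> (nat \<Rightarrow> nat) \<Rightarrow> bool" where
  "wp z I c Q R \<longleftrightarrow> (\<exists>M S. exec z c R M S \<and> (\<forall>T\<in>M. I T) \<and> I S \<and> Q S)"

lemma wp_Skip: "I R \<Longrightarrow> Q R \<Longrightarrow> wp z I Skip Q R"
  unfolding wp_def using exec_Skip by blast

lemma wp_Do:
  assumes "I R" "I (snd (exec_instr z J (0, R)))" "Q (snd (exec_instr z J (0, R)))"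
    and "\<And>i j q. J \<noteq> Jump i j q"
  shows "wp z I (Do J) Q R"
  unfolding wp_def using exec_Do[OF assms(4)] assms(1-3) by blast

lemma wp_Zero: "I R \<Longrightarrow> I (R(i := 0)) \<Longrightarrow> Q (R(i := 0)) \<Longrightarrow> wp z I (Do (Zero i)) Q R"
  by (rule wp_Do) auto

lemma wp_Succ: "I R \<Longrightarrow> I (R(i := Suc (R i))) \<Longrightarrow> Q (R(i := Suc (R i))) \<Longrightarrow> wp z I (Do (Succ i)) Q R"
  by (rule wp_Do) auto

lemma wp_Copy: "I R \<Longrightarrow> I (R(j := R i)) \<Longrightarrow> Q (R(j := R i)) \<Longrightarrow> wp z I (Do (Copy i j)) Q R"
  by (rule wp_Do) auto

lemma wp_Oracle:
  "I R \<Longrightarrow> I (R(i := of_bool (R i \<in> z))) \<Longrightarrow> Q (R(i := of_bool (R i \<in> z))) \<Longrightarrow> wp z I (Do (Oracle i)) Q R"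
  by (rule wp_Do) (auto simp: of_bool_def)

lemma wp_Seq: "wp z I a (wp z I b Q) R \<Longrightarrow> wp z I (a ;; b) Q R"
  unfolding wp_def using exec_Seq by (metis UnE)

lemma wp_If:
  assumes "I R" "R i = R j \<Longrightarrow> wp z I a Q R" "R i \<noteq> R j \<Longrightarrow> wp z I b Q R"
  shows "wp z I (IfEq i j a b) Q R"
proof (cases "R i = R j")
  case True
  then show ?thesis
    using assms(1) assms(2)[OF True] exec_IfT[of R i j, OF True] unfolding wp_def
    by (metis insert_iff)
next
  case False
  then show ?thesis
    using assms(1) assms(3)[OF False] exec_IfF[of R i j, OF False] unfolding wp_def
    by (metis insert_iff)
qed

lemma wp_conseq: "wp z I c Q R \<Longrightarrow> (\<And>S. I S \<Longrightarrow> J S) \<Longrightarrow> (\<And>S. I S \<Longrightarrow> Q S \<Longrightarrow> Q' S) \<Longrightarrow> wp z J c Q' R"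
  unfolding wp_def by blast

text \<open>For loops that end after finitely many iterations; transfinite iteration is confined to
  the tree search below.\<close>

lemma wp_While:
  fixes \<mu> :: "(nat \<Rightarrow> nat) \<Rightarrow> nat"
  assumes "Inv R" and I: "\<And>S. Inv S \<Longrightarrow> I S"
    and step: "\<And>S. Inv S \<Longrightarrow> S i \<noteq> S j \<Longrightarrow> wp z I a (\<lambda>T. Inv T \<and> \<mu> T < \<mu> S) S"
    and Q: "\<And>S. Inv S \<Longrightarrow> S i = S j \<Longrightarrow> Q S"
  shows "wp z I (WhileNeq i j a) Q R"
proof -
  have "\<exists>M S. iter z i j a R M S \<and> (\<forall>T\<in>M. I T) \<and> Inv S \<and> S i = S j" if "Inv R" for R
    using that
  proof (induction "\<mu> R" arbitrary: R rule: less_induct)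
    case less
    show ?case
    proof (cases "R i = R j")
      case True
      then show ?thesis using iter_refl less.prems by blast
    next
      case False
      then obtain M S where S: "exec z a R M S" "\<forall>T\<in>M. I T" "I S" "Inv S" "\<mu> S < \<mu> R"
        using step[OF less.prems False] unfolding wp_def by blast
      then obtain N T where T: "iter z i j a S N T" "\<forall>U\<in>N. I U" "Inv T" "T i = T j"
        using less.hyps by blast
      have "iter z i j a R (insert R (insert S M) \<union> N) T"
        using iter_trans[OF iter_body[OF False S(1)] T(1)] .
      moreover have "\<forall>U\<in>insert R (insert S M) \<union> N. I U" using S T I less.prems by blast
      ultimately show ?thesis using T by blast
    qed
  qed
  then obtain M S where "iter z i j a R M S" "\<forall>T\<in>M. I T" "Inv S" "S i = S j" using assms(1) by blast
  then show ?thesis unfolding wp_def using exec_While I Q by (metis insert_iff)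
qed

abbreviation frame :: "nat \<Rightarrow> (nat \<Rightarrow> nat) \<Rightarrow> (nat \<Rightarrow> nat) \<Rightarrow> bool" where
  "frame r R S \<equiv> \<forall>i<r. S i = R i"

definition computes :: "(nat \<Rightarrow> cmd) \<Rightarrow> (nat \<Rightarrow> nat set \<Rightarrow> nat) \<Rightarrow> bool" where
  "computes C F \<longleftrightarrow> (\<forall>z r R. wp z (frame r R) (C r) (\<lambda>S. S r = F (R r) z) R)"

definition computable :: "(nat \<Rightarrow> nat set \<Rightarrow> nat) \<Rightarrow> bool" where
  "computable F \<longleftrightarrow> (\<exists>C. computes C F)"

lemma computableI: "(\<And>z r R. wp z (frame r R) (C r) (\<lambda>S. S r = F (R r) z) R) \<Longrightarrow> computable F"
  unfolding computable_def computes_def by blast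

lemma wp_call:
  assumes "computes C F" "\<And>S. frame r R S \<Longrightarrow> I S"
    and "\<And>S. frame r R S \<Longrightarrow> S r = F (R r) z \<Longrightarrow> Q S"
  shows "wp z I (C r) Q R"
  by (rule wp_conseq[OF assms(1)[unfolded computes_def, rule_format]]) (use assms(2,3) in auto)

lemmas wp_intros = wp_Skip wp_Zero wp_Succ wp_Copy wp_Oracle wp_Seq wp_If

lemma computable_id: "computable (\<lambda>e z. e)"
  by (rule computableI[of "\<lambda>r. Skip"]) (auto intro!: wp_intros)

lemma computable_zero: "computable (\<lambda>e z. 0)"
  by (rule computableI[of "\<lambda>r. Do (Zero r)"]) (auto intro!: wp_intros)

lemma computable_succ: "computable (\<lambda>e z. Suc e)"
  by (rule computableI[of "\<lambda>r. Do (Succ r)"]) (auto intro!: wp_intros)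

lemma computable_oracle: "computable (\<lambda>e z. of_bool (e \<in> z))"
  by (rule computableI[of "\<lambda>r. Do (Oracle r)"]) (auto intro!: wp_intros)

lemma computable_comp:
  assumes "computable F" "computable G"
  shows "computable (\<lambda>e z. F (G e z) z)"
proof -
  obtain CF CG where C: "computes CF F" "computes CG G" using assms by (auto simp: computable_def)
  show ?thesis
    by (rule computableI[of "\<lambda>r. CG r ;; CF r"])
      (auto intro!: wp_Seq wp_call[OF C(1)] wp_call[OF C(2)])
qed

lemma computable_is_zero: "computable (\<lambda>e z. of_bool (e = 0))"
  by (rule computableI[of "\<lambda>r. Do (Zero (r + 1)) ;; IfEq r (r + 1) (Do (Succ r)) (Do (Zero r))"])
    (auto intro!: wp_intros)

section \<open>Pairing and iteration of computable functions\<close>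

definition pr :: "nat \<Rightarrow> nat \<Rightarrow> nat" where "pr a b = prod_encode (a, b)"
definition p1 :: "nat \<Rightarrow> nat" where "p1 n = fst (prod_decode n)"
definition p2 :: "nat \<Rightarrow> nat" where "p2 n = snd (prod_decode n)"

lemma pr_simps [simp]: "p1 (pr a b) = a" "p2 (pr a b) = b" "pr (p1 n) (p2 n) = n"
  by (simp_all add: pr_def p1_def p2_def)

lemma pr_eq_iff [simp]: "pr a b = pr c d \<longleftrightarrow> a = c \<and> b = d"
  by (simp add: pr_def)

lemma le_pr: "a \<le> pr a b" "b \<le> pr a b"
  by (simp_all add: pr_def le_prod_encode_1 le_prod_encode_2)

lemma pr_triangle: "a \<le> s \<Longrightarrow> pr a (s - a) = triangle s + a"
  by (simp add: pr_def prod_encode_def)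

text \<open>For contents \<open>m\<close> and \<open>n\<close> the code is
  \<open>triangle (m + n) + m\<close>: the loops form \<open>m + n\<close> in \<open>r + 2\<close>,
  then its triangle number in \<open>r\<close>, and finally add \<open>m\<close>.\<close>

definition pair_cmd :: "nat \<Rightarrow> nat \<Rightarrow> nat \<Rightarrow> cmd" where
  "pair_cmd i j r =
     Do (Copy i (r + 2)) ;; Do (Zero (r + 1)) ;;
     WhileNeq (r + 1) j (Do (Succ (r + 2)) ;; Do (Succ (r + 1))) ;;
     Do (Zero r) ;; Do (Zero (r + 3)) ;;
     WhileNeq (r + 3) (r + 2)
       (Do (Succ (r + 3)) ;; Do (Zero (r + 1)) ;;
        WhileNeq (r + 1) (r + 3) (Do (Succ r) ;; Do (Succ (r + 1)))) ;;
     Do (Zero (r + 1)) ;;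
     WhileNeq (r + 1) i (Do (Succ r) ;; Do (Succ (r + 1)))"

lemma wp_pair_cmd:
  assumes "i < r" "j < r" "\<And>S. frame r R S \<Longrightarrow> I S"
    and "\<And>S. frame r R S \<Longrightarrow> S r = pr (R i) (R j) \<Longrightarrow> Q S"
  shows "wp z I (pair_cmd i j r) Q R"
proof -
  let ?m = "R i" and ?n = "R j"
  have 4: "wp z (frame r R) (WhileNeq (r + 1) i (Do (Succ r) ;; Do (Succ (r + 1)))) (\<lambda>S. S r = pr ?m ?n) S"
    if "frame r R S" "S r = triangle (?m + ?n)" "S (r + 1) = 0" for S
    using that assms(1)
    by (intro wp_While[where Inv = "\<lambda>S. frame r R S \<and> S (r + 1) \<le> ?m \<and> S r = triangle (?m + ?n) + S (r + 1)"
          and \<mu> = "\<lambda>S. ?m - S (r + 1)"])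
      (auto intro!: wp_intros simp: pr_def prod_encode_def)
  have inner: "wp z (frame r R) (WhileNeq (r + 1) (r + 3) (Do (Succ r) ;; Do (Succ (r + 1))))
       (\<lambda>S. frame r R S \<and> S (r + 2) = ?m + ?n \<and> S (r + 3) = a \<and> S r = triangle a) S"
    if "frame r R S" "S (r + 2) = ?m + ?n" "S (r + 3) = a" "triangle a = S r + a" "S (r + 1) = 0" for S a
    using that
    by (intro wp_While[where Inv = "\<lambda>S. frame r R S \<and> S (r + 2) = ?m + ?n \<and> S (r + 3) = a \<and>
            S (r + 1) \<le> a \<and> triangle a = S r + (a - S (r + 1))"
          and \<mu> = "\<lambda>S. a - S (r + 1)"])
      (auto intro!: wp_intros)
  have 2: "wp z (frame r R) (WhileNeq (r + 3) (r + 2)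
       (Do (Succ (r + 3)) ;; Do (Zero (r + 1)) ;;
        WhileNeq (r + 1) (r + 3) (Do (Succ r) ;; Do (Succ (r + 1)))))
      (\<lambda>S. frame r R S \<and> S r = triangle (?m + ?n)) S"
    if "frame r R S" "S (r + 2) = ?m + ?n" "S (r + 3) = 0" "S r = 0" for S
  proof (rule wp_While[where Inv = "\<lambda>S. frame r R S \<and> S (r + 2) = ?m + ?n \<and> S (r + 3) \<le> ?m + ?n \<and> S r = triangle (S (r + 3))"
          and \<mu> = "\<lambda>S. ?m + ?n - S (r + 3)"], goal_cases)
    case (3 S)
    then show ?case
      by (intro wp_Seq wp_Zero wp_Succ wp_conseq[OF inner[where a = "Suc (S (r + 3))"]]) auto
  qed (use that in auto)
  have 1: "wp z (frame r R) (WhileNeq (r + 1) j (Do (Succ (r + 2)) ;; Do (Succ (r + 1))))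
      (\<lambda>S. frame r R S \<and> S (r + 2) = ?m + ?n) S"
    if "frame r R S" "S (r + 2) = ?m" "S (r + 1) = 0" for S
    using that assms(2)
    by (intro wp_While[where Inv = "\<lambda>S. frame r R S \<and> S (r + 1) \<le> ?n \<and> S (r + 2) = ?m + S (r + 1)"
          and \<mu> = "\<lambda>S. ?n - S (r + 1)"])
      (auto intro!: wp_intros)
  have "wp z (frame r R) (pair_cmd i j r) (\<lambda>S. S r = pr ?m ?n) R"
    unfolding pair_cmd_def
    by (intro wp_Seq wp_Zero wp_Copy wp_conseq[OF 1] wp_conseq[OF 2] 4) (use assms(1,2) in auto)
  then show ?thesis by (rule wp_conseq) (use assms(3,4) in auto)
qed

lemma computable_pair:
  assumes "computable F" "computable G"
  shows "computable (\<lambda>e z. pr (F e z) (G e z))"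
proof -
  obtain CF CG where C: "computes CF F" "computes CG G" using assms by (auto simp: computable_def)
  show ?thesis
    by (rule computableI[of "\<lambda>r. Do (Copy r (r + 1)) ;; CF (r + 1) ;; Do (Copy r (r + 2)) ;; CG (r + 2) ;;
        pair_cmd (r + 1) (r + 2) (r + 3) ;; Do (Copy (r + 3) r)"])
      (auto intro!: wp_Seq wp_Copy wp_call[OF C(1)] wp_call[OF C(2)] wp_pair_cmd)
qed

text \<open>Walks through the pairs in the order of their codes, with the first component in
  \<open>r + 1\<close>, the sum of both in \<open>r + 2\<close> and the code in
  \<open>r + 3\<close>. A diagonal ends when the first component equals the sum.\<close>

definition unpair_cmd :: "nat \<Rightarrow> cmd" where
  "unpair_cmd r =
     Do (Zero (r + 1)) ;; Do (Zero (r + 2)) ;; Do (Zero (r + 3)) ;;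
     WhileNeq (r + 3) r
       (IfEq (r + 1) (r + 2) (Do (Succ (r + 2)) ;; Do (Zero (r + 1))) (Do (Succ (r + 1))) ;;
        Do (Succ (r + 3)))"

lemma wp_unpair_cmd:
  assumes "\<And>S. frame (r + 1) R S \<Longrightarrow> I S"
    and "\<And>S. frame (r + 1) R S \<Longrightarrow> S (r + 1) = p1 (R r) \<Longrightarrow> S (r + 2) = p1 (R r) + p2 (R r) \<Longrightarrow> Q S"
  shows "wp z I (unpair_cmd r) Q R"
proof -
  have loop: "wp z (frame (r + 1) R) (WhileNeq (r + 3) r
       (IfEq (r + 1) (r + 2) (Do (Succ (r + 2)) ;; Do (Zero (r + 1))) (Do (Succ (r + 1))) ;;
        Do (Succ (r + 3)))) (\<lambda>S. S (r + 1) = p1 (R r) \<and> S (r + 2) = p1 (R r) + p2 (R r)) S"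
    if "frame (r + 1) R S" "S (r + 1) = 0" "S (r + 2) = 0" "S (r + 3) = 0" for S
  proof (rule wp_While[where Inv = "\<lambda>S. frame (r + 1) R S \<and> S (r + 1) \<le> S (r + 2) \<and>
            S (r + 3) = triangle (S (r + 2)) + S (r + 1) \<and> S (r + 3) \<le> R r"
          and \<mu> = "\<lambda>S. R r - S (r + 3)"])
    fix S assume S: "frame (r + 1) R S \<and> S (r + 1) \<le> S (r + 2) \<and>
            S (r + 3) = triangle (S (r + 2)) + S (r + 1) \<and> S (r + 3) \<le> R r" "S (r + 3) = S r"
    then have "frame (r + 1) R S" by blast
    then have "S r = R r" by simp
    moreover have le: "S (r + 1) \<le> S (r + 2)" and "S (r + 3) = triangle (S (r + 2)) + S (r + 1)"
      using S(1) by blast+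
    ultimately have "R r = triangle (S (r + 2)) + S (r + 1)" using S(2) by linarith
    then have "R r = pr (S (r + 1)) (S (r + 2) - S (r + 1))" unfolding pr_triangle[OF le] .
    then show "S (r + 1) = p1 (R r) \<and> S (r + 2) = p1 (R r) + p2 (R r)" using le by simp
  qed (use that in \<open>auto intro!: wp_intros\<close>)
  show ?thesis unfolding unpair_cmd_def
    by (intro wp_Seq wp_Zero wp_conseq[OF loop]) (use assms in auto)
qed

lemma computable_p1: "computable (\<lambda>e z. p1 e)"
  by (rule computableI[of "\<lambda>r. unpair_cmd r ;; Do (Copy (r + 1) r)"])
    (auto intro!: wp_Seq wp_Copy wp_unpair_cmd)

lemma computable_p2: "computable (\<lambda>e z. p2 e)"
proof (rule computableI[of "\<lambda>r. unpair_cmd r ;; Do (Zero r) ;;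
    WhileNeq (r + 1) (r + 2) (Do (Succ (r + 1)) ;; Do (Succ r))"])
  fix z r and R :: "nat \<Rightarrow> nat"
  have "wp z (frame r R) (WhileNeq (r + 1) (r + 2) (Do (Succ (r + 1)) ;; Do (Succ r))) (\<lambda>S. S r = p2 (R r)) S"
    if "frame r R S" "S (r + 1) = p1 (R r)" "S (r + 2) = p1 (R r) + p2 (R r)" "S r = 0" for S
    using that
    by (intro wp_While[where Inv = "\<lambda>S. frame r R S \<and> S (r + 2) = p1 (R r) + p2 (R r) \<and>
          S (r + 1) \<le> S (r + 2) \<and> S (r + 1) = p1 (R r) + S r" and \<mu> = "\<lambda>S. S (r + 2) - S (r + 1)"])
      (auto intro!: wp_intros)
  then show "wp z (frame r R) (unpair_cmd r ;; Do (Zero r) ;;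
    WhileNeq (r + 1) (r + 2) (Do (Succ (r + 1)) ;; Do (Succ r))) (\<lambda>S. S r = p2 (R r)) R"
    by (auto intro!: wp_Seq wp_Zero wp_unpair_cmd)
qed

lemma computable_funpow:
  assumes "computable F"
  shows "computable (\<lambda>e z. ((\<lambda>x. F x z) ^^ p1 e) (p2 e))"
proof -
  obtain CF C1 C2 where C: "computes CF F" "computes C1 (\<lambda>e z. p1 e)" "computes C2 (\<lambda>e z. p2 e)"
    using assms computable_p1 computable_p2 by (auto simp: computable_def)
  let ?loop = "\<lambda>r. WhileNeq r (r + 1) (CF (r + 2) ;; Do (Succ r))"
  show ?thesis
  proof (rule computableI[of "\<lambda>r. Do (Copy r (r + 1)) ;; C1 (r + 1) ;; Do (Copy r (r + 2)) ;; C2 (r + 2) ;;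
        Do (Zero r) ;; ?loop r ;; Do (Copy (r + 2) r)"])
    fix z r and R :: "nat \<Rightarrow> nat"
    let ?h = "\<lambda>n. ((\<lambda>x. F x z) ^^ n) (p2 (R r))"
    have "wp z (frame r R) (?loop r) (\<lambda>S. frame r R S \<and> S (r + 2) = ?h (p1 (R r))) S"
      if "frame r R S" "S (r + 1) = p1 (R r)" "S (r + 2) = p2 (R r)" "S r = 0" for S
      using that
      by (intro wp_While[where Inv = "\<lambda>S. frame r R S \<and> S (r + 1) = p1 (R r) \<and> S r \<le> p1 (R r) \<and>
          S (r + 2) = ?h (S r)" and \<mu> = "\<lambda>S. p1 (R r) - S r"])
        (auto intro!: wp_Seq wp_Succ wp_call[OF C(1)])
    then show "wp z (frame r R) (Do (Copy r (r + 1)) ;; C1 (r + 1) ;; Do (Copy r (r + 2)) ;; C2 (r + 2) ;;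
        Do (Zero r) ;; ?loop r ;; Do (Copy (r + 2) r)) (\<lambda>S. S r = ?h (p1 (R r))) R"
      by (auto intro!: wp_Seq wp_Copy wp_Zero wp_call[OF C(2)] wp_call[OF C(3)]
          intro: wp_conseq[where I = "frame r R" and Q = "\<lambda>S. frame r R S \<and> S (r + 2) = ?h (p1 (R r))"])
  qed
qed

lemma computable_Suc: "computable F \<Longrightarrow> computable (\<lambda>e z. Suc (F e z))"
  using computable_comp[OF computable_succ] .

lemma computable_fst: "computable F \<Longrightarrow> computable (\<lambda>e z. p1 (F e z))"
  using computable_comp[OF computable_p1] .

lemma computable_snd: "computable F \<Longrightarrow> computable (\<lambda>e z. p2 (F e z))"
  using computable_comp[OF computable_p2] .

lemma computable_const: "computable (\<lambda>e z. n)"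
  by (induction n) (auto intro: computable_zero computable_Suc)

lemma computable_iterate:
  assumes "computable F" "computable G" "computable H"
  shows "computable (\<lambda>e z. ((\<lambda>x. F x z) ^^ G e z) (H e z))"
  using computable_comp[OF computable_funpow[OF assms(1)] computable_pair[OF assms(2,3)]] by simp

lemma computable_pred:
  assumes "computable F"
  shows "computable (\<lambda>e z. F e z - 1)"
proof -
  let ?s = "\<lambda>q. pr (p2 q) (Suc (p2 q))"
  have "(?s ^^ n) (pr 0 0) = pr (n - 1) n" for n
    by (induction n) auto
  then have eq: "n - 1 = p1 ((?s ^^ n) (pr 0 0))" for n by simp
  show ?thesis unfolding eq
    by (intro computable_fst computable_iterate[of "\<lambda>x z. ?s x"] computable_pair computable_snd
        computable_Suc computable_id computable_const assms)
qed

lemma computable_diff: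
  assumes "computable F" "computable G"
  shows "computable (\<lambda>e z. F e z - G e z)"
proof -
  have eq: "m - n = ((\<lambda>x. x - 1) ^^ n) m" for m n :: nat
    by (induction n) (auto simp: diff_Suc split: nat.split)
  show ?thesis unfolding eq[of "F _ _"]
    by (intro computable_iterate[of "\<lambda>x z. x - 1"] computable_pred computable_id assms)
qed

definition decidable :: "(nat \<Rightarrow> nat set \<Rightarrow> bool) \<Rightarrow> bool" where
  "decidable R \<longleftrightarrow> computable (\<lambda>e z. of_bool (R e z))"

lemma decidable_not:
  assumes "decidable R"
  shows "decidable (\<lambda>e z. \<not> R e z)"
  using computable_comp[OF computable_is_zero assms[unfolded decidable_def]]
  by (simp add: decidable_def)

lemma decidable_conj:
  assumes "decidable R" "decidable Q"
  shows "decidable (\<lambda>e z. R e z \<and> Q e z)"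
proof -
  have eq: "of_bool (a \<and> b) = (of_bool a - (1 - of_bool b) :: nat)" for a b by simp
  show ?thesis
    using assms unfolding decidable_def eq by (intro computable_diff computable_const)
qed

section \<open>Searching trees for infinite branches\<close>

text \<open>Nodes code finite sequences with the latest entry outermost: 0 is the root and
  \<open>Suc (pr k t)\<close> is child \<open>k\<close> of \<open>t\<close>. The inductive form
  supplies the recursion that the depth-first search follows.\<close>

inductive barred :: "(nat \<Rightarrow> bool) \<Rightarrow> nat \<Rightarrow> bool" for \<phi> where
  bar: "\<phi> t \<Longrightarrow> barred \<phi> t"
| step: "(\<And>k. barred \<phi> (Suc (pr k t))) \<Longrightarrow> barred \<phi> t"

primrec initial :: "(nat \<Rightarrow> nat) \<Rightarrow> nat \<Rightarrow> nat" where
  "initial g 0 = 0"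
| "initial g (Suc k) = Suc (pr (g k) (initial g k))"

text \<open>Bar induction: a node that is not barred has a child that is not barred, so dependent
  choice yields a branch avoiding \<open>\<phi>\<close>.\<close>

lemma barred_iff: "barred \<phi> 0 \<longleftrightarrow> (\<forall>g. \<exists>k. \<phi> (initial g k))"
proof
  have "\<exists>k. \<phi> (initial g k)" if "barred \<phi> t" "initial g j = t" for g t j
    using that by (induction arbitrary: j) (use initial.simps(2) in metis)+
  then show "barred \<phi> 0 \<Longrightarrow> \<forall>g. \<exists>k. \<phi> (initial g k)" using initial.simps(1) by blast
next
  assume all: "\<forall>g. \<exists>k. \<phi> (initial g k)"
  show "barred \<phi> 0"
  proof (rule ccontr)
    assume nb: "\<not> barred \<phi> 0"
    define c where "c t = (SOME k. \<not> barred \<phi> (Suc (pr k t)))" for t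
    have c: "\<not> barred \<phi> (Suc (pr (c t) t))" if "\<not> barred \<phi> t" for t
      unfolding c_def by (rule someI_ex) (use that barred.step in blast)
    define s where "s = rec_nat 0 (\<lambda>_ t. Suc (pr (c t) t))"
    have s: "s 0 = 0" "s (Suc k) = Suc (pr (c (s k)) (s k))" for k by (simp_all add: s_def)
    have "initial (\<lambda>k. c (s k)) k = s k" for k by (induction k) (auto simp: s)
    moreover have "\<not> barred \<phi> (s k)" for k by (induction k) (use nb c in \<open>auto simp: s\<close>)
    ultimately show False using all barred.bar by metis
  qed
qed

lemma slim_eqI:
  assumes "\<And>k a. a \<in> A k \<Longrightarrow> v \<le> a" "\<And>k. v \<in> A k"
  shows "slim A = v"
proof -
  have "(\<exists>\<^sub>\<infinity>k. \<exists>a\<in>A k. a \<le> w) \<longleftrightarrow> v \<le> w" for w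
    unfolding INFM_nat_le using assms by (meson order_refl order_trans)
  then show ?thesis unfolding slim_def by (auto intro!: Least_equality)
qed

lemma slim_unbounded:
  assumes "\<And>k a. a \<in> A k \<Longrightarrow> k < a"
  shows "slim A = 0"
proof -
  have "\<not> (\<exists>\<^sub>\<infinity>k. \<exists>a\<in>A k. a \<le> w)" for w
  proof
    assume "\<exists>\<^sub>\<infinity>k. \<exists>a\<in>A k. a \<le> w"
    then obtain k a where "k \<ge> w" "a \<in> A k" "a \<le> w" unfolding INFM_nat_le by blast
    then show False using assms[of a k] by simp
  qed
  then show ?thesis unfolding slim_def by (simp only: if_False ex_simps not_ex[symmetric]) simp
qed

text \<open>
  Depth-first search through the tree of unbarred nodes.  Register \<open>r + 1\<close> holds the successor of
  the current node and \<open>r + 2\<close> the next child to be visited.  At a limit time, the flag \<open>r + 3\<close> is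
  \<open>0\<close>; then either all children of the node in \<open>r + 1\<close> have been searched, or the nodes have run
  through an infinite branch, and \<open>r + 1\<close> has been reset to \<open>0\<close> by overflow.
\<close>

locale search =
  fixes z :: "nat set" and r e :: nat and X :: "nat \<Rightarrow> nat" and R :: "nat \<Rightarrow> nat set \<Rightarrow> bool"
    and C Cnode Ck Ct :: "nat \<Rightarrow> cmd"
  assumes C: "computes C (\<lambda>e z. of_bool (R e z))"
    and Cnode: "computes Cnode (\<lambda>x z. Suc (pr (p1 x) (p2 x - 1)))"
    and Ck: "computes Ck (\<lambda>x z. Suc (p1 (x - 2)))"
    and Ct: "computes Ct (\<lambda>x z. Suc (p2 (x - 2)))"
begin

definition \<phi> :: "nat \<Rightarrow> bool" where "\<phi> s \<longleftrightarrow> R (pr e s) z"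

text \<open>Tests the next child of the current node. As \<open>r + 1\<close> holds the node plus 1,
  \<open>Cnode\<close> subtracts 1 before forming the child. A child in the bar is skipped;
  otherwise the search descends into it.\<close>

definition vrest :: cmd where
  "vrest = pair_cmd (r + 2) (r + 1) (r + 8) ;; Cnode (r + 8) ;; pair_cmd r (r + 8) (r + 9) ;; C (r + 9) ;;
     IfEq (r + 9) (r + 7) (Do (Succ (r + 2)))
       (Do (Succ (r + 8)) ;; Do (Copy (r + 8) (r + 1)) ;; Do (Zero (r + 2)))"

text \<open>Storing nodes plus 1 separates the two endings: 0 in \<open>r + 1\<close> comes from
  overflow and means an infinite branch, while 1 means that the root is exhausted. From any other
  node the search returns to the parent and its next child.\<close>

definition pop :: cmd where
  "pop = IfEq (r + 1) (r + 6) (Do (Succ (r + 4)))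
     (IfEq (r + 1) (r + 7) (Do (Succ (r + 5)) ;; Do (Succ (r + 4)))
       (Do (Copy (r + 1) (r + 8)) ;; Ck (r + 8) ;; Do (Copy (r + 1) (r + 9)) ;; Ct (r + 9) ;;
        Do (Copy (r + 8) (r + 2)) ;; Do (Copy (r + 9) (r + 1)) ;; Do (Succ (r + 3))))"

text \<open>The flag is 0 at some moment of every pass, and it is 1 whenever a pass ends without
  stopping the loop. So the loop test finds it 0 exactly at limits of passes.\<close>

definition body :: cmd where
  "body = IfEq (r + 3) (r + 6) pop (Do (Zero (r + 3)) ;; Do (Succ (r + 3)) ;; vrest)"

definition base :: "(nat \<Rightarrow> nat) \<Rightarrow> bool" where
  "base T \<longleftrightarrow> frame r X T \<and> T r = e \<and> T (r + 4) = 0 \<and> T (r + 5) = 0 \<and> T (r + 6) = 0 \<and> T (r + 7) = 1"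

definition state :: "nat \<Rightarrow> nat \<Rightarrow> nat \<Rightarrow> (nat \<Rightarrow> nat) \<Rightarrow> bool" where
  "state S k f T \<longleftrightarrow> base T \<and> T (r + 1) = S \<and> T (r + 2) = k \<and> T (r + 3) = f"

text \<open>This records what a limit of \<omega> segments needs: if \<open>r + 1\<close> never
  falls below \<open>B\<close> and equals \<open>B\<close> at the start of each segment, its limit
  is \<open>B\<close>, and the moments with flag 0 make the limit of the flag 0.\<close>

definition leads :: "nat \<Rightarrow> (nat \<Rightarrow> nat) \<Rightarrow> (nat \<Rightarrow> nat) \<Rightarrow> bool" where
  "leads B T T' \<longleftrightarrow> (\<exists>M. iter z (r + 4) (r + 7) body T M T' \<and> T \<in> M \<and>
     (\<forall>U\<in>M. base U \<and> B \<le> U (r + 1)) \<and> (\<exists>U\<in>M. U (r + 3) = 0))"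

lemma leads_trans: "leads B T T' \<Longrightarrow> leads B' T' T'' \<Longrightarrow> B \<le> B' \<Longrightarrow> leads B T T''"
proof -
  assume "leads B T T'" "leads B' T' T''" and B: "B \<le> B'"
  then obtain M N where M: "iter z (r + 4) (r + 7) body T M T'" "T \<in> M"
      "\<forall>U\<in>M. base U \<and> B \<le> U (r + 1)" "\<exists>U\<in>M. U (r + 3) = 0"
    and N: "iter z (r + 4) (r + 7) body T' N T''" "\<forall>U\<in>N. base U \<and> B' \<le> U (r + 1)"
    unfolding leads_def by blast
  have "\<forall>U\<in>M \<union> N. base U \<and> B \<le> U (r + 1)" using M(3) N(2) B by fastforce
  then show "leads B T T''" using iter_trans[OF M(1) N(1)] M unfolding leads_def by blast
qed

lemma visit:
  assumes T: "state (Suc t) k 1 T"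
  shows "\<exists>T'. leads (Suc t) T T' \<and>
    (if \<phi> (Suc (pr k t)) then state (Suc t) (Suc k) 1 T' else state (Suc (Suc (pr k t))) 0 1 T')"
proof -
  let ?I = "\<lambda>U. base U \<and> Suc t \<le> U (r + 1)"
  let ?Q = "\<lambda>T'. if \<phi> (Suc (pr k t)) then state (Suc t) (Suc k) 1 T' else state (Suc (Suc (pr k t))) 0 1 T'"
  let ?T1 = "T(r + 3 := 0)"
  have Tb: "base T" "T (r + 1) = Suc t" "T (r + 2) = k" "T (r + 3) = 1" using T by (auto simp: state_def)
  have le: "t \<le> Suc (pr k t)" using le_pr(2)[of t k] by simp
  have "wp z ?I (Do (Succ (r + 3)) ;; vrest) ?Q ?T1"
  proof -
    have of_bool: "of_bool b = Suc 0 \<longleftrightarrow> b" for b by simp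
    show ?thesis
      unfolding vrest_def
      by (intro wp_Seq wp_Succ wp_pair_cmd wp_call[OF Cnode] wp_call[OF C] wp_If wp_Copy wp_Zero)
        (use Tb le in \<open>auto simp: base_def state_def \<phi>_def of_bool\<close>)
  qed
  then obtain M T' where M: "exec z (Do (Succ (r + 3)) ;; vrest) ?T1 M T'" "\<forall>U\<in>M. ?I U" "?I T'" "?Q T'"
    unfolding wp_def by blast
  have "exec z (Do (Zero (r + 3))) T {T} ?T1" using exec_Do[of "Zero (r + 3)" z T] by simp
  from exec_Seq[OF this M(1)]
  have "exec z (Do (Zero (r + 3)) ;; Do (Succ (r + 3)) ;; vrest) T ({T} \<union> M) T'" .
  from exec_IfF[of T "r + 3" "r + 6", OF _ this]
  have b: "exec z body T (insert T (insert T' ({T} \<union> M))) T'" using Tb unfolding body_def base_def by simp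
  have "T (r + 4) \<noteq> T (r + 7)" using Tb by (simp add: base_def)
  from iter_body[of T "r + 4" "r + 7", OF this b]
  have "iter z (r + 4) (r + 7) body T (insert T (insert T' M)) T'" by (simp add: insert_commute)
  moreover have T1: "?T1 \<in> insert T (insert T' M)"
  proof -
    obtain N S N' where "exec z (Do (Succ (r + 3))) ?T1 N S" "M = N \<union> N'"
      using M(1) by (cases rule: exec.cases) auto
    moreover from this(1) have "N = {?T1}" by (cases rule: exec.cases) auto
    ultimately show ?thesis by simp
  qed
  moreover from T1 have "\<exists>U\<in>insert T (insert T' M). U (r + 3) = 0" by (rule bexI[rotated]) simp
  moreover have "\<forall>U\<in>insert T (insert T' M). ?I U" using M Tb by simp
  ultimately have "leads (Suc t) T T'" unfolding leads_def by blast
  then show ?thesis using M by blast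
qed

lemma up:
  assumes T: "state (Suc (Suc (pr k t))) k' 0 T"
  shows "\<exists>T'. leads (Suc t) T T' \<and> state (Suc t) (Suc k) 1 T'"
proof -
  let ?I = "\<lambda>U. base U \<and> Suc t \<le> U (r + 1)"
  have Tb: "base T" "T (r + 1) = Suc (Suc (pr k t))" "T (r + 3) = 0" using T by (auto simp: state_def)
  have le: "t \<le> Suc (pr k t)" using le_pr(2)[of t k] by simp
  have "wp z ?I body (state (Suc t) (Suc k) 1) T"
    unfolding body_def pop_def
  proof (intro wp_If)
    show "wp z ?I (Do (Copy (r + 1) (r + 8)) ;; Ck (r + 8) ;; Do (Copy (r + 1) (r + 9)) ;; Ct (r + 9) ;;
        Do (Copy (r + 8) (r + 2)) ;; Do (Copy (r + 9) (r + 1)) ;; Do (Succ (r + 3))) (state (Suc t) (Suc k) 1) T"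
      by (intro wp_Seq wp_Succ wp_call[OF Ck] wp_call[OF Ct] wp_Copy)
        (use Tb le in \<open>auto simp: base_def state_def\<close>)
  qed (use Tb le in \<open>auto simp: base_def\<close>)
  then obtain M T' where M: "exec z body T M T'" "\<forall>U\<in>M. ?I U" "?I T'" "state (Suc t) (Suc k) 1 T'"
    unfolding wp_def by blast
  have "T (r + 4) \<noteq> T (r + 7)" using Tb by (simp add: base_def)
  from iter_body[of T "r + 4" "r + 7", OF this M(1)] have "leads (Suc t) T T'"
    unfolding leads_def using M Tb le by (intro exI[of _ "insert T (insert T' M)"]) auto
  then show ?thesis using M by blast
qed

lemma child:
  assumes T: "state (Suc t) k 1 T"
    and rec: "\<And>T. \<not> \<phi> (Suc (pr k t)) \<Longrightarrow> state (Suc (Suc (pr k t))) 0 1 T \<Longrightarrow>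
      \<exists>T' k'. leads (Suc (Suc (pr k t))) T T' \<and> state (Suc (Suc (pr k t))) k' 0 T'"
  shows "\<exists>T'. leads (Suc t) T T' \<and> state (Suc t) (Suc k) 1 T'"
proof (cases "\<phi> (Suc (pr k t))")
  case True
  then show ?thesis using visit[OF T] by simp
next
  case False
  then obtain T1 where T1: "leads (Suc t) T T1" "state (Suc (Suc (pr k t))) 0 1 T1"
    using visit[OF T] by auto
  then obtain T2 k' where T2: "leads (Suc (Suc (pr k t))) T1 T2" "state (Suc (Suc (pr k t))) k' 0 T2"
    using rec False by blast
  then obtain T3 where T3: "leads (Suc t) T2 T3" "state (Suc t) (Suc k) 1 T3" using up by blast
  have "Suc t \<le> Suc (Suc (pr k t))" using le_pr(2)[of t k] by simp
  then have "leads (Suc t) T T3" using T1 T2 T3 leads_trans by blast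
  then show ?thesis using T3 by blast
qed

lemma base_lim:
  assumes M: "\<And>k. f k \<in> M k" "\<And>k U. U \<in> M k \<Longrightarrow> base U" "\<And>k. \<exists>U\<in>M k. U (r + 3) = 0"
    and T': "T' = (\<lambda>n. slim (\<lambda>k. (\<lambda>S. S n) ` M k))"
  shows "base T'" "T' (r + 3) = 0"
proof -
  have const: "T' n = v" if "\<And>U. base U \<Longrightarrow> U n = v" for n v
    unfolding T' by (rule slim_eqI) (use that M(1,2) in force)+
  have "T' i = X i" if "i < r" for i by (rule const) (use that in \<open>simp add: base_def\<close>)
  moreover have "T' r = e" "T' (r + 4) = 0" "T' (r + 5) = 0" "T' (r + 6) = 0" "T' (r + 7) = 1"
    by (rule const, simp add: base_def)+
  ultimately show "base T'" unfolding base_def by blast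
  show "T' (r + 3) = 0"
    unfolding T' by (rule slim_eqI) (use M(3) in \<open>force simp: image_iff\<close>)+
qed

text \<open>After \<omega> children the stored node is back at \<open>B\<close> and the flag is 0,
  which \<open>pop\<close> reads as exhaustion of the node.\<close>

lemma leads_lim:
  assumes f: "\<And>k. leads B (f k) (f (Suc k))" and S: "\<And>k. f k (r + 1) = B"
  shows "\<exists>T'. leads B (f 0) T' \<and> state B (T' (r + 2)) 0 T'"
proof -
  obtain M where M: "\<And>k. iter z (r + 4) (r + 7) body (f k) (M k) (f (Suc k))" "\<And>k. f k \<in> M k"
    "\<And>k U. U \<in> M k \<Longrightarrow> base U \<and> B \<le> U (r + 1)" "\<And>k. \<exists>U\<in>M k. U (r + 3) = 0"
    using f unfolding leads_def by metis
  define T' where "T' = (\<lambda>n. slim (\<lambda>k. (\<lambda>S. S n) ` M k))"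
  have it: "iter z (r + 4) (r + 7) body (f 0) (\<Union>k. M k) T'"
    unfolding T'_def by (rule iter_lim) (use M(1,2) in auto)
  have "base T'" "T' (r + 3) = 0" using base_lim[of f M, OF M(2) _ M(4) T'_def] M(3) by blast+
  moreover have "T' (r + 1) = B"
    unfolding T'_def
  proof (rule slim_eqI)
    show "B \<in> (\<lambda>S. S (r + 1)) ` M k" for k using S[of k] M(2)[of k] by (metis image_eqI)
  qed (use M(3) in auto)
  ultimately have "state B (T' (r + 2)) 0 T'" by (simp add: state_def)
  moreover have "f 0 \<in> (\<Union>k. M k)" "\<exists>U\<in>(\<Union>k. M k). U (r + 3) = 0" using M(2)[of 0] M(4)[of 0] by blast+
  moreover have "\<forall>U\<in>(\<Union>k. M k). base U \<and> B \<le> U (r + 1)" using M(3) by blast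
  ultimately show ?thesis unfolding leads_def using it by blast
qed

text \<open>By induction on \<open>barred\<close>: each child lies in the bar and is skipped, or its
  search ends by the induction hypothesis. After all children a limit time is reached.\<close>

lemma search_barred:
  assumes "barred \<phi> t" "\<not> \<phi> t" "state (Suc t) 0 1 T"
  shows "\<exists>T' k. leads (Suc t) T T' \<and> state (Suc t) k 0 T'"
  using assms
proof (induction arbitrary: T)
  case (step t)
  have ch: "\<exists>T'. leads (Suc t) T T' \<and> state (Suc t) (Suc k) 1 T'" if "state (Suc t) k 1 T" for T k
    using child[OF that] step.IH by blast
  define nx where "nx k T = (SOME T'. leads (Suc t) T T' \<and> state (Suc t) (Suc k) 1 T')" for k T
  have nx: "leads (Suc t) T (nx k T) \<and> state (Suc t) (Suc k) 1 (nx k T)" if "state (Suc t) k 1 T" for k T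
    using someI_ex[OF ch[OF that]] unfolding nx_def .
  define f where "f = rec_nat T nx"
  have f: "f 0 = T" "f (Suc k) = nx k (f k)" for k by (simp_all add: f_def)
  have st: "state (Suc t) k 1 (f k)" for k
    by (induction k) (use step.prems nx in \<open>auto simp: f\<close>)
  have "leads (Suc t) (f k) (f (Suc k))" "f k (r + 1) = Suc t" for k
    using nx[OF st[of k]] st[of k] unfolding f state_def by blast+
  then have "\<exists>T'. leads (Suc t) (f 0) T' \<and> state (Suc t) (T' (r + 2)) 0 T'"
    by (intro leads_lim)
  then show ?case by (auto simp: f)
qed simp

lemma search_unbarred:
  assumes "\<not> barred \<phi> 0" "state 1 0 1 T"
  shows "\<exists>M T' k. iter z (r + 4) (r + 7) body T M T' \<and> (\<forall>U\<in>M. base U) \<and> state 0 k 0 T'"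
proof -
  have down: "\<exists>t' T'. t < t' \<and> \<not> barred \<phi> t' \<and> leads (Suc t) T T' \<and> state (Suc t') 0 1 T'"
    if t: "\<not> barred \<phi> t" and T: "state (Suc t) 0 1 T" for t T
  proof -
    \<comment> \<open>The leftmost child that is not barred. The searches of the barred siblings
      before it terminate, so it is reached.\<close>
    define j where "j = (LEAST j. \<not> barred \<phi> (Suc (pr j t)))"
    have "\<exists>j. \<not> barred \<phi> (Suc (pr j t))" using t barred.step by blast
    then have j: "\<not> barred \<phi> (Suc (pr j t))" unfolding j_def by (rule LeastI_ex)
    have bj: "barred \<phi> (Suc (pr k t))" if "k < j" for k
      using that not_less_Least unfolding j_def by blast
    have "k = 0 \<or> (\<exists>T'. leads (Suc t) T T' \<and> state (Suc t) k 1 T')" if "k \<le> j" for k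
      using that
    proof (induction k)
      case (Suc k)
      then have bk: "barred \<phi> (Suc (pr k t))" using bj by simp
      have "\<exists>T'. leads (Suc t) T1 T' \<and> state (Suc t) (Suc k) 1 T'" if "state (Suc t) k 1 T1" for T1
        using child[OF that] search_barred[OF bk] by blast
      then show ?case using Suc T leads_trans by (metis Suc_leD order_refl)
    qed simp
    then obtain T1 where T1: "state (Suc t) j 1 T1" "T1 = T \<or> leads (Suc t) T T1" using T by blast
    have "\<not> \<phi> (Suc (pr j t))" using j barred.bar by blast
    then obtain T2 where "leads (Suc t) T1 T2" "state (Suc (Suc (pr j t))) 0 1 T2"
      using visit[OF T1(1)] by auto
    moreover have "t < Suc (pr j t)" using le_pr(2)[of t j] by simp
    ultimately show ?thesis using T1(2) j leads_trans by blast
  qed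
  define nx where "nx = (\<lambda>(t, T). SOME (t', T'). t < t' \<and> \<not> barred \<phi> t' \<and> leads (Suc t) T T' \<and> state (Suc t') 0 1 T')"
  have nx: "case nx (t, T) of (t', T') \<Rightarrow> t < t' \<and> \<not> barred \<phi> t' \<and> leads (Suc t) T T' \<and> state (Suc t') 0 1 T'"
    if "\<not> barred \<phi> t" "state (Suc t) 0 1 T" for t T
    unfolding nx_def prod.case by (rule someI_ex) (use down[OF that] in auto)
  define f where "f = rec_nat (0, T) (\<lambda>_. nx)"
  have f: "f 0 = (0, T)" "f (Suc k) = nx (f k)" for k by (simp_all add: f_def)
  have inv: "\<not> barred \<phi> (fst (f k)) \<and> state (Suc (fst (f k))) 0 1 (snd (f k))" for k
  proof (induction k)
    case (Suc k)
    then show ?case using nx[of "fst (f k)" "snd (f k)"] by (auto simp: f split: prod.splits)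
  qed (use assms in \<open>simp add: f\<close>)
  have st: "fst (f k) < fst (f (Suc k)) \<and> leads (Suc (fst (f k))) (snd (f k)) (snd (f (Suc k)))" for k
    using nx[of "fst (f k)" "snd (f k)"] inv[of k] by (auto simp: f split: prod.splits)
  \<comment> \<open>Codes grow along the branch, so \<open>r + 1\<close> tends to infinity and
    overflows to 0.\<close>
  have ge: "k \<le> fst (f k)" for k
    by (induction k) (use st in \<open>auto intro: le_less_trans Suc_leI\<close>)
  obtain M where M: "\<And>k. iter z (r + 4) (r + 7) body (snd (f k)) (M k) (snd (f (Suc k)))"
    "\<And>k. snd (f k) \<in> M k" "\<And>k U. U \<in> M k \<Longrightarrow> base U \<and> Suc (fst (f k)) \<le> U (r + 1)"
    "\<And>k. \<exists>U\<in>M k. U (r + 3) = 0"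
    using st unfolding leads_def by metis
  define T' where "T' = (\<lambda>n. slim (\<lambda>k. (\<lambda>S. S n) ` M k))"
  have it: "iter z (r + 4) (r + 7) body (snd (f 0)) (\<Union>k. M k) T'"
    unfolding T'_def by (rule iter_lim) (use M(1,2) in auto)
  have "base T'" "T' (r + 3) = 0"
    using base_lim[of "\<lambda>k. snd (f k)" M, OF M(2) _ M(4) T'_def] M(3) by blast+
  moreover have "T' (r + 1) = 0"
    unfolding T'_def
  proof (rule slim_unbounded)
    fix k a assume "a \<in> (\<lambda>S. S (r + 1)) ` M k"
    then show "k < a" using M(3)[of _ k] ge[of k] by fastforce
  qed
  ultimately have "state 0 (T' (r + 2)) 0 T'" by (simp add: state_def)
  then show ?thesis using it M(3) by (auto simp: f)
qed

definition loop :: cmd where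
  "loop = Do (Zero (r + 1)) ;; Do (Succ (r + 1)) ;; Do (Zero (r + 2)) ;; Do (Zero (r + 3)) ;; Do (Succ (r + 3)) ;;
     Do (Zero (r + 4)) ;; Do (Zero (r + 5)) ;; WhileNeq (r + 4) (r + 7) body ;; Do (Copy (r + 5) r)"

lemma final:
  assumes T: "state S k 0 T" "S \<le> 1"
  shows "\<exists>M T'. iter z (r + 4) (r + 7) body T M T' \<and> (\<forall>U\<in>insert T' M. frame r X U) \<and>
    T' (r + 4) = T' (r + 7) \<and> T' (r + 5) = S"
proof -
  have "wp z (frame r X) body (\<lambda>T'. T' (r + 4) = T' (r + 7) \<and> T' (r + 5) = S) T"
  proof -
    have T': "frame r X T" "T (r + 1) = S" "T (r + 3) = 0" "T (r + 4) = 0" "T (r + 5) = 0" "T (r + 6) = 0"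
        "T (r + 7) = 1"
      using T by (auto simp: base_def state_def)
    have z: "wp z (frame r X) (Do (Succ (r + 4))) (\<lambda>T'. T' (r + 4) = T' (r + 7) \<and> T' (r + 5) = S) T"
      if "S = 0"
      by (rule wp_Succ) (use T' that in auto)
    have s: "wp z (frame r X) (Do (Succ (r + 5)) ;; Do (Succ (r + 4)))
        (\<lambda>T'. T' (r + 4) = T' (r + 7) \<and> T' (r + 5) = S) T" if "S = 1"
      by (intro wp_Seq wp_Succ) (use T' that in auto)
    show ?thesis
      unfolding body_def pop_def
    proof (intro wp_If)
      assume "T (r + 1) = T (r + 6)"
      with T' z show "wp z (frame r X) (Do (Succ (r + 4))) (\<lambda>T'. T' (r + 4) = T' (r + 7) \<and> T' (r + 5) = S) T"
        by simp
    next
      assume "T (r + 1) = T (r + 7)"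
      with T' s show "wp z (frame r X) (Do (Succ (r + 5)) ;; Do (Succ (r + 4)))
        (\<lambda>T'. T' (r + 4) = T' (r + 7) \<and> T' (r + 5) = S) T" by simp
    qed (use T' assms(2) in auto)
  qed
  then obtain M T' where M: "exec z body T M T'" "\<forall>U\<in>M. frame r X U" "frame r X T'"
    "T' (r + 4) = T' (r + 7)" "T' (r + 5) = S"
    unfolding wp_def by blast
  have "T (r + 4) \<noteq> T (r + 7)" using T by (simp add: base_def state_def)
  from iter_body[of T "r + 4" "r + 7", OF this M(1)] show ?thesis
    using M T by (intro exI[of _ "insert T (insert T' M)"] exI[of _ T']) (auto simp: base_def state_def)
qed

text \<open>The search tests a node before descending into it, but it starts inside the root. Hence
  the root is tested beforehand, in \<open>decidable_branches\<close>.\<close>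

lemma wp_loop:
  assumes T: "frame r X T" "T r = e" "T (r + 6) = 0" "T (r + 7) = 1" and root: "\<not> \<phi> 0"
  shows "wp z (frame r X) loop (\<lambda>T'. T' r = of_bool (barred \<phi> 0)) T"
proof -
  have while: "wp z (frame r X) (WhileNeq (r + 4) (r + 7) body) (\<lambda>T'. T' (r + 5) = of_bool (barred \<phi> 0)) T"
    if T: "state 1 0 1 T" for T
  proof -
    have "\<exists>M T1 k. iter z (r + 4) (r + 7) body T M T1 \<and> (\<forall>U\<in>M. base U) \<and> state (of_bool (barred \<phi> 0)) k 0 T1"
    proof (cases "barred \<phi> 0")
      case True
      then show ?thesis using search_barred[OF True root, of T] T unfolding leads_def by auto
    next
      case False
      then show ?thesis using search_unbarred[OF False T] by simp
    qed
    then obtain M T1 k where 1: "iter z (r + 4) (r + 7) body T M T1" "\<forall>U\<in>M. base U"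
      "state (of_bool (barred \<phi> 0)) k 0 T1" by blast
    obtain M' T2 where 2: "iter z (r + 4) (r + 7) body T1 M' T2" "\<forall>U\<in>insert T2 M'. frame r X U"
      "T2 (r + 4) = T2 (r + 7)" "T2 (r + 5) = of_bool (barred \<phi> 0)"
      using final[OF 1(3) of_bool_less_eq_one] by blast
    have "\<forall>U\<in>insert T2 (M \<union> M'). frame r X U" using 1(2) 2(2) unfolding base_def by blast
    then show ?thesis
      unfolding wp_def using exec_While[OF iter_trans[OF 1(1) 2(1)] 2(3)] 2(4) by blast
  qed
  show ?thesis
    unfolding loop_def
    by (intro wp_Seq wp_Zero wp_Succ wp_conseq[OF while] wp_Copy) (use T in \<open>auto simp: state_def base_def\<close>)
qed

end

lemma decidable_branches:
  assumes "decidable R"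
  shows "decidable (\<lambda>e z. \<forall>g. \<exists>k. R (pr e (initial g k)) z)"
proof -
  obtain C where C: "computes C (\<lambda>e z. of_bool (R e z))"
    using assms by (auto simp: decidable_def computable_def)
  have "computable (\<lambda>x z. Suc (pr (p1 x) (p2 x - 1)))" "computable (\<lambda>x z. Suc (p1 (x - 2)))"
      "computable (\<lambda>x z. Suc (p2 (x - 2)))"
    by (intro computable_Suc computable_pair computable_fst computable_snd computable_diff
        computable_const computable_id)+
  then obtain Cn Ck Ct where "computes Cn (\<lambda>x z. Suc (pr (p1 x) (p2 x - 1)))"
    "computes Ck (\<lambda>x z. Suc (p1 (x - 2)))" "computes Ct (\<lambda>x z. Suc (p2 (x - 2)))"
    unfolding computable_def by blast
  with C have loc: "search R C Cn Ck Ct" by unfold_locales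
  show ?thesis
    unfolding decidable_def
  proof (rule computableI[of "\<lambda>r. Do (Zero (r + 6)) ;; Do (Zero (r + 7)) ;; Do (Succ (r + 7)) ;;
      pair_cmd r (r + 6) (r + 9) ;; C (r + 9) ;;
      IfEq (r + 9) (r + 7) (Do (Zero r) ;; Do (Succ r)) (search.loop r C Cn Ck Ct)"])
    fix z r and X :: "nat \<Rightarrow> nat"
    interpret search z r "X r" X R C Cn Ck Ct by (rule loc)
    have eq: "(\<forall>g. \<exists>k. R (pr (X r) (initial g k)) z) \<longleftrightarrow> barred \<phi> 0"
      unfolding barred_iff \<phi>_def ..
    show "wp z (frame r X) (Do (Zero (r + 6)) ;; Do (Zero (r + 7)) ;; Do (Succ (r + 7)) ;;
      pair_cmd r (r + 6) (r + 9) ;; C (r + 9) ;;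
      IfEq (r + 9) (r + 7) (Do (Zero r) ;; Do (Succ r)) loop)
      (\<lambda>S. S r = of_bool (\<forall>g. \<exists>k. R (pr (X r) (initial g k)) z)) X"
      unfolding eq
      by (intro wp_Seq wp_Zero wp_Succ wp_pair_cmd wp_call[OF C] wp_If wp_loop)
        (auto simp: \<phi>_def barred.bar)
  qed
qed

section \<open>Definable relations\<close>

abbreviation cf :: "(nat \<Rightarrow> nat) \<Rightarrow> bool" where
  "cf f \<equiv> computable (\<lambda>e z. f e)"

text \<open>All number parameters are packed into \<open>e\<close> by pairing, and \<open>z\<close>
  is the oracle. The clause \<open>branches\<close> dualizes the Suslin operation; through codes of
  functions it quantifies over reals.\<close>

inductive definable :: "(nat \<Rightarrow> nat set \<Rightarrow> bool) \<Rightarrow> bool" where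
  zero: "cf f \<Longrightarrow> definable (\<lambda>e z. f e = 0)"
| mem: "cf f \<Longrightarrow> definable (\<lambda>e z. f e \<in> z)"
| neg: "definable R \<Longrightarrow> definable (\<lambda>e z. \<not> R e z)"
| conj: "definable R \<Longrightarrow> definable Q \<Longrightarrow> definable (\<lambda>e z. R e z \<and> Q e z)"
| branches: "definable R \<Longrightarrow> definable (\<lambda>e z. \<forall>g. \<exists>k. R (pr e (initial g k)) z)"

lemma definable_decidable:
  assumes "definable R"
  shows "decidable R"
  using assms
proof induction
  case (zero f)
  then show ?case using computable_comp[OF computable_is_zero] by (simp add: decidable_def)
next
  case (mem f)
  then show ?case using computable_comp[OF computable_oracle] by (simp add: decidable_def)
qed (auto intro: decidable_not decidable_conj decidable_branches)

lemma cf_comp: "cf f \<Longrightarrow> cf g \<Longrightarrow> cf (\<lambda>e. f (g e))"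
  using computable_comp .

lemma definable_subst:
  assumes "definable R" "cf h"
  shows "definable (\<lambda>e z. R (h e) z)"
  using assms
proof (induction arbitrary: h)
  case (branches R)
  have "cf (\<lambda>x. pr (h (p1 x)) (p2 x))"
    using computable_pair[OF cf_comp[OF branches.prems computable_p1] computable_p2] by simp
  from definable.branches[OF branches.IH[OF this]] show ?case by simp
qed (auto intro: definable.intros cf_comp)

text \<open>Serves to replace the oracle by its left half and to exchange its two halves.\<close>

lemma definable_oracle_subst:
  assumes "definable R" "cf h"
  shows "definable (\<lambda>e z. R e {n. h n \<in> z})"
  using assms
proof induction
  case (mem f)
  then show ?case using definable.mem[OF cf_comp[of h f]] by simp
qed (auto intro: definable.intros)

definition tl' :: "nat \<Rightarrow> nat" where "tl' s = p2 (s - 1)"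
definition nth' :: "nat \<Rightarrow> nat \<Rightarrow> nat" where "nth' s i = p1 ((tl' ^^ i) s - 1)"
text \<open>\<open>1 - (1 - n)\<close> is 1 for positive \<open>n\<close> and 0 for
  \<open>n = 0\<close>, so the counter stops at the empty sequence. The \<open>s\<close> iterations
  in \<open>len'\<close> suffice because the code of a sequence is at least its length.\<close>

definition len_step :: "nat \<Rightarrow> nat" where
  "len_step q = pr ((Suc ^^ (1 - (1 - p2 q))) (p1 q)) (tl' (p2 q))"
definition len' :: "nat \<Rightarrow> nat" where "len' s = p1 ((len_step ^^ s) (pr 0 s))"
text \<open>Node codes carry the latest entry outermost, whereas entry \<open>i\<close> of a branch
  is the one added at stage \<open>i\<close>; so the index is counted from the inner end.\<close>

definition elem' :: "nat \<Rightarrow> nat \<Rightarrow> nat" where "elem' s i = nth' s (len' s - 1 - i)"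

lemma cf_id: "cf (\<lambda>e. e)" by (rule computable_id)
lemma cf_const: "cf (\<lambda>e. n)" by (rule computable_const)
lemma cf_Suc: "cf f \<Longrightarrow> cf (\<lambda>e. Suc (f e))" by (rule computable_Suc)
lemma cf_pr: "cf f \<Longrightarrow> cf g \<Longrightarrow> cf (\<lambda>e. pr (f e) (g e))" by (rule computable_pair)
lemma cf_p1: "cf f \<Longrightarrow> cf (\<lambda>e. p1 (f e))" by (rule computable_fst)
lemma cf_p2: "cf f \<Longrightarrow> cf (\<lambda>e. p2 (f e))" by (rule computable_snd)
lemma cf_diff: "cf f \<Longrightarrow> cf g \<Longrightarrow> cf (\<lambda>e. f e - g e)" by (rule computable_diff)
lemma cf_iterate: "cf f \<Longrightarrow> cf g \<Longrightarrow> cf h \<Longrightarrow> cf (\<lambda>e. (f ^^ g e) (h e))"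
  by (rule computable_iterate)

lemma cf_tl': "cf f \<Longrightarrow> cf (\<lambda>e. tl' (f e))"
  unfolding tl'_def by (intro cf_p2 cf_diff cf_const)

lemma cf_drop: "cf f \<Longrightarrow> cf g \<Longrightarrow> cf (\<lambda>e. (tl' ^^ g e) (f e))"
  by (intro cf_iterate[of tl'] cf_tl' cf_id)

lemma cf_nth': "cf f \<Longrightarrow> cf g \<Longrightarrow> cf (\<lambda>e. nth' (f e) (g e))"
  unfolding nth'_def by (intro cf_p1 cf_diff cf_const cf_drop)

lemma cf_len': "cf f \<Longrightarrow> cf (\<lambda>e. len' (f e))"
  unfolding len'_def len_step_def
  by (intro cf_p1 cf_iterate[of "\<lambda>q. pr ((Suc ^^ (1 - (1 - p2 q))) (p1 q)) (tl' (p2 q))"] cf_pr cf_const cf_p2 cf_diff cf_tl'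
      cf_iterate[of Suc] cf_Suc[of "\<lambda>x. x"] cf_id)

lemma cf_elem': "cf f \<Longrightarrow> cf g \<Longrightarrow> cf (\<lambda>e. elem' (f e) (g e))"
  unfolding elem'_def by (intro cf_nth' cf_diff cf_const cf_len')

lemmas cf_intros = cf_id cf_const cf_Suc cf_pr cf_p1 cf_p2 cf_diff cf_drop cf_nth' cf_len' cf_elem'

lemma pr_0_0: "pr 0 0 = 0"
  by (simp add: pr_def prod_encode_def)

lemma p_0 [simp]: "p1 0 = 0" "p2 0 = 0"
  using pr_simps(1,2)[of 0 0] by (simp_all only: pr_0_0)

lemma tl'_initial [simp]: "tl' (initial g (Suc k)) = initial g k" "tl' 0 = 0"
  by (simp_all add: tl'_def)

lemma drop_initial: "j \<le> k \<Longrightarrow> (tl' ^^ j) (initial g k) = initial g (k - j)"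
proof (induction j)
  case (Suc j)
  then have "k - j = Suc (k - Suc j)" by simp
  then show ?case using Suc by (metis Suc_leD funpow_simps_right(2) comp_apply funpow_swap1 tl'_initial(1))
qed simp

lemma le_initial: "k \<le> initial g k"
  by (induction k) (use le_pr(2) order_trans in \<open>auto, blast\<close>)

lemma len'_initial [simp]: "len' (initial g k) = k"
proof -
  have 1: "(len_step ^^ n) (pr c (initial g k)) = pr (c + n) (initial g (k - n))" if "n \<le> k" for n c
    using that
  proof (induction n)
    case (Suc n)
    then obtain m where m: "k - n = Suc m" by (metis Suc_diff_Suc Suc_le_eq)
    then have "k - Suc n = m" by simp
    then show ?case using Suc m by (simp add: len_step_def tl'_def)
  qed simp
  have 2: "(len_step ^^ n) (pr c 0) = pr c 0" for n c
    by (induction n) (auto simp: len_step_def)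
  obtain d where d: "initial g k = d + k" using le_initial[of k g] by (metis le_add_diff_inverse2)
  have "(len_step ^^ (d + k)) (pr 0 (initial g k)) = (len_step ^^ d) ((len_step ^^ k) (pr 0 (initial g k)))"
    by (simp add: funpow_add)
  also have "\<dots> = pr k 0" using 1[of k 0] 2 by simp
  finally show ?thesis unfolding len'_def d[symmetric] by simp
qed

lemma elem'_initial [simp]:
  assumes "i < k"
  shows "elem' (initial g k) i = g i"
proof -
  have "k - (k - 1 - i) = Suc i" using assms by simp
  then show ?thesis using assms drop_initial[of "k - 1 - i" k g] by (simp add: elem'_def nth'_def)
qed

lemma definable_disj: "definable R \<Longrightarrow> definable Q \<Longrightarrow> definable (\<lambda>e z. R e z \<or> Q e z)"
  using definable.neg[OF definable.conj[OF definable.neg definable.neg], of R Q] by simp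

lemma definable_imp: "definable R \<Longrightarrow> definable Q \<Longrightarrow> definable (\<lambda>e z. R e z \<longrightarrow> Q e z)"
  using definable_disj[OF definable.neg, of R Q] by simp

lemma definable_iff: "definable R \<Longrightarrow> definable Q \<Longrightarrow> definable (\<lambda>e z. R e z \<longleftrightarrow> Q e z)"
  using definable.conj[OF definable_imp definable_imp, of R Q Q R] by (simp add: iff_conv_conj_imp)

text \<open>Every branch passes through a node of each length, so a bar that looks only at lengths
  expresses a number quantifier.\<close>

lemma definable_ex:
  assumes "definable (\<lambda>e z. Q (p1 e) (p2 e) z)"
  shows "definable (\<lambda>e z. \<exists>k. Q e k z)"
proof -
  have "cf (\<lambda>x. pr (p1 x) (len' (p2 x)))" by (intro cf_intros)
  from definable.branches[OF definable_subst[OF assms this]] show ?thesis by simp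
qed

lemma definable_all:
  assumes "definable (\<lambda>e z. Q (p1 e) (p2 e) z)"
  shows "definable (\<lambda>e z. \<forall>k. Q e k z)"
  using definable.neg[OF definable_ex[OF definable.neg[OF assms]]] by simp

lemma definable_le: "cf f \<Longrightarrow> cf g \<Longrightarrow> definable (\<lambda>e z. f e \<le> g e)"
  using definable.zero[OF cf_diff, of f g] by simp

lemma definable_less: "cf f \<Longrightarrow> cf g \<Longrightarrow> definable (\<lambda>e z. f e < g e)"
  using definable_le[OF cf_Suc, of f g] by (simp add: Suc_le_eq)

lemma definable_eq: "cf f \<Longrightarrow> cf g \<Longrightarrow> definable (\<lambda>e z. f e = g e)"
  using definable.conj[OF definable_le[of f g] definable_le[of g f]] by (simp add: eq_iff)

lemma definable_const: "definable (\<lambda>e z. b)"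
proof (cases b)
  case True
  then show ?thesis using definable_eq[OF cf_id cf_id] by simp
next
  case False
  then show ?thesis using definable.neg[OF definable_eq[OF cf_id cf_id]] by simp
qed

lemma definable_Ball: "finite A \<Longrightarrow> (\<And>a. a \<in> A \<Longrightarrow> definable (Q a)) \<Longrightarrow> definable (\<lambda>e z. \<forall>a\<in>A. Q a e z)"
  by (induction rule: finite_induct) (auto intro: definable_const definable.conj)

lemma definable_Bex: "finite A \<Longrightarrow> (\<And>a. a \<in> A \<Longrightarrow> definable (Q a)) \<Longrightarrow> definable (\<lambda>e z. \<exists>a\<in>A. Q a e z)"
  by (induction rule: finite_induct) (auto intro: definable_const definable_disj)

lemmas definable_intros = definable.mem definable.neg definable.conj definable_disj definable_imp
  definable_iff definable_ex definable_all definable_less definable_le definable_eq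

section \<open>Inductive definitions\<close>

text \<open>Read \<open>D n d\<close> as: \<open>d\<close> is a rule with conclusion
  \<open>n\<close>. Its premises are the \<open>m\<close> with \<open>W n d m\<close>, possibly
  infinitely many.\<close>

inductive ind :: "(nat \<Rightarrow> nat \<Rightarrow> bool) \<Rightarrow> (nat \<Rightarrow> nat \<Rightarrow> nat \<Rightarrow> bool) \<Rightarrow> nat \<Rightarrow> bool" for D W where
  "D n d \<Longrightarrow> (\<And>m. W n d m \<Longrightarrow> ind D W m) \<Longrightarrow> ind D W n"

text \<open>
  A branch \<open>g\<close> codes a set \<open>{n. g (pr 0 n) = 1}\<close> together with, for each element \<open>n\<close> and each rule
  \<open>d\<close> for \<open>n\<close>, a premise \<open>g (pr 1 (pr n d))\<close> of that rule.  The node \<open>s\<close> refutes \<open>n\<close> if it shows that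
  \<open>n\<close> is not in the set or that one of these premises is not a premise in the set.
\<close>

definition refutes :: "(nat \<Rightarrow> nat \<Rightarrow> bool) \<Rightarrow> (nat \<Rightarrow> nat \<Rightarrow> nat \<Rightarrow> bool) \<Rightarrow> nat \<Rightarrow> nat \<Rightarrow> bool" where
  "refutes D W n s \<longleftrightarrow> pr 0 n < len' s \<and> elem' s (pr 0 n) \<noteq> 1 \<or>
     (\<exists>m d. D m d \<and> pr 0 m < len' s \<and> elem' s (pr 0 m) = 1 \<and> pr 1 (pr m d) < len' s \<and>
       (\<not> W m d (elem' s (pr 1 (pr m d))) \<or>
        pr 0 (elem' s (pr 1 (pr m d))) < len' s \<and> elem' s (pr 0 (elem' s (pr 1 (pr m d)))) \<noteq> 1))"

lemma ind_iff_refutes: "ind D W n \<longleftrightarrow> (\<forall>g. \<exists>k. refutes D W n (initial g k))"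
proof
  assume n: "ind D W n"
  show "\<forall>g. \<exists>k. refutes D W n (initial g k)"
  proof (rule allI, rule ccontr)
    fix g assume "\<not> (\<exists>k. refutes D W n (initial g k))"
    then have no: "\<not> refutes D W n (initial g k)" for k by blast
    obtain k where "pr 0 n < k" by blast
    then have "g (pr 0 n) = 1" using no[of k] by (simp add: refutes_def)
    \<comment> \<open>Since no node refutes \<open>n\<close>, every rule for an element of the coded
      set has a premise in that set. By induction the set misses everything that is
      generated.\<close>
    moreover have "g (pr 0 m) \<noteq> 1" if "ind D W m" for m
      using that
    proof induction
      case (1 m d)
      let ?v = "g (pr 1 (pr m d))"
      obtain k where k: "pr 0 m < k" "pr 1 (pr m d) < k" "pr 0 ?v < k"
        by (metis add.commute less_add_Suc1 less_add_Suc2 trans_less_add2)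
      show ?case
      proof
        assume "g (pr 0 m) = 1"
        then have "W m d ?v" "g (pr 0 ?v) = 1"
          using no[of k] 1(1) k unfolding refutes_def by (auto simp del: One_nat_def)
        then show False using 1 by blast
      qed
    qed
    ultimately show False using n by blast
  qed
next
  assume all: "\<forall>g. \<exists>k. refutes D W n (initial g k)"
  show "ind D W n"
  proof (rule ccontr)
    assume n: "\<not> ind D W n"
    define w where "w m d = (SOME v. W m d v \<and> \<not> ind D W v)" for m d
    have w: "W m d (w m d) \<and> \<not> ind D W (w m d)" if "\<not> ind D W m" "D m d" for m d
      unfolding w_def by (rule someI_ex) (use that ind.intros in blast)
    \<comment> \<open>The complement of the generated set, with an ungenerated premise chosen for
      each rule, is a branch on which no node refutes \<open>n\<close>.\<close>
    define g where "g x = (if p1 x = 0 then of_bool (\<not> ind D W (p2 x)) else w (p1 (p2 x)) (p2 (p2 x)))" for x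
    have g: "g (pr 0 m) = of_bool (\<not> ind D W m)" "g (pr 1 (pr m d)) = w m d" for m d
      by (simp_all add: g_def)
    obtain k where "refutes D W n (initial g k)" using all by blast
    then show False
      unfolding refutes_def
    proof (elim disjE exE conjE)
      assume "pr 0 n < len' (initial g k)" "elem' (initial g k) (pr 0 n) \<noteq> 1"
      then show False using n by (simp add: g)
    next
      fix m d assume m: "D m d" "pr 0 m < len' (initial g k)" "elem' (initial g k) (pr 0 m) = 1"
        "pr 1 (pr m d) < len' (initial g k)"
      then have nm: "\<not> ind D W m" by (cases "ind D W m") (simp_all add: g)
      have v: "elem' (initial g k) (pr 1 (pr m d)) = w m d"
        using m(4) g(2)[of m d] by (simp del: One_nat_def)
      { assume "\<not> W m d (elem' (initial g k) (pr 1 (pr m d)))"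
        then show False using w[OF nm m(1)] v by simp }
      { assume "pr 0 (elem' (initial g k) (pr 1 (pr m d))) < len' (initial g k)"
          "elem' (initial g k) (pr 0 (elem' (initial g k) (pr 1 (pr m d)))) \<noteq> 1"
        then show False using w[OF nm m(1)] unfolding v by (simp add: g) }
    qed
  qed
qed

lemma definable_ind:
  assumes D: "definable (\<lambda>e z. D (p1 e) (p2 e) z)"
    and W: "definable (\<lambda>e z. W (p1 e) (p1 (p2 e)) (p2 (p2 e)) z)"
  shows "definable (\<lambda>e z. ind (\<lambda>n d. D n d z) (\<lambda>n d m. W n d m z) e)"
proof -
  have D': "definable (\<lambda>e z. D (f e) (g e) z)" if "cf f" "cf g" for f g
    using definable_subst[OF D cf_pr[OF that]] by simp
  have W': "definable (\<lambda>e z. W (f e) (g e) (h e) z)" if "cf f" "cf g" "cf h" for f g h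
    using definable_subst[OF W cf_pr[OF that(1) cf_pr[OF that(2,3)]]] by simp
  have "definable (\<lambda>e z. refutes (\<lambda>n d. D n d z) (\<lambda>n d m. W n d m z) (p1 e) (p2 e))"
    unfolding refutes_def by (intro definable_intros D' W' cf_intros)
  from definable.branches[OF this] show ?thesis unfolding ind_iff_refutes by simp
qed

section \<open>Reachability is definable\<close>

lemma tlim_cofinal: "tcof t f v \<Longrightarrow> tcof t f (tlim t f)"
  unfolding tlim_def by (auto intro: LeastI)

lemma tlim_eventually:
  assumes "tlimit t"
  shows "\<exists>s<t. \<forall>u. s \<le> u \<and> u < t \<longrightarrow> tlim t f \<le> f u"
proof (cases "tlim t f")
  case 0
  then show ?thesis using tlimit_not_zero[OF assms] by auto
next
  case (Suc v)
  have "\<not> tcof t f v"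
  proof
    assume "tcof t f v"
    then have "tlim t f \<le> v" unfolding tlim_def by (auto intro: Least_le)
    with Suc show False by simp
  qed
  then show ?thesis unfolding tcof_def Suc by (metis not_less_eq_eq)
qed

lemma nth'_cons [simp]: "nth' (Suc (pr x s)) 0 = x" "nth' (Suc (pr x s)) (Suc j) = nth' s j"
  by (simp_all add: nth'_def tl'_def funpow_swap1[symmetric] del: funpow.simps add: funpow_Suc_right)

lemma ex_code: "\<exists>c. \<forall>j<K. nth' c j = v j"
proof (induction K arbitrary: v)
  case (Suc K)
  obtain c where c: "\<forall>j<K. nth' c j = v (Suc j)" using Suc.IH[of "\<lambda>j. v (Suc j)"] by blast
  have "nth' (Suc (pr (v 0) c)) j = v j" if "j < Suc K" for j
    using that c by (cases j) auto
  then show ?case by blast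
qed simp

lemma nth'_0 [simp]: "nth' 0 j = 0"
proof -
  have "(tl' ^^ j) 0 = 0" by (induction j) auto
  then show ?thesis by (simp add: nth'_def)
qed

text \<open>
  \<open>V z t j\<close> is component \<open>j\<close> of the state at time \<open>t\<close> with oracle \<open>z\<close>.  States are coded by numbers, and
  only the first \<open>K\<close> entries of a code matter, so that codes are not unique.
\<close>

locale liminf_machine =
  fixes K :: nat and V :: "nat set \<Rightarrow> ctime \<Rightarrow> nat \<Rightarrow> nat" and Stp :: "nat \<Rightarrow> nat \<Rightarrow> nat set \<Rightarrow> bool"
  assumes Stp_definable: "definable (\<lambda>e z. Stp (p1 e) (p2 e) z)"
    and Stp: "(\<And>j. j < K \<Longrightarrow> V z s j = nth' c j) \<Longrightarrow>
      Stp c c' z \<longleftrightarrow> (\<forall>j<K. V z (tsuc s) j = nth' c' j)"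
    and lim: "tlimit t \<Longrightarrow> j < K \<Longrightarrow> V z t j = tlim t (\<lambda>s. V z s j)"
begin

section \<open>Runs between two states and their overflows\<close>

definition sim :: "nat set \<Rightarrow> ctime \<Rightarrow> nat \<Rightarrow> bool" where
  "sim z s c \<longleftrightarrow> (\<forall>j\<in>{..<K}. V z s j = nth' c j)"

definition geq :: "nat \<Rightarrow> nat \<Rightarrow> bool" where
  "geq c b \<longleftrightarrow> (\<forall>j\<in>{..<K}. nth' b j \<le> nth' c j)"

definition eqv :: "nat \<Rightarrow> nat \<Rightarrow> bool" where
  "eqv c d \<longleftrightarrow> (\<forall>j\<in>{..<K}. nth' c j = nth' d j)"

definition overflow :: "nat set \<Rightarrow> ctime \<Rightarrow> nat set" where
  "overflow z t = {j. j < K \<and> \<not> (\<exists>v. tcof t (\<lambda>s. V z s j) v)}"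

definition good :: "nat set \<Rightarrow> nat set \<Rightarrow> ctime \<Rightarrow> ctime \<Rightarrow> bool" where
  "good A z s t \<longleftrightarrow> s \<le> t \<and> (\<forall>l. s < l \<and> l \<le> t \<and> tlimit l \<longrightarrow> overflow z l \<subseteq> A)"

text \<open>In contrast to \<open>good\<close>, the start counts and the end does not: what matters
  at a limit are lower bounds at the times before it.\<close>

definition above :: "nat set \<Rightarrow> nat \<Rightarrow> ctime \<Rightarrow> ctime \<Rightarrow> bool" where
  "above z b s t \<longleftrightarrow> (\<forall>u. s \<le> u \<and> u < t \<longrightarrow> (\<forall>j\<in>{..<K}. nth' b j \<le> V z u j))"

definition cod :: "nat set \<Rightarrow> ctime \<Rightarrow> nat" where
  "cod z s = (SOME c. sim z s c)"

lemma sim_cod: "sim z s (cod z s)"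
proof -
  have "\<exists>c. sim z s c" using ex_code[of K "V z s"] unfolding sim_def by (metis lessThan_iff)
  then show ?thesis unfolding cod_def by (rule someI_ex)
qed

lemma nth'_cod: "j < K \<Longrightarrow> nth' (cod z s) j = V z s j"
  using sim_cod by (simp add: sim_def)

lemma Stp_sim: "sim z s c \<Longrightarrow> Stp c c' z \<longleftrightarrow> sim z (tsuc s) c'"
  using Stp[of z s c c'] unfolding sim_def by simp blast

lemma good_trans: "good A z s t \<Longrightarrow> good A z t u \<Longrightarrow> good A z s u"
  unfolding good_def by (meson leI order_trans)

lemma good_sub: "good A z s t \<Longrightarrow> s \<le> s' \<Longrightarrow> s' \<le> t' \<Longrightarrow> t' \<le> t \<Longrightarrow> good A z s' t'"
  unfolding good_def by (meson order_trans le_less_trans)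

lemma good_refl: "good A z s s"
  unfolding good_def by (meson leD order_refl)

lemma good_tsuc: "good A z s t \<Longrightarrow> good A z s (tsuc t)"
  unfolding good_def
  by (metis less_imp_le less_tsuc less_tsuc_iff nless_le not_tlimit_tsuc order_trans)

lemma above_trans: "above z b s t \<Longrightarrow> above z b t u \<Longrightarrow> above z b s u"
  unfolding above_def by (meson leI)

lemma above_refl: "above z b s s"
  unfolding above_def by (meson leD)

lemma above_sub: "above z b s t \<Longrightarrow> s \<le> s' \<Longrightarrow> t' \<le> t \<Longrightarrow> above z b s' t'"
  unfolding above_def by (meson order_trans less_le_trans)

lemma above_0: "above z 0 s t"
  unfolding above_def by simp

text \<open>Times can be eliminated in favour of codes since the future of a run depends on its
  state alone: soundness is asked for every time \<open>s\<close> with state \<open>c\<close>. The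
  bound \<open>b\<close> is carried along because the approach to a limit has to stay above the
  limit values.\<close>

definition adequate :: "nat set \<Rightarrow> (nat \<Rightarrow> nat \<Rightarrow> nat \<Rightarrow> nat set \<Rightarrow> bool) \<Rightarrow> bool" where
  "adequate A T \<longleftrightarrow>
    definable (\<lambda>e z. T (p1 e) (p1 (p2 e)) (p2 (p2 e)) z) \<and>
    (\<forall>z c b c' s. T c b c' z \<longrightarrow> sim z s c \<longrightarrow> (\<exists>t. good A z s t \<and> above z b s t \<and> sim z t c')) \<and>
    (\<forall>z c b c' s t. good A z s t \<longrightarrow> above z b s t \<longrightarrow> sim z s c \<longrightarrow> sim z t c' \<longrightarrow> T c b c' z)"

lemma adequate_sound:
  "adequate A T \<Longrightarrow> T c b c' z \<Longrightarrow> sim z s c \<Longrightarrow> \<exists>t. good A z s t \<and> above z b s t \<and> sim z t c'"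
  unfolding adequate_def by blast

lemma adequate_complete:
  "adequate A T \<Longrightarrow> good A z s t \<Longrightarrow> above z b s t \<Longrightarrow> sim z s c \<Longrightarrow> sim z t c' \<Longrightarrow> T c b c' z"
  unfolding adequate_def by blast

text \<open>
  With \<open>T\<close> describing the runs that never overflow at \<open>j\<close>, the relation \<open>macro T A j\<close> describes runs
  that reach a first limit with an overflow at \<open>j\<close>.  The inferior limits at that limit can be read off
  from \<open>T\<close>, as the future of a run depends on its current state only.
\<close>

definition ov :: "(nat \<Rightarrow> nat \<Rightarrow> nat \<Rightarrow> nat set \<Rightarrow> bool) \<Rightarrow> nat \<Rightarrow> nat \<Rightarrow> nat set \<Rightarrow> bool" where
  "ov T i c z \<longleftrightarrow> (\<forall>k. \<exists>u. T c 0 u z \<and> (\<forall>v. T u 0 v z \<longrightarrow> k \<le> nth' v i))"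

definition fin :: "(nat \<Rightarrow> nat \<Rightarrow> nat \<Rightarrow> nat set \<Rightarrow> bool) \<Rightarrow> nat \<Rightarrow> nat \<Rightarrow> nat \<Rightarrow> nat set \<Rightarrow> bool" where
  "fin T i c d z \<longleftrightarrow> (\<exists>u. T c 0 u z \<and> (\<forall>v. T u 0 v z \<longrightarrow> nth' d i \<le> nth' v i)) \<and>
     \<not> (\<exists>u. T c 0 u z \<and> (\<forall>v. T u 0 v z \<longrightarrow> Suc (nth' d i) \<le> nth' v i))"

definition macro :: "(nat \<Rightarrow> nat \<Rightarrow> nat \<Rightarrow> nat set \<Rightarrow> bool) \<Rightarrow> nat set \<Rightarrow> nat \<Rightarrow> nat \<Rightarrow> nat \<Rightarrow> nat \<Rightarrow> nat set \<Rightarrow> bool" where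
  "macro T A j c b d z \<longleftrightarrow> (\<forall>u. T c 0 u z \<longrightarrow> geq u b) \<and> ov T j c z \<and>
     (\<forall>i\<in>{..<K}. fin T i c d z \<or> i \<in> A \<and> ov T i c z \<and> nth' d i = 0)"

text \<open>As \<open>good\<close> first fails at \<open>l\<close>, the states that \<open>T\<close>
  reaches from \<open>c\<close> are exactly those at times from \<open>s\<close> up to but excluding
  \<open>l\<close>. Quantifiers over codes thus replace quantifiers over the times near
  \<open>l\<close>.\<close>

lemma eventually_iff:
  assumes T: "adequate B T" and l: "s < l" "\<forall>t. s \<le> t \<and> t < l \<longrightarrow> good B z s t" "\<not> good B z s l"
    and c: "sim z s c" and i: "i < K"
  shows "(\<exists>u. T c 0 u z \<and> (\<forall>v. T u 0 v z \<longrightarrow> k \<le> nth' v i)) \<longleftrightarrow>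
    (\<exists>t. s \<le> t \<and> t < l \<and> (\<forall>t'. t \<le> t' \<and> t' < l \<longrightarrow> k \<le> V z t' i))"
proof
  have less: "t < l" if "good B z s t" for t
    using that l(1,3) good_sub[OF that] by (meson not_less less_imp_le order_refl)
  {
    assume "\<exists>u. T c 0 u z \<and> (\<forall>v. T u 0 v z \<longrightarrow> k \<le> nth' v i)"
    then obtain u where u: "T c 0 u z" "\<And>v. T u 0 v z \<Longrightarrow> k \<le> nth' v i" by blast
    obtain t where t: "good B z s t" "sim z t u" using adequate_sound[OF T u(1) c] by blast
    have st: "s \<le> t" using t by (simp add: good_def)
    have "k \<le> V z t' i" if "t \<le> t'" "t' < l" for t'
    proof -
      have "good B z t t'" using good_sub[of B z s t'] l(2) that st order_trans by blast
      then have "T u 0 (cod z t') z" using adequate_complete[OF T _ above_0 t(2) sim_cod] by blast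
      then show ?thesis using u(2) nth'_cod[OF i] by metis
    qed
    then show "\<exists>t. s \<le> t \<and> t < l \<and> (\<forall>t'. t \<le> t' \<and> t' < l \<longrightarrow> k \<le> V z t' i)"
      using st less[OF t(1)] by blast
  next
    assume "\<exists>t. s \<le> t \<and> t < l \<and> (\<forall>t'. t \<le> t' \<and> t' < l \<longrightarrow> k \<le> V z t' i)"
    then obtain t where t: "s \<le> t" "t < l" "\<And>t'. t \<le> t' \<Longrightarrow> t' < l \<Longrightarrow> k \<le> V z t' i" by blast
    have g: "good B z s t" using l(2) t by blast
    have "T c 0 (cod z t) z" using adequate_complete[OF T g above_0 c sim_cod] .
    moreover have "k \<le> nth' v i" if v: "T (cod z t) 0 v z" for v
    proof -
      obtain t' where t': "good B z t t'" "sim z t' v" using adequate_sound[OF T v sim_cod] by blast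
      have "t' < l" using less good_trans[OF g t'(1)] by blast
      moreover have "t \<le> t'" using t'(1) by (simp add: good_def)
      ultimately have "k \<le> V z t' i" using t(3) by blast
      then show ?thesis using t'(2) i by (simp add: sim_def)
    qed
    ultimately show "\<exists>u. T c 0 u z \<and> (\<forall>v. T u 0 v z \<longrightarrow> k \<le> nth' v i)" by blast
  }
qed

lemma macro_iff:
  assumes T: "adequate B T" and l: "s < l" "\<forall>t. s \<le> t \<and> t < l \<longrightarrow> good B z s t" "\<not> good B z s l"
    and lm: "tlimit l" and c: "sim z s c" and j: "j < K"
  shows "macro T A j c b d z \<longleftrightarrow>
    above z b s l \<and> j \<in> overflow z l \<and> overflow z l \<subseteq> A \<and> sim z l d"
proof -
  note ev = eventually_iff[OF T l c]
  have evl: "(\<exists>t. s \<le> t \<and> t < l \<and> (\<forall>t'. t \<le> t' \<and> t' < l \<longrightarrow> Suc k \<le> V z t' i)) \<longleftrightarrow>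
      \<not> tcof l (\<lambda>s. V z s i) k" for k i
  proof
    assume "\<exists>t. s \<le> t \<and> t < l \<and> (\<forall>t'. t \<le> t' \<and> t' < l \<longrightarrow> Suc k \<le> V z t' i)"
    then show "\<not> tcof l (\<lambda>s. V z s i) k" unfolding tcof_def by (metis not_less_eq_eq)
  next
    assume "\<not> tcof l (\<lambda>s. V z s i) k"
    then obtain t where t: "t < l" "\<And>u. t \<le> u \<Longrightarrow> u < l \<Longrightarrow> Suc k \<le> V z u i"
      unfolding tcof_def by (metis not_less_eq_eq)
    then have "s \<le> max s t \<and> max s t < l \<and> (\<forall>t'. max s t \<le> t' \<and> t' < l \<longrightarrow> Suc k \<le> V z t' i)"
      using l(1) by auto
    then show "\<exists>t. s \<le> t \<and> t < l \<and> (\<forall>t'. t \<le> t' \<and> t' < l \<longrightarrow> Suc k \<le> V z t' i)" by blast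
  qed
  have ev0: "\<exists>t. s \<le> t \<and> t < l \<and> (\<forall>t'. t \<le> t' \<and> t' < l \<longrightarrow> 0 \<le> V z t' i)" for i
    using l(1) by auto
  have ov: "ov T i c z \<longleftrightarrow> i \<in> overflow z l" if i: "i < K" for i
  proof -
    have "ov T i c z \<longleftrightarrow> (\<forall>k. \<not> tcof l (\<lambda>s. V z s i) k)"
      unfolding ov_def ev[OF i]
    proof
      assume L: "\<forall>k. \<exists>t. s \<le> t \<and> t < l \<and> (\<forall>t'. t \<le> t' \<and> t' < l \<longrightarrow> k \<le> V z t' i)"
      show "\<forall>k. \<not> tcof l (\<lambda>s. V z s i) k" using L[rule_format, of "Suc k" for k] evl by blast
    next
      assume R: "\<forall>k. \<not> tcof l (\<lambda>s. V z s i) k"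
      show "\<forall>k. \<exists>t. s \<le> t \<and> t < l \<and> (\<forall>t'. t \<le> t' \<and> t' < l \<longrightarrow> k \<le> V z t' i)"
      proof
        fix k show "\<exists>t. s \<le> t \<and> t < l \<and> (\<forall>t'. t \<le> t' \<and> t' < l \<longrightarrow> k \<le> V z t' i)"
          using R evl[where i = i] ev0[of i] by (cases k) blast+
      qed
    qed
    then show ?thesis using i by (simp add: overflow_def)
  qed
  have fin: "fin T i c d z \<longleftrightarrow> i \<notin> overflow z l \<and> V z l i = nth' d i" if i: "i < K" for i
  proof
    assume f: "fin T i c d z"
    then have cof: "tcof l (\<lambda>s. V z s i) (nth' d i)"
      unfolding fin_def ev[OF i] evl by blast
    obtain t where t: "t < l" "\<And>t'. t \<le> t' \<Longrightarrow> t' < l \<Longrightarrow> nth' d i \<le> V z t' i"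
      using f unfolding fin_def ev[OF i] by blast
    have "tlim l (\<lambda>s. V z s i) = nth' d i"
      by (rule tlimI[OF t]) (use cof in \<open>auto simp: tcof_def\<close>)
    then show "i \<notin> overflow z l \<and> V z l i = nth' d i"
      using cof lim[OF lm i] by (auto simp: overflow_def)
  next
    assume a: "i \<notin> overflow z l \<and> V z l i = nth' d i"
    then obtain v where "tcof l (\<lambda>s. V z s i) v" using i by (auto simp: overflow_def)
    from tlim_cofinal[OF this] have "tcof l (\<lambda>s. V z s i) (nth' d i)" using a lim[OF lm i] by simp
    moreover obtain t where "t < l" "\<And>u. t \<le> u \<Longrightarrow> u < l \<Longrightarrow> nth' d i \<le> V z u i"
      using tlim_eventually[OF lm, of "\<lambda>s. V z s i"] a lim[OF lm i] by auto
    then have "s \<le> max s t \<and> max s t < l \<and> (\<forall>t'. max s t \<le> t' \<and> t' < l \<longrightarrow> nth' d i \<le> V z t' i)"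
      using l(1) by auto
    ultimately show "fin T i c d z" unfolding fin_def ev[OF i] evl by blast
  qed
  have ov0: "V z l i = 0" if "i \<in> overflow z l" for i
    using that lim[OF lm, of i z] by (simp add: overflow_def tlim_def)
  have ab: "(\<forall>u. T c 0 u z \<longrightarrow> geq u b) \<longleftrightarrow> above z b s l"
  proof
    assume L: "\<forall>u. T c 0 u z \<longrightarrow> geq u b"
    show "above z b s l"
      unfolding above_def
    proof (intro allI impI ballI)
      fix u i assume u: "s \<le> u \<and> u < l" and i: "i \<in> {..<K}"
      then have "T c 0 (cod z u) z" using adequate_complete[OF T _ above_0 c sim_cod] l(2) by blast
      then have "geq (cod z u) b" using L by blast
      then have "nth' b i \<le> nth' (cod z u) i" using i unfolding geq_def by blast
      then show "nth' b i \<le> V z u i" using i nth'_cod[of i z u] by simp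
    qed
  next
    assume R: "above z b s l"
    show "\<forall>u. T c 0 u z \<longrightarrow> geq u b"
    proof (intro allI impI)
      fix u assume "T c 0 u z"
      then obtain t where t: "good B z s t" "sim z t u" using adequate_sound[OF T _ c] by blast
      have "t < l" using t(1) l(1,3) good_sub[OF t(1)] by (meson not_less less_imp_le order_refl)
      then show "geq u b" using R t unfolding above_def geq_def good_def sim_def by metis
    qed
  qed
  have "macro T A j c b d z \<longleftrightarrow> above z b s l \<and> j \<in> overflow z l \<and>
      (\<forall>i\<in>{..<K}. i \<notin> overflow z l \<and> V z l i = nth' d i \<or> i \<in> A \<and> i \<in> overflow z l \<and> nth' d i = 0)"
    unfolding macro_def ab ov[OF j] using ov fin by simp
  also have "(\<forall>i\<in>{..<K}. i \<notin> overflow z l \<and> V z l i = nth' d i \<or> i \<in> A \<and> i \<in> overflow z l \<and> nth' d i = 0)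
      \<longleftrightarrow> overflow z l \<subseteq> A \<and> sim z l d"
  proof -
    have "overflow z l \<subseteq> {..<K}" by (auto simp: overflow_def)
    then show ?thesis unfolding sim_def using ov0 by (metis subset_iff)
  qed
  finally show ?thesis .
qed

lemma macro_sound:
  assumes T: "adequate (A - {j}) T" and m: "macro T A j c b d z" and c: "sim z s c" and j: "j < K"
  shows "\<exists>t. good A z s t \<and> above z b s t \<and> sim z t d"
proof -
  let ?B = "A - {j}"
  \<comment> \<open>Otherwise component \<open>j\<close> would, for every \<open>k\<close>, be at
    least \<open>k\<close> from some countable time on; at the supremum of these times it would have
    to exceed all numbers.\<close>
  have "\<exists>t. s \<le> t \<and> \<not> good ?B z s t"
  proof (rule ccontr)
    assume "\<not> (\<exists>t. s \<le> t \<and> \<not> good ?B z s t)"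
    then have all: "good ?B z s t" if "s \<le> t" for t using that by blast
    have "\<exists>t\<ge>s. \<forall>t'\<ge>t. k \<le> V z t' j" for k
    proof -
      obtain u where u: "T c 0 u z" "\<And>v. T u 0 v z \<Longrightarrow> k \<le> nth' v j"
        using m unfolding macro_def ov_def by blast
      obtain t where t: "good ?B z s t" "sim z t u" using adequate_sound[OF T u(1) c] by blast
      have st: "s \<le> t" using t by (simp add: good_def)
      have "k \<le> V z t' j" if tt: "t \<le> t'" for t'
      proof -
        have "good ?B z t t'" using good_sub[OF all[of t']] st tt order_trans by blast
        then have "T u 0 (cod z t') z" using adequate_complete[OF T _ above_0 t(2) sim_cod] by blast
        then show ?thesis using u(2) nth'_cod[OF j] by metis
      qed
      then show ?thesis using st by blast
    qed
    then obtain f where f: "\<And>k t'. f k \<le> t' \<Longrightarrow> k \<le> V z t' j" by metis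
    have "k \<le> V z (tsup f) j" for k using f less_imp_le[OF less_tsup] by blast
    then show False using not_less_eq_eq by blast
  qed
  define l where "l = (LEAST t. s \<le> t \<and> \<not> good ?B z s t)"
  have l: "s \<le> l" "\<not> good ?B z s l"
    using LeastI_ex[OF \<open>\<exists>t. s \<le> t \<and> \<not> good ?B z s t\<close>] unfolding l_def by blast+
  have below: "\<forall>t. s \<le> t \<and> t < l \<longrightarrow> good ?B z s t"
    using not_less_Least[of _ "\<lambda>t. s \<le> t \<and> \<not> good ?B z s t"] unfolding l_def by blast
  have sl: "s < l" using l good_refl by (metis nless_le)
  have lm: "tlimit l"
  proof (cases l rule: ctime_cases)
    case zero
    then show ?thesis using sl by blast
  next
    case (suc t)
    then have "s \<le> t" "t < l" using sl less_tsuc_iff by auto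
    then show ?thesis using good_tsuc[of ?B z s t] below l(2) suc by blast
  qed
  have r: "above z b s l" "overflow z l \<subseteq> A" "sim z l d"
    using m macro_iff[OF T sl below l(2) lm c j] by blast+
  have "good A z s l"
    unfolding good_def
  proof (intro conjI allI impI)
    fix l' assume l': "s < l' \<and> l' \<le> l \<and> tlimit l'"
    show "overflow z l' \<subseteq> A"
    proof (cases "l' = l")
      case False
      then have "s \<le> l' \<and> l' < l" using l' less_imp_le le_neq_trans by blast
      then have "good ?B z s l'" using below by blast
      then show ?thesis using l' unfolding good_def by blast
    qed (use r in simp)
  qed (rule l)
  then show ?thesis using r by blast
qed

section \<open>A derivation system for runs, with soundness and completeness\<close>

definition eT :: "nat \<Rightarrow> nat \<Rightarrow> nat \<Rightarrow> nat" where "eT c b d = pr 0 (pr c (pr b d))"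
definition eE :: "nat \<Rightarrow> nat \<Rightarrow> nat \<Rightarrow> nat" where "eE c m i = pr 1 (pr c (pr m i))"
definition eC :: "nat \<Rightarrow> nat \<Rightarrow> nat \<Rightarrow> nat \<Rightarrow> nat" where "eC c m i d = pr 2 (pr c (pr m (pr i d)))"

text \<open>
  \<open>eT c b d\<close> stands for a run from \<open>c\<close> to \<open>d\<close> that stays above \<open>b\<close>.  \<open>eC c m i d\<close> stands for such a
  run that stays above \<open>m\<close> and attains successively the components \<open>p1 0, \<dots>, p1 (i - 1)\<close> of \<open>m\<close>.  As
  each component is listed infinitely often, \<open>m\<close> is the state at a limit time if there are such runs
  for all \<open>i\<close>, which is expressed by \<open>eE c m i\<close>.
\<close>

definition rule :: "(nat \<Rightarrow> nat \<Rightarrow> nat \<Rightarrow> nat set \<Rightarrow> bool) \<Rightarrow> nat \<Rightarrow> nat \<Rightarrow> nat set \<Rightarrow> bool" where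
  "rule Mac n r z \<longleftrightarrow>
    (\<exists>c b d. n = eT c b d \<and>
      (r = pr 0 0 \<and> eqv c d \<or> r = pr 1 0 \<and> geq c b \<and> Stp c d z \<or> r = pr 2 0 \<and> geq d b \<or>
       r = pr 3 0 \<and> Mac c b d z \<or> (\<exists>m. r = pr 4 m))) \<or>
    (\<exists>c m i. n = eE c m i) \<or>
    (\<exists>c m i d. n = eC c m i d \<and>
      (i = 0 \<and> eqv c d \<or>
       (\<exists>k a u. i = Suc k \<and> r = pr a u \<and> geq u m \<and> Stp u d z \<and>
         (p1 k < K \<longrightarrow> nth' u (p1 k) = nth' m (p1 k)))))"

definition prem :: "nat \<Rightarrow> nat \<Rightarrow> nat \<Rightarrow> nat set \<Rightarrow> bool" where
  "prem n r x z \<longleftrightarrow>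
    (\<exists>c b d. n = eT c b d \<and>
      (r = pr 2 0 \<and> (\<exists>i. x = eE c d i) \<or> (\<exists>m. r = pr 4 m \<and> (x = eT c b m \<or> x = eT m b d)))) \<or>
    (\<exists>c m i. n = eE c m i \<and> x = eC c m i r) \<or>
    (\<exists>c m k d a u. n = eC c m (Suc k) d \<and> r = pr a u \<and> (x = eC c m k a \<or> x = eT a m u))"

abbreviation der :: "(nat \<Rightarrow> nat \<Rightarrow> nat \<Rightarrow> nat set \<Rightarrow> bool) \<Rightarrow> nat set \<Rightarrow> nat \<Rightarrow> bool" where
  "der Mac z \<equiv> ind (\<lambda>n r. rule Mac n r z) (\<lambda>n r x. prem n r x z)"

lemmas e_defs = eT_def eE_def eC_def

lemma der_refl: "eqv c d \<Longrightarrow> der Mac z (eT c b d)"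
  by (rule ind.intros[of _ _ "pr 0 0"]) (auto simp: rule_def prem_def e_defs)

lemma der_step: "geq c b \<Longrightarrow> Stp c d z \<Longrightarrow> der Mac z (eT c b d)"
  by (rule ind.intros[of _ _ "pr 1 0"]) (auto simp: rule_def prem_def e_defs)

lemma der_lim: "geq d b \<Longrightarrow> (\<And>i. der Mac z (eE c d i)) \<Longrightarrow> der Mac z (eT c b d)"
  by (rule ind.intros[of _ _ "pr 2 0"]) (auto simp: rule_def prem_def e_defs)

lemma der_mac: "Mac c b d z \<Longrightarrow> der Mac z (eT c b d)"
  by (rule ind.intros[of _ _ "pr 3 0"]) (auto simp: rule_def prem_def e_defs)

lemma der_trans: "der Mac z (eT c b m) \<Longrightarrow> der Mac z (eT m b d) \<Longrightarrow> der Mac z (eT c b d)"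
  by (rule ind.intros[of _ _ "pr 4 m"]) (auto simp: rule_def prem_def e_defs)

lemma der_E: "der Mac z (eC c m i d) \<Longrightarrow> der Mac z (eE c m i)"
  by (rule ind.intros[of _ _ d]) (auto simp: rule_def prem_def e_defs)

lemma der_C_0: "eqv c d \<Longrightarrow> der Mac z (eC c m 0 d)"
  by (rule ind.intros[of _ _ 0]) (auto simp: rule_def prem_def e_defs)

text \<open>The component is attained at \<open>u\<close>, and one further step leads to
  \<open>d\<close>. This step makes successive rounds strictly later, so that their supremum is a
  limit time.\<close>

lemma der_C_Suc:
  "der Mac z (eC c m k a) \<Longrightarrow> der Mac z (eT a m u) \<Longrightarrow> geq u m \<Longrightarrow> Stp u d z \<Longrightarrow>
    (p1 k < K \<Longrightarrow> nth' u (p1 k) = nth' m (p1 k)) \<Longrightarrow> der Mac z (eC c m (Suc k) d)"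
  by (rule ind.intros[of _ _ "pr a u"]) (auto simp: rule_def prem_def e_defs)

lemma geq_definable: "cf f \<Longrightarrow> cf g \<Longrightarrow> definable (\<lambda>e z. geq (f e) (g e))"
  unfolding geq_def by (intro definable_Ball finite_lessThan definable_le cf_nth' cf_const)

lemma der_definable:
  assumes "definable (\<lambda>e z. Mac (p1 e) (p1 (p2 e)) (p2 (p2 e)) z)"
  shows "definable (\<lambda>e z. der Mac z e)"
proof -
  have Mac: "definable (\<lambda>e z. Mac (f e) (g e) (h e) z)" if "cf f" "cf g" "cf h" for f g h
    using definable_subst[OF assms cf_pr[OF that(1) cf_pr[OF that(2,3)]]] by simp
  have St: "definable (\<lambda>e z. Stp (f e) (g e) z)" if "cf f" "cf g" for f g
    using definable_subst[OF Stp_definable cf_pr[OF that]] by simp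
  have eqv: "definable (\<lambda>e z. eqv (f e) (g e))" if "cf f" "cf g" for f g
    unfolding eqv_def by (intro definable_Ball finite_lessThan definable_eq cf_nth' cf_const that)
  show ?thesis
  proof (rule definable_ind)
    show "definable (\<lambda>e z. rule Mac (p1 e) (p2 e) z)"
      unfolding rule_def e_defs by (intro definable_intros Mac St geq_definable eqv cf_intros)
    show "definable (\<lambda>e z. prem (p1 e) (p1 (p2 e)) (p2 (p2 e)) z)"
      unfolding prem_def e_defs by (intro definable_intros cf_intros)
  qed
qed

text \<open>The semantic counterpart of \<open>eC\<close>, with times in place of codes.\<close>

primrec chain :: "nat set \<Rightarrow> nat set \<Rightarrow> nat \<Rightarrow> nat \<Rightarrow> ctime \<Rightarrow> ctime \<Rightarrow> bool" where
  "chain A z m 0 s t \<longleftrightarrow> t = s"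
| "chain A z m (Suc k) s t \<longleftrightarrow> (\<exists>t' u. chain A z m k s t' \<and> good A z t' u \<and> above z m t' (tsuc u) \<and>
     t = tsuc u \<and> (p1 k < K \<longrightarrow> V z u (p1 k) = nth' m (p1 k)))"

lemma chain_good: "chain A z m i s t \<Longrightarrow> good A z s t \<and> above z m s t"
proof (induction i arbitrary: t)
  case 0
  then show ?case using good_refl above_refl by auto
next
  case (Suc i)
  then show ?case using good_trans good_tsuc above_trans by simp blast
qed

lemma chain_limit:
  assumes ch: "\<And>i. \<exists>t. chain A z m i s t"
  shows "\<exists>t. good A z s t \<and> above z m s t \<and> sim z t m"
proof -
  \<comment> \<open>Chains of different lengths need not extend each other. The least end times
    nevertheless increase strictly, with the required component attained in between.\<close>
  define f where "f i = (LEAST t. chain A z m i s t)" for i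
  have f: "chain A z m i s (f i)" for i unfolding f_def using LeastI_ex[OF ch] .
  have f_least: "f i \<le> t" if "chain A z m i s t" for i t unfolding f_def using that by (rule Least_le)
  have hit: "\<exists>u. f i \<le> u \<and> u < f (Suc i) \<and> (p1 i < K \<longrightarrow> V z u (p1 i) = nth' m (p1 i))" for i
  proof -
    obtain t' u where u: "chain A z m i s t'" "good A z t' u" "f (Suc i) = tsuc u"
      "p1 i < K \<longrightarrow> V z u (p1 i) = nth' m (p1 i)" using f[of "Suc i"] by auto
    have "f i \<le> u" using f_least[OF u(1)] u(2) by (auto simp: good_def)
    then show ?thesis using u by auto
  qed
  then have inc: "f i < f (Suc i)" for i using le_less_trans by blast
  have mono: "f i \<le> f k" if "i \<le> k" for i k
    using that by (rule lift_Suc_mono_le[rotated]) (use inc less_imp_le in blast)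
  define l where "l = tsup f"
  have lm: "tlimit l" unfolding l_def using inc by (rule tlimit_tsup)
  have sl: "s < l" using less_tsup[of f 0] f[of 0] by (simp add: l_def)
  have ab: "above z m s l"
    unfolding above_def
  proof (intro allI impI)
    fix u assume u: "s \<le> u \<and> u < l"
    then obtain k where "u \<le> f k" using less_tsupD[of _ f] unfolding l_def by blast
    then have "u < f (Suc k)" using inc le_less_trans by blast
    then show "\<forall>j\<in>{..<K}. nth' m j \<le> V z u j"
      using chain_good[OF f[of "Suc k"]] u unfolding above_def by blast
  qed
  have cof: "\<exists>u\<ge>s'. u < l \<and> V z u j \<le> nth' m j" if "s' < l" and j: "j < K" for s' j
  proof -
    obtain k where k: "s' \<le> f k" using less_tsupD[of s' f] \<open>s' < l\<close> unfolding l_def by blast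
    \<comment> \<open>Component \<open>j\<close> is due in round \<open>pr j k\<close> for every
      \<open>k\<close>, hence cofinally often.\<close>
    obtain u where u: "f (pr j k) \<le> u" "u < f (Suc (pr j k))" "V z u j = nth' m j"
      using hit[of "pr j k"] j by auto
    have "s' \<le> u" using k mono[OF le_pr(2)[of k j]] u(1) by (meson order_trans)
    moreover have "u < l" using u(2) less_tsup[of f] unfolding l_def by (meson less_trans)
    ultimately show ?thesis using u(3) by auto
  qed
  have "V z l j = nth' m j" if j: "j < K" for j
    unfolding lim[OF lm j]
    by (rule tlimI[OF sl]) (use ab cof j in \<open>auto simp: above_def\<close>)
  then have "sim z l m" by (simp add: sim_def)
  moreover have "good A z s l"
    unfolding good_def
  proof (intro conjI allI impI)
    fix l' assume l': "s < l' \<and> l' \<le> l \<and> tlimit l'"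
    show "overflow z l' \<subseteq> A"
    proof (cases "l' = l")
      case True
      have "overflow z l = {}" unfolding overflow_def tcof_def using cof by blast
      then show ?thesis using True by simp
    next
      case False
      then have "l' < l" using l' le_neq_trans by blast
      then obtain k where "l' \<le> f k" using less_tsupD[of _ f] unfolding l_def by blast
      then show ?thesis using chain_good[OF f[of k]] l' unfolding good_def by blast
    qed
  qed (use sl in simp)
  ultimately show ?thesis using ab by blast
qed

lemma sim_eqv: "sim z s c \<Longrightarrow> eqv c d \<Longrightarrow> sim z s d"
  by (simp add: sim_def eqv_def)

lemma eqv_sim: "sim z s c \<Longrightarrow> sim z s d \<Longrightarrow> eqv c d"
  by (simp add: sim_def eqv_def)

lemma above_geq: "geq c b \<Longrightarrow> sim z s c \<Longrightarrow> above z b s (tsuc s)"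
  unfolding above_def geq_def sim_def by (metis antisym_conv2 leD less_tsuc_iff)

lemma above_geq_mono: "geq d b \<Longrightarrow> above z d s t \<Longrightarrow> above z b s t"
  unfolding above_def geq_def by (meson order_trans)

lemma der_sound:
  assumes Mac: "\<forall>c b d s. Mac c b d z \<longrightarrow> sim z s c \<longrightarrow> (\<exists>t. good A z s t \<and> above z b s t \<and> sim z t d)"
    and "der Mac z n"
  shows "(\<forall>c b d s. n = eT c b d \<longrightarrow> sim z s c \<longrightarrow> (\<exists>t. good A z s t \<and> above z b s t \<and> sim z t d)) \<and>
    (\<forall>c m i s. n = eE c m i \<longrightarrow> sim z s c \<longrightarrow> (\<exists>t. chain A z m i s t)) \<and>
    (\<forall>c m i d s. n = eC c m i d \<longrightarrow> sim z s c \<longrightarrow> (\<exists>t. chain A z m i s t \<and> sim z t d))"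
  using assms(2)
proof induction
  case (1 n r)
  let ?T = "\<lambda>c b d s. \<exists>t. good A z s t \<and> above z b s t \<and> sim z t d"
  have IHT: "?T c b d s" if "prem n r (eT c b d) z" "sim z s c" for c b d s
    using "1.IH"[OF that(1)] that(2) by blast
  have IHE: "\<exists>t. chain A z m i s t" if "prem n r (eE c m i) z" "sim z s c" for c m i s
    using "1.IH"[OF that(1)] that(2) by blast
  have IHC: "\<exists>t. chain A z m i s t \<and> sim z t d" if "prem n r (eC c m i d) z" "sim z s c" for c m i d s
    using "1.IH"[OF that(1)] that(2) by blast
  have T: "?T c b d s" if n: "n = eT c b d" and s: "sim z s c" for c b d s
  proof -
    consider "eqv c d" | "geq c b" "Stp c d z" | "r = pr 2 0" "geq d b" | "Mac c b d z" | m where "r = pr 4 m"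
      using 1(1) unfolding rule_def n by (auto simp: e_defs)
    then show ?thesis
    proof cases
      case 1
      then show ?thesis using s sim_eqv good_refl above_refl by blast
    next
      case 2
      then show ?thesis using s Stp_sim above_geq good_tsuc[OF good_refl] by blast
    next
      case 3
      have "\<exists>t. chain A z d i s t" for i
      proof -
        have "prem n r (eE c d i) z" using 3 n unfolding prem_def by blast
        then show ?thesis using IHE s by blast
      qed
      from chain_limit[OF this] show ?thesis using above_geq_mono[OF 3(2)] by blast
    next
      case 4
      then show ?thesis using Mac s by blast
    next
      case (5 m)
      have "prem n r (eT c b m) z" "prem n r (eT m b d) z" using 5 n unfolding prem_def by blast+
      note pr = this
      obtain t where t: "good A z s t" "above z b s t" "sim z t m" using IHT[OF pr(1) s] by blast
      obtain u where "good A z t u" "above z b t u" "sim z u d" using IHT[OF pr(2) t(3)] by blast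
      then show ?thesis using good_trans[OF t(1)] above_trans[OF t(2)] by blast
    qed
  qed
  have E: "\<exists>t. chain A z m i s t" if n: "n = eE c m i" and s: "sim z s c" for c m i s
  proof -
    have "prem n r (eC c m i r) z" using n unfolding prem_def by blast
    then show ?thesis using IHC s by blast
  qed
  have C: "\<exists>t. chain A z m i s t \<and> sim z t d" if n: "n = eC c m i d" and s: "sim z s c" for c m i d s
  proof -
    consider "i = 0" "eqv c d" | k a u where "i = Suc k" "r = pr a u" "geq u m" "Stp u d z"
        "p1 k < K \<longrightarrow> nth' u (p1 k) = nth' m (p1 k)"
      using 1(1) unfolding rule_def n by (auto simp: e_defs)
    then show ?thesis
    proof cases
      case 1
      then show ?thesis using s sim_eqv by auto
    next
      case (2 k a u)
      have "prem n r (eC c m k a) z" "prem n r (eT a m u) z" using 2(1,2) n unfolding prem_def by blast+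
      note pr = this
      obtain t where t: "chain A z m k s t" "sim z t a" using IHC[OF pr(1) s] by blast
      obtain t' where t': "good A z t t'" "above z m t t'" "sim z t' u" using IHT[OF pr(2) t(2)] by blast
      have "above z m t (tsuc t')" using above_trans[OF t'(2) above_geq[OF 2(3) t'(3)]] .
      moreover have "p1 k < K \<longrightarrow> V z t' (p1 k) = nth' m (p1 k)" using 2(5) t'(3) by (simp add: sim_def)
      ultimately have "chain A z m i s (tsuc t')" using 2(1) t(1) t'(1) by auto
      then show ?thesis using Stp_sim[OF t'(3)] 2(4) by blast
    qed
  qed
  show ?case using T E C by blast
qed

text \<open>Induction on the end time. A limit without overflow is derived by the chain rules; a
  limit with overflow is one application of \<open>Mac\<close>, started late enough before
  it.\<close>

lemma der_complete:
  assumes Mac: "\<And>c b d s t j. tlimit t \<Longrightarrow> s < t \<Longrightarrow> j \<in> overflow z t \<Longrightarrow>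
      (\<forall>u. s \<le> u \<and> u < t \<longrightarrow> good (A - {j}) z s u) \<Longrightarrow> overflow z t \<subseteq> A \<Longrightarrow>
      above z b s t \<Longrightarrow> sim z s c \<Longrightarrow> sim z t d \<Longrightarrow> Mac c b d z"
  shows "good A z s t \<Longrightarrow> above z b s t \<Longrightarrow> sim z s c \<Longrightarrow> sim z t d \<Longrightarrow> der Mac z (eT c b d)"
proof (induction t arbitrary: s b c d rule: less_induct)
  case (less t)
  have st: "s \<le> t" using less.prems(1) by (simp add: good_def)
  have IH: "der Mac z (eT c b d)"
    if "u < t" "good A z s u" "above z b s u" "sim z s c" "sim z u d" for u s b c d
    using less.IH that by blast
  show ?case
  proof (cases "s = t")
    case True
    then show ?thesis using less.prems eqv_sim der_refl by blast
  next
    case False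
    then have s: "s < t" using st by simp
    show ?thesis
    proof (cases t rule: ctime_cases)
      case zero
      then show ?thesis using s by blast
    next
      case (suc u)
      have u: "s \<le> u" "u < t" using suc s less_tsuc_iff by auto
      have "der Mac z (eT c b (cod z u))"
        using IH[OF u(2)] good_sub[OF less.prems(1)] above_sub[OF less.prems(2)] less.prems(3) sim_cod u
        by (meson less_imp_le order_refl)
      moreover have "geq (cod z u) b"
        using less.prems(2) u nth'_cod unfolding above_def geq_def by simp
      then have "der Mac z (eT (cod z u) b d)"
        using der_step Stp_sim[OF sim_cod] less.prems(4) suc by blast
      ultimately show ?thesis by (rule der_trans)
    next
      case lim': lim
      show ?thesis
      proof (cases "overflow z t = {}")
        case True
        have cof: "tcof t (\<lambda>s. V z s j) (V z t j)" if "j < K" for j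
          using True that tlim_cofinal lim[OF lim' that] unfolding overflow_def by fastforce
        have "\<exists>s0<t. \<forall>u. s0 \<le> u \<and> u < t \<longrightarrow> V z t j \<le> V z u j" if "j < K" for j
          using tlim_eventually[OF lim', of "\<lambda>s. V z s j"] lim[OF lim' that] by simp
        then obtain g where g: "\<And>j. j < K \<Longrightarrow> g j < t"
          "\<And>j u. j < K \<Longrightarrow> g j \<le> u \<Longrightarrow> u < t \<Longrightarrow> V z t j \<le> V z u j" by metis
        \<comment> \<open>From \<open>s'\<close> on all components are at least their values at
          \<open>t\<close>, so that the limit state \<open>d\<close> can serve as the bound of the
          chain.\<close>
        define s' where "s' = Max (insert s (g ` {..<K}))"
        have s': "s \<le> s'" "s' < t" "\<And>j. j < K \<Longrightarrow> g j \<le> s'"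
          unfolding s'_def using s g(1) by auto
        have ab: "above z d s' t"
          unfolding above_def
        proof (intro allI impI ballI)
          fix u j assume "s' \<le> u \<and> u < t" "j \<in> {..<K}"
          then have "V z t j \<le> V z u j" using g(2)[of j u] s'(3)[of j] order_trans by auto
          then show "nth' d j \<le> V z u j" using less.prems(4) \<open>j \<in> {..<K}\<close> by (simp add: sim_def)
        qed
        have gd: "good A z u v" if "s \<le> u" "u \<le> v" "v < t" for u v
          using good_sub[OF less.prems(1)] that less_imp_le by blast
        have "geq d b"
          unfolding geq_def
        proof
          fix j assume j: "j \<in> {..<K}"
          then obtain u where "u \<ge> s" "u < t" "V z u j \<le> V z t j" using cof[of j] s unfolding tcof_def by blast
          then have "nth' b j \<le> V z t j" using less.prems(2) j unfolding above_def by (meson order_trans)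
          then show "nth' b j \<le> nth' d j" using less.prems(4) j by (simp add: sim_def)
        qed
        have "der Mac z (eT c b (cod z s'))"
          using IH[OF s'(2) gd[OF order_refl s'(1,2)] above_sub[OF less.prems(2) order_refl] less.prems(3) sim_cod]
            s'(2) less_imp_le by blast
        moreover have "\<exists>u. s' \<le> u \<and> u < t \<and> der Mac z (eC (cod z s') d i (cod z u))" for i
        proof (induction i)
          case 0
          then show ?case using der_C_0 eqv_sim[OF sim_cod sim_cod] s'(2) by blast
        next
          case (Suc i)
          then obtain u where u: "s' \<le> u" "u < t" "der Mac z (eC (cod z s') d i (cod z u))" by blast
          have "\<exists>w\<ge>u. w < t \<and> (p1 i < K \<longrightarrow> V z w (p1 i) \<le> V z t (p1 i))"
            using cof[of "p1 i"] u(2) unfolding tcof_def by (cases "p1 i < K") auto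
          then obtain w where w: "u \<le> w" "w < t" "p1 i < K \<longrightarrow> V z w (p1 i) \<le> V z t (p1 i)" by blast
          have sw: "s' \<le> w" using u(1) w(1) by (rule order_trans)
          have "der Mac z (eT (cod z u) d (cod z w))"
            using IH[OF w(2) gd[OF order_trans[OF s'(1) u(1)] w(1,2)] above_sub[OF ab u(1)] sim_cod sim_cod]
              w(2) less_imp_le by blast
          moreover have "geq (cod z w) d"
            unfolding geq_def using ab sw w(2) nth'_cod unfolding above_def by simp
          moreover have "Stp (cod z w) (cod z (tsuc w)) z" using Stp_sim[OF sim_cod] sim_cod by blast
          moreover have "nth' (cod z w) (p1 i) = nth' d (p1 i)" if "p1 i < K"
          proof -
            have "nth' d (p1 i) \<le> V z w (p1 i)" using ab sw w(2) that unfolding above_def by simp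
            moreover have "V z w (p1 i) \<le> nth' d (p1 i)" using w(3) that less.prems(4) by (simp add: sim_def)
            ultimately show ?thesis using nth'_cod[OF that, of z w] by simp
          qed
          ultimately have "der Mac z (eC (cod z s') d (Suc i) (cod z (tsuc w)))"
            using der_C_Suc[OF u(3)] by blast
          moreover have "s' \<le> tsuc w" using sw less_imp_le[OF less_tsuc[of w]] by (rule order_trans)
          ultimately show ?case using tlimit_tsuc_less[OF lim' w(2)] by blast
        qed
        then have "der Mac z (eT (cod z s') b d)"
          using der_lim[OF \<open>geq d b\<close>] der_E by blast
        ultimately show ?thesis by (rule der_trans)
      next
        case False
        then obtain j where j: "j \<in> overflow z t" by blast
        then have jK: "j < K" and nc: "\<not> tcof t (\<lambda>s. V z s j) 0" by (auto simp: overflow_def)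
        \<comment> \<open>An overflow would reset \<open>j\<close> to 0. But \<open>j\<close> tends
          to infinity at \<open>t\<close>, hence is positive from \<open>s0\<close> on, and cannot
          overflow at limits between \<open>s'\<close> and \<open>t\<close>.\<close>
        obtain s0 where s0: "s0 < t" "\<And>u. s0 \<le> u \<Longrightarrow> u < t \<Longrightarrow> 0 < V z u j"
          using nc unfolding tcof_def by auto
        define s' where "s' = max s s0"
        have s': "s \<le> s'" "s' < t" using s s0(1) by (auto simp: s'_def)
        have gd: "good (A - {j}) z s' u" if u: "s' \<le> u" "u < t" for u
          unfolding good_def
        proof (intro conjI allI impI)
          fix l assume l: "s' < l \<and> l \<le> u \<and> tlimit l"
          have "overflow z l \<subseteq> A" using less.prems(1) l s'(1) u unfolding good_def
            by (meson le_less_trans less_imp_le order_trans)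
          moreover have "0 < V z l j" using s0(2)[of l] l u by (auto simp: s'_def)
          then have "j \<notin> overflow z l" using lim[of l j z] l by (auto simp: overflow_def tlim_def split: if_splits)
          ultimately show "overflow z l \<subseteq> A - {j}" by blast
        qed (rule u)
        have "overflow z t \<subseteq> A" using less.prems(1) s lim' unfolding good_def by blast
        then have "Mac (cod z s') b d z"
          using Mac[OF lim' s'(2) j _ _ above_sub[OF less.prems(2) s'(1) order_refl] sim_cod less.prems(4)] gd by blast
        then have "der Mac z (eT (cod z s') b d)" by (rule der_mac)
        moreover have "der Mac z (eT c b (cod z s'))"
          using IH[OF s'(2) good_sub[OF less.prems(1) order_refl s'(1)]
              above_sub[OF less.prems(2) order_refl] less.prems(3) sim_cod] s'(2) less_imp_le by blast
        ultimately show ?thesis using der_trans by blast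
      qed
    qed
  qed
qed

lemma adequate_ex:
  assumes "A \<subseteq> {..<K}"
  shows "\<exists>T. adequate A T"
proof -
  have "finite A" using assms finite_subset by blast
  then show ?thesis
    using assms
  proof (induction A rule: finite_psubset_induct)
    case (psubset A)
    have "\<exists>T. adequate (A - {j}) T" if "j \<in> A" for j
      using psubset.IH[of "A - {j}"] psubset.prems that by blast
    then obtain T where T: "\<And>j. j \<in> A \<Longrightarrow> adequate (A - {j}) (T j)" by metis
    define Mac where "Mac c b d z \<longleftrightarrow> (\<exists>j\<in>A. macro (T j) A j c b d z)" for c b d z
    have "definable (\<lambda>e z. macro (T j) A j (p1 e) (p1 (p2 e)) (p2 (p2 e)) z)" if j: "j \<in> A" for j
    proof -
      have "definable (\<lambda>e z. T j (p1 e) (p1 (p2 e)) (p2 (p2 e)) z)"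
        using T[OF j] unfolding adequate_def by blast
      then have Tj: "definable (\<lambda>e z. T j (f e) (g e) (h e) z)" if "cf f" "cf g" "cf h" for f g h
        using definable_subst[OF _ cf_pr[OF that(1) cf_pr[OF that(2,3)]]] by fastforce
      show ?thesis
        unfolding macro_def ov_def fin_def
        by (intro definable_Ball finite_lessThan definable_intros Tj geq_definable cf_intros definable_const)
    qed
    then have "definable (\<lambda>e z. Mac (p1 e) (p1 (p2 e)) (p2 (p2 e)) z)"
      unfolding Mac_def by (rule definable_Bex[OF psubset.hyps(1)])
    from der_definable[OF this] have D: "definable (\<lambda>e z. der Mac z e)" .
    have "adequate A (\<lambda>c b d z. der Mac z (eT c b d))"
      unfolding adequate_def
    proof (intro conjI allI impI)
      show "definable (\<lambda>e z. der Mac z (eT (p1 e) (p1 (p2 e)) (p2 (p2 e))))"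
        unfolding eT_def by (rule definable_subst[OF D]) (intro cf_intros)
    next
      fix z c b c' s assume d: "der Mac z (eT c b c')" and s: "sim z s c"
      have "\<forall>c b d s. Mac c b d z \<longrightarrow> sim z s c \<longrightarrow> (\<exists>t. good A z s t \<and> above z b s t \<and> sim z t d)"
        using macro_sound T psubset.prems unfolding Mac_def by blast
      from der_sound[OF this d] show "\<exists>t. good A z s t \<and> above z b s t \<and> sim z t c'" using s by blast
    next
      fix z c b c' s t assume a: "good A z s t" "above z b s t" "sim z s c" "sim z t c'"
      show "der Mac z (eT c b c')"
      proof (rule der_complete[OF _ a])
        fix c b d s t j
        assume t: "tlimit t" "s < t" and j: "j \<in> overflow z t" and g: "\<forall>u. s \<le> u \<and> u < t \<longrightarrow> good (A - {j}) z s u"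
          and o: "overflow z t \<subseteq> A" and b: "above z b s t" "sim z s c" "sim z t d"
        have jA: "j \<in> A" using j o by blast
        have "\<not> good (A - {j}) z s t" using t j unfolding good_def by blast
        then have "macro (T j) A j c b d z"
          using macro_iff[OF T[OF jA] t(2) g _ t(1) b(2), of j A b d] j o b jA psubset.prems by blast
        then show "Mac c b d z" unfolding Mac_def using jA by blast
      qed
    qed
    then show ?case by blast
  qed
qed

lemma reachable_definable:
  assumes "definable (\<lambda>e z. Q e)" "\<And>c d. eqv c d \<Longrightarrow> Q c \<longleftrightarrow> Q d" and init: "\<And>z. sim z t0 0"
  shows "definable (\<lambda>e z. \<exists>t\<ge>t0. Q (cod z t))"
proof -
  obtain T where T: "adequate {..<K} T" using adequate_ex by blast
  have good: "good {..<K} z s t" if "s \<le> t" for z s t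
    using that by (auto simp: good_def overflow_def)
  have "(\<exists>t\<ge>t0. Q (cod z t)) \<longleftrightarrow> (\<exists>c. T 0 0 c z \<and> Q c)" for z
  proof
    assume "\<exists>t\<ge>t0. Q (cod z t)"
    then show "\<exists>c. T 0 0 c z \<and> Q c"
      using adequate_complete[OF T good above_0 init sim_cod] by blast
  next
    assume "\<exists>c. T 0 0 c z \<and> Q c"
    then obtain c where c: "T 0 0 c z" "Q c" by blast
    obtain t where t: "good {..<K} z t0 t" "sim z t c" using adequate_sound[OF T c(1) init] by blast
    then have "Q (cod z t)" using c(2) assms(2) eqv_sim[OF sim_cod t(2)] by blast
    then show "\<exists>t\<ge>t0. Q (cod z t)" using t(1) unfolding good_def by blast
  qed
  moreover have "definable (\<lambda>e z. \<exists>c. T 0 0 c z \<and> Q c)"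
  proof (intro definable_ex definable.conj)
    have "definable (\<lambda>e z. T (p1 e) (p1 (p2 e)) (p2 (p2 e)) z)" using T unfolding adequate_def by blast
    from definable_subst[OF this, of "\<lambda>e. pr 0 (pr 0 (p2 e))"]
    show "definable (\<lambda>e z. T 0 0 (p2 e) z)" by (simp add: cf_intros)
    show "definable (\<lambda>e z. Q (p2 e))" using definable_subst[OF assms(1) cf_p2[OF cf_id]] .
  qed
  ultimately show ?thesis by simp
qed

end

section \<open>Register machines as instances of the locale\<close>

definition vec :: "config \<Rightarrow> nat \<Rightarrow> nat" where
  "vec c j = (case j of 0 \<Rightarrow> fst c | Suc i \<Rightarrow> snd c i)"

definition unvec :: "(nat \<Rightarrow> nat) \<Rightarrow> config" where
  "unvec v = (v 0, \<lambda>i. v (Suc i))"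

lemma vec_simps [simp]: "vec c 0 = fst c" "vec c (Suc i) = snd c i"
  by (simp_all add: vec_def)

lemma vec_unvec [simp]: "vec (unvec v) = v"
  by (rule ext) (simp add: vec_def unvec_def split: nat.split)

lemma fst_unvec [simp]: "fst (unvec v) = v 0"
  by (simp add: unvec_def)

lemma unvec_vec [simp]: "unvec (vec c) = c"
  by (simp add: unvec_def)

fun regs :: "instr \<Rightarrow> nat set" where
  "regs (Zero i) = {i}"
| "regs (Succ i) = {i}"
| "regs (Copy i j) = {i, j}"
| "regs (Jump i j q) = {i, j}"
| "regs (Oracle i) = {i}"

text \<open>A code determines only finitely many components, so a step must not depend on the
  others. Component 0 is the line and component \<open>i + 1\<close> is register
  \<open>i\<close>.\<close>

lemma vec_nxt_cong:
  assumes P: "\<And>I. I \<in> set P \<Longrightarrow> regs I \<subseteq> {..<N}" and vw: "\<And>j. j \<le> N \<Longrightarrow> v j = w j" and j: "j \<le> N"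
  shows "vec (nxt P z (unvec v)) j = vec (nxt P z (unvec w)) j"
proof (cases "v 0 < length P")
  case False
  then show ?thesis using vw[of 0] vw[OF j] by (simp add: nxt_def halted_def)
next
  case True
  have "regs (P ! w 0) \<subseteq> {..<N}" using P True vw[of 0] by (simp add: nth_mem)
  then have "vec (exec_instr z (P ! w 0) (unvec v)) j = vec (exec_instr z (P ! w 0) (unvec w)) j"
    using vw j by (cases "P ! w 0"; cases j) (auto simp: unvec_def)
  then show ?thesis using True vw[of 0] by (simp add: nxt_def halted_def)
qed

lemma definable_exec_instr:
  assumes "cf f" "cf g"
  shows "definable (\<lambda>e z. f e = vec (exec_instr z I (unvec (nth' (g e)))) j)"
proof -
  have eq_if: "(x = (if b then u else v)) \<longleftrightarrow> (b \<longrightarrow> x = u) \<and> (\<not> b \<longrightarrow> x = v)" for x u v :: nat and b by simp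
  show ?thesis
    by (cases I; cases j)
      (auto simp: unvec_def eq_if fun_upd_def if_distrib[of fst]
        intro!: definable_intros definable_const cf_intros assms cong: if_cong)
qed

lemma halting_definable: "definable (\<lambda>e z. itrm_computes P z 1)"
proof -
  have "finite (\<Union>I\<in>set P. regs I)"
    by (rule finite_UN_I) (simp, metis finite.emptyI finite_insert regs.elims)
  then obtain N where N: "\<And>i. i \<in> (\<Union>I\<in>set P. regs I) \<Longrightarrow> i < N" by (meson finite_nat_bounded lessThan_iff subsetD)
  \<comment> \<open>The additional register guarantees that the output register 0, which is
    component 1, is recorded even if \<open>P\<close> mentions no register.\<close>
  define M where "M = Suc N"
  have regs: "regs I \<subseteq> {..<M}" if "I \<in> set P" for I using that N unfolding M_def by fastforce
  define V where "V z t j = vec (run P z t) j" for z t j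
  define Stp where "Stp c c' z \<longleftrightarrow> (\<forall>j\<in>{..<Suc M}. nth' c' j = vec (nxt P z (unvec (nth' c))) j)" for c c' z
  interpret liminf_machine "Suc M" V Stp
  proof
    have step: "nth' d j = vec (nxt P z (unvec (nth' c))) j \<longleftrightarrow>
        length P \<le> nth' c 0 \<and> nth' d j = nth' c j \<or>
        (\<exists>q\<in>{..<length P}. nth' c 0 = q \<and> nth' d j = vec (exec_instr z (P ! q) (unvec (nth' c))) j)" for c d z j
      by (cases "nth' c 0 < length P") (auto simp: nxt_def halted_def)
    show "definable (\<lambda>e z. Stp (p1 e) (p2 e) z)"
      unfolding Stp_def step
      by (intro definable_Ball definable_Bex finite_lessThan definable_intros definable_exec_instr cf_intros)
  next
    fix z s c c' assume c: "\<And>j. j < Suc M \<Longrightarrow> V z s j = nth' c j"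
    have "vec (nxt P z (unvec (nth' c))) j = V z (tsuc s) j" if "j < Suc M" for j
    proof -
      have "vec (nxt P z (unvec (nth' c))) j = vec (nxt P z (unvec (V z s))) j"
        by (rule vec_nxt_cong[of P M]) (use regs c that in auto)
      also have "unvec (V z s) = run P z s" unfolding V_def by simp
      finally show ?thesis by (simp add: V_def run_tsuc)
    qed
    then show "Stp c c' z \<longleftrightarrow> (\<forall>j<Suc M. V z (tsuc s) j = nth' c' j)"
      unfolding Stp_def by auto
  next
    fix t j z assume t: "tlimit t"
    show "V z t j = tlim t (\<lambda>s. V z s j)"
      unfolding V_def using run_tlimit[OF t, of P z] by (cases j) simp_all
  qed
  define t0 :: ctime where "t0 = (LEAST t. True)"
  have t0: "t0 \<le> t" for t unfolding t0_def by (simp add: Least_le)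
  have run0: "run P z t0 = (0, \<lambda>_. 0)" for z using t0 by (intro run_zero) (simp add: leD)
  have init: "sim z t0 0" for z
  proof -
    have "V z t0 j = 0" for j unfolding V_def run0 by (cases j) simp_all
    then show ?thesis by (simp add: sim_def)
  qed
  define Q where "Q c \<longleftrightarrow> length P \<le> nth' c 0 \<and> nth' c 1 = 1" for c
  have 1: "definable (\<lambda>e z. Q e)" unfolding Q_def by (intro definable_intros cf_intros)
  have 2: "Q c \<longleftrightarrow> Q d" if "eqv c d" for c d using that unfolding Q_def eqv_def by (simp add: M_def)
  have "Q (cod z t) \<longleftrightarrow> halted P (run P z t) \<and> snd (run P z t) 0 = 1" for z t
    using nth'_cod[of 0 z t] nth'_cod[of 1 z t] unfolding Q_def halted_def V_def M_def by simp
  then have "(\<exists>t\<ge>t0. Q (cod z t)) \<longleftrightarrow> itrm_computes P z 1" for z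
    using t0 by (simp add: itrm_computes_iff_run)
  then show ?thesis using reachable_definable[OF 1 2 init] by simp
qed

section \<open>Cohen forcing\<close>

text \<open>Every number is a Cohen condition: it codes a list, a nonzero entry meaning membership.
  Beyond the end of the list \<open>nth'\<close> is 0, so the domain has to be tested
  separately.\<close>

definition indom :: "nat \<Rightarrow> nat \<Rightarrow> bool" where
  "indom p i \<longleftrightarrow> (tl' ^^ i) p \<noteq> 0"

definition cyl :: "nat \<Rightarrow> nat set set" where
  "cyl p = {x. \<forall>i. indom p i \<longrightarrow> (i \<in> x \<longleftrightarrow> nth' p i \<noteq> 0)}"

definition ext :: "nat \<Rightarrow> nat \<Rightarrow> bool" where
  "ext q p \<longleftrightarrow> (\<forall>i. indom p i \<longrightarrow> indom q i \<and> (nth' q i \<noteq> 0 \<longleftrightarrow> nth' p i \<noteq> 0))"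

definition cond_len :: "nat \<Rightarrow> nat" where
  "cond_len p = length (list_decode p)"

definition res :: "nat set \<Rightarrow> nat \<Rightarrow> nat" where
  "res x n = list_encode (map (\<lambda>i. of_bool (i \<in> x)) [0..<n])"

lemma drop_list_encode: "(tl' ^^ i) (list_encode xs) = list_encode (drop i xs)"
proof (induction i arbitrary: xs)
  case (Suc i)
  have "tl' (list_encode xs) = list_encode (tl xs)"
    by (cases xs) (simp_all add: tl'_def flip: pr_def)
  then show ?case using Suc[of "tl xs"] by (simp add: funpow_swap1 drop_Suc)
qed simp

lemma list_encode_eq_0: "list_encode xs = 0 \<longleftrightarrow> xs = []"
  by (cases xs) auto

lemma indom_iff: "indom p i \<longleftrightarrow> i < cond_len p"
  using drop_list_encode[of i "list_decode p"] list_encode_eq_0[of "drop i (list_decode p)"]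
  by (simp add: indom_def cond_len_def not_le)

lemma indom_res: "indom (res x n) i \<longleftrightarrow> i < n"
  unfolding indom_iff by (simp add: cond_len_def res_def)

lemma nth'_res: "i < n \<Longrightarrow> nth' (res x n) i = of_bool (i \<in> x)"
proof -
  assume i: "i < n"
  then have d: "drop i (map (\<lambda>i. of_bool (i \<in> x)) [0..<n]) = of_bool (i \<in> x) # drop (Suc i) (map (\<lambda>i. of_bool (i \<in> x)) [0..<n])"
    by (subst Cons_nth_drop_Suc[symmetric]) auto
  have "(tl' ^^ i) (res x n) = Suc (pr (of_bool (i \<in> x)) (list_encode (drop (Suc i) (map (\<lambda>i. of_bool (i \<in> x)) [0..<n]))))"
    unfolding res_def drop_list_encode d by (simp add: pr_def)
  then show ?thesis by (simp add: nth'_def)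
qed

lemma cyl_res: "y \<in> cyl (res x n) \<longleftrightarrow> (\<forall>i<n. i \<in> y \<longleftrightarrow> i \<in> x)"
  unfolding cyl_def by (auto simp: indom_res nth'_res)

lemma in_cyl_res [simp]: "x \<in> cyl (res x n)"
  by (simp add: cyl_res)

lemma ext_res: "x \<in> cyl p \<Longrightarrow> cond_len p \<le> n \<Longrightarrow> ext (res x n) p"
  unfolding cyl_def ext_def indom_res by (auto simp: indom_iff nth'_res)

lemma ext_refl [simp]: "ext p p"
  by (simp add: ext_def)

lemma ext_trans: "ext q p \<Longrightarrow> ext r q \<Longrightarrow> ext r p"
  unfolding ext_def by blast

lemma cyl_mono: "ext q p \<Longrightarrow> cyl q \<subseteq> cyl p"
  unfolding ext_def cyl_def by blast

lemma cyl_0 [simp]: "cyl 0 = UNIV"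
proof -
  have "(tl' ^^ i) 0 = 0" for i by (induction i) auto
  then show ?thesis by (simp add: cyl_def indom_def)
qed

lemma cyl_nonempty: "\<exists>x. x \<in> cyl p"
  unfolding cyl_def by (rule exI[of _ "{i. nth' p i \<noteq> 0}"]) simp

lemma common_ext:
  assumes "x \<in> cyl p" "x \<in> cyl q"
  shows "\<exists>r. ext r p \<and> ext r q \<and> x \<in> cyl r"
  using ext_res[OF assms(1), of "max (cond_len p) (cond_len q)"] ext_res[OF assms(2), of "max (cond_len p) (cond_len q)"]
  by (intro exI[of _ "res x (max (cond_len p) (cond_len q))"]) simp

section \<open>Nowhere dense and meager sets in terms of conditions\<close>

definition nwd :: "nat set set \<Rightarrow> bool" where
  "nwd N \<longleftrightarrow> (\<forall>p. \<exists>q. ext q p \<and> cyl q \<inter> N = {})"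

definition meag :: "nat set set \<Rightarrow> bool" where
  "meag M \<longleftrightarrow> (\<exists>F. (\<forall>n::nat. nwd (F n)) \<and> M \<subseteq> (\<Union>n. F n))"

lemma nwd_empty: "nwd {}"
  unfolding nwd_def using ext_refl by blast

lemma nwd_meag: "nwd N \<Longrightarrow> meag N"
  unfolding meag_def by (rule exI[of _ "\<lambda>_. N"]) auto

lemma meag_empty: "meag {}"
  using nwd_meag nwd_empty by blast

lemma meag_subset: "meag M \<Longrightarrow> N \<subseteq> M \<Longrightarrow> meag N"
  unfolding meag_def by (meson order_trans)

lemma meag_UN:
  assumes "\<And>n::nat. meag (M n)"
  shows "meag (\<Union>n. M n)"
proof -
  have "\<forall>n. \<exists>F. (\<forall>k::nat. nwd (F k)) \<and> M n \<subseteq> (\<Union>k. F k)" using assms unfolding meag_def by blast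
  then obtain F where "\<forall>n. (\<forall>k::nat. nwd (F n k)) \<and> M n \<subseteq> (\<Union>k. F n k)" by (rule choice[THEN exE])
  then have F: "\<And>n k. nwd (F n k)" "\<And>n. M n \<subseteq> (\<Union>k. F n k)" by auto
  define G where "G m = F (p1 m) (p2 m)" for m
  have "(\<Union>n. M n) \<subseteq> (\<Union>m. G m)"
  proof
    fix x assume "x \<in> (\<Union>n. M n)"
    then obtain n k where "x \<in> F n k" using F(2) by blast
    then have "x \<in> G (pr n k)" by (simp add: G_def)
    then show "x \<in> (\<Union>m. G m)" by blast
  qed
  moreover have "nwd (G m)" for m using F(1) by (simp add: G_def)
  ultimately show ?thesis unfolding meag_def by blast
qed

lemma meag_Un: "meag M \<Longrightarrow> meag N \<Longrightarrow> meag (M \<union> N)"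
  by (rule meag_subset[OF meag_UN[of "\<lambda>n. if n = 0 then M else N"]]) (auto split: if_splits intro: exI[of _ "1::nat"])

lemma baire: "\<not> meag (cyl p)"
proof
  assume "meag (cyl p)"
  then obtain F where F: "\<And>n::nat. nwd (F n)" "cyl p \<subseteq> (\<Union>n. F n)" unfolding meag_def by blast
  define nx where "nx n q = (SOME r. ext r q \<and> cyl r \<inter> F n = {})" for n q
  have nx: "ext (nx n q) q \<and> cyl (nx n q) \<inter> F n = {}" for n q
    unfolding nx_def by (rule someI_ex) (use F(1) in \<open>simp add: nwd_def\<close>)
  define s where "s = rec_nat p nx"
  have s: "s 0 = p" "s (Suc n) = nx n (s n)" for n by (simp_all add: s_def)
  have mono: "ext (s n) (s m)" if "m \<le> n" for m n
    using that by (induction n rule: dec_induct) (use nx ext_trans in \<open>auto simp: s\<close>)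
  define x where "x = {i. \<exists>n. indom (s n) i \<and> nth' (s n) i \<noteq> 0}"
  have x: "x \<in> cyl (s n)" for n
    unfolding cyl_def
  proof (clarify, rule iffI)
    fix i assume i: "indom (s n) i" "i \<in> x"
    then obtain m where "indom (s m) i" "nth' (s m) i \<noteq> 0" by (auto simp: x_def)
    then show "nth' (s n) i \<noteq> 0" using mono[of m "max m n"] mono[of n "max m n"] i unfolding ext_def by auto
  qed (auto simp: x_def)
  have "x \<in> cyl p" using x[of 0] s by simp
  moreover have "x \<notin> F n" for n using x[of "Suc n"] nx[of n "s n"] s(2)[of n] by auto
  ultimately show False using F(2) by blast
qed

text \<open>A form of the Banach category theorem: there are only countably many conditions below
  which \<open>M\<close> is meager, and by density the part of \<open>cyl p\<close> outside their
  cylinders is nowhere dense.\<close>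

lemma meag_local:
  assumes "\<And>q. ext q p \<Longrightarrow> \<exists>r. ext r q \<and> meag (cyl r \<inter> M)"
  shows "meag (cyl p \<inter> M)"
proof -
  define G where "G r = (if meag (cyl r \<inter> M) then cyl r else {})" for r
  let ?N = "cyl p - (\<Union>r. G r)"
  have "nwd ?N"
    unfolding nwd_def
  proof
    fix q show "\<exists>r. ext r q \<and> cyl r \<inter> ?N = {}"
    proof (cases "cyl q \<inter> cyl p = {}")
      case True
      then show ?thesis using ext_refl by blast
    next
      case False
      then obtain q' where q': "ext q' p" "ext q' q" using common_ext by blast
      then obtain r where r: "ext r q'" "meag (cyl r \<inter> M)" using assms by blast
      then have "cyl r \<inter> ?N = {}" unfolding G_def by auto
      then show ?thesis using ext_trans[OF q'(2) r(1)] by blast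
    qed
  qed
  moreover have "meag (G r \<inter> M)" for r unfolding G_def using meag_empty by auto
  ultimately have "meag (?N \<union> (\<Union>r. G r \<inter> M))" 
    by (intro meag_Un[OF nwd_meag meag_UN[of "\<lambda>r. G r \<inter> M"]])
  then show ?thesis by (rule meag_subset) blast
qed

section \<open>Forcing in the sense of category\<close>

definition forces :: "nat \<Rightarrow> nat set set \<Rightarrow> bool" where
  "forces p S \<longleftrightarrow> meag (cyl p - S)"

text \<open>This amounts to the Baire property of \<open>S\<close>.\<close>

definition decides :: "nat set set \<Rightarrow> bool" where
  "decides S \<longleftrightarrow> (\<forall>p. \<exists>q. ext q p \<and> (forces q S \<or> forces q (- S)))"

lemma forces_ext: "ext q p \<Longrightarrow> forces p S \<Longrightarrow> forces q S"
  unfolding forces_def using cyl_mono meag_subset by (meson Diff_mono order_refl)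

lemma forces_mono: "forces p S \<Longrightarrow> cyl p \<inter> S \<subseteq> T \<Longrightarrow> forces p T"
  unfolding forces_def by (rule meag_subset) auto

lemma forces_cyl: "cyl p \<subseteq> S \<Longrightarrow> forces p S"
  unfolding forces_def using meag_empty by (simp add: Diff_eq_empty_iff[THEN iffD2])

lemma forces_dense:
  assumes "\<And>q. ext q p \<Longrightarrow> \<exists>r. ext r q \<and> forces r S"
  shows "forces p S"
  using meag_local[of p "- S"] assms unfolding forces_def by (simp add: Diff_eq)

lemma forces_consistent: "forces p S \<Longrightarrow> \<not> forces p (- S)"
proof
  assume "forces p S" "forces p (- S)"
  then have "meag ((cyl p - S) \<union> (cyl p - - S))" unfolding forces_def by (rule meag_Un)
  then have "meag (cyl p)" by (rule meag_subset) blast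
  then show False using baire by blast
qed

lemma forces_INT:
  assumes "\<And>n::nat. forces p (S n)"
  shows "forces p (\<Inter>n. S n)"
proof -
  have "meag (\<Union>n. cyl p - S n)" using assms unfolding forces_def by (rule meag_UN)
  then show ?thesis unfolding forces_def by (rule meag_subset) blast
qed

lemma forces_Int: "forces p (S \<inter> T) \<longleftrightarrow> forces p S \<and> forces p T"
proof
  assume "forces p S \<and> forces p T"
  then have "meag ((cyl p - S) \<union> (cyl p - T))" unfolding forces_def by (auto intro: meag_Un)
  then show "forces p (S \<inter> T)" unfolding forces_def by (rule meag_subset) blast
qed (auto elim: forces_mono)

lemma forces_Compl:
  assumes "decides S"
  shows "forces p (- S) \<longleftrightarrow> (\<forall>q. ext q p \<longrightarrow> \<not> forces q S)"
proof
  assume "forces p (- S)"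
  then show "\<forall>q. ext q p \<longrightarrow> \<not> forces q S" using forces_ext forces_consistent by blast
next
  assume "\<forall>q. ext q p \<longrightarrow> \<not> forces q S"
  then show "forces p (- S)"
    using forces_dense[of p "- S"] assms ext_trans unfolding decides_def by meson
qed

lemma decides_Compl: "decides S \<Longrightarrow> decides (- S)"
  unfolding decides_def by auto

lemma decides_Int:
  assumes "decides S" "decides T"
  shows "decides (S \<inter> T)"
  unfolding decides_def
proof
  fix p
  obtain q where q: "ext q p" "forces q S \<or> forces q (- S)" using assms(1) unfolding decides_def by blast
  obtain r where r: "ext r q" "forces r T \<or> forces r (- T)" using assms(2) unfolding decides_def by blast
  have rp: "ext r p" using q(1) r(1) by (rule ext_trans)
  have "forces r S \<or> forces r (- S)" using q(2) forces_ext[OF r(1)] by blast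
  then consider "forces r S" "forces r T" | "forces r (- S)" | "forces r (- T)" using r(2) by blast
  then show "\<exists>q. ext q p \<and> (forces q (S \<inter> T) \<or> forces q (- (S \<inter> T)))"
  proof cases
    case 1
    then show ?thesis using rp forces_Int by blast
  next
    case 2
    then have "forces r (- (S \<inter> T))" by (rule forces_mono) blast
    then show ?thesis using rp by blast
  next
    case 3
    then have "forces r (- (S \<inter> T))" by (rule forces_mono) blast
    then show ?thesis using rp by blast
  qed
qed

lemma forces_const: "forces p {x. b} \<longleftrightarrow> b"
  using baire meag_empty by (cases b) (simp_all add: forces_def)

lemma decides_const: "decides {x. b}"
proof -
  have "forces p {x. b} \<or> forces p (- {x. b})" for p
    using forces_const[of p True] by (cases b) simp_all
  then show ?thesis unfolding decides_def using ext_refl by blast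
qed

text \<open>A condition that does not put \<open>j\<close> into the set has an extension that
  excludes \<open>j\<close>.\<close>

lemma forces_mem: "forces p {x. j \<in> x} \<longleftrightarrow> indom p j \<and> nth' p j \<noteq> 0"
proof
  assume "indom p j \<and> nth' p j \<noteq> 0"
  then show "forces p {x. j \<in> x}" by (intro forces_cyl) (auto simp: cyl_def)
next
  assume f: "forces p {x. j \<in> x}"
  show "indom p j \<and> nth' p j \<noteq> 0"
  proof (rule ccontr)
    assume n: "\<not> (indom p j \<and> nth' p j \<noteq> 0)"
    define x where "x = {i. indom p i \<and> nth' p i \<noteq> 0}"
    have x: "x \<in> cyl p" by (auto simp: cyl_def x_def)
    define q where "q = res x (max (Suc j) (cond_len p))"
    have q: "ext q p" unfolding q_def using x by (rule ext_res) simp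
    have "cyl q \<subseteq> - {x. j \<in> x}" using n unfolding q_def by (auto simp: cyl_res x_def)
    then show False using forces_cyl forces_consistent forces_ext[OF q f] by blast
  qed
qed

lemma decides_mem: "decides {x. j \<in> x}"
  unfolding decides_def
proof
  fix p
  obtain x where x: "x \<in> cyl p" using cyl_nonempty by blast
  define q where "q = res x (max (Suc j) (cond_len p))"
  have "ext q p" unfolding q_def using x by (rule ext_res) simp
  moreover have "cyl q \<subseteq> {x. j \<in> x} \<or> cyl q \<subseteq> - {x. j \<in> x}"
    unfolding q_def by (cases "j \<in> x") (auto simp: cyl_res)
  ultimately show "\<exists>q. ext q p \<and> (forces q {x. j \<in> x} \<or> forces q (- {x. j \<in> x}))"
    using forces_cyl by blast
qed

lemma definable_indom:
  assumes "cf f" "cf g"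
  shows "definable (\<lambda>e z. indom (f e) (g e))"
  unfolding indom_def by (intro definable_intros cf_intros assms)

lemma definable_ext:
  assumes "cf f" "cf g"
  shows "definable (\<lambda>e z. ext (f e) (g e))"
  unfolding ext_def by (intro definable_intros definable_indom cf_intros cf_comp[OF assms(1)] cf_comp[OF assms(2)])

text \<open>
  The forcing relation for ``the node \<open>s\<close> is barred'' is itself inductively defined: a condition \<open>p\<close>
  (tag \<open>0\<close>) forces this if every extension \<open>q\<close> (tag \<open>1\<close>) has an extension \<open>r\<close> that forces \<open>s\<close> to lie
  in the bar or forces all children of \<open>s\<close> to be barred.
\<close>

definition brule :: "nat \<Rightarrow> nat \<Rightarrow> bool" where
  "brule n d \<longleftrightarrow> p1 n = 0 \<or> p1 n = 1 \<and> ext d (p1 (p2 (p2 n)))"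

definition bprem :: "(nat \<Rightarrow> nat \<Rightarrow> bool) \<Rightarrow> nat \<Rightarrow> nat \<Rightarrow> nat \<Rightarrow> bool" where
  "bprem \<Phi> n d m \<longleftrightarrow>
     p1 n = 0 \<and> (\<exists>q. ext q (p1 (p2 (p2 n))) \<and> m = pr 1 (pr (p1 (p2 n)) (pr q (p2 (p2 (p2 n)))))) \<or>
     p1 n = 1 \<and> \<not> \<Phi> d (pr (p1 (p2 n)) (p2 (p2 (p2 n)))) \<and>
       (\<exists>k. m = pr 0 (pr (p1 (p2 n)) (pr d (Suc (pr k (p2 (p2 (p2 n))))))))"

abbreviation bforces :: "(nat \<Rightarrow> nat \<Rightarrow> bool) \<Rightarrow> nat \<Rightarrow> nat \<Rightarrow> nat \<Rightarrow> bool" where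
  "bforces \<Phi> e p s \<equiv> ind brule (bprem \<Phi>) (pr 0 (pr e (pr p s)))"

lemma bforces_iff:
  "bforces \<Phi> e p s \<longleftrightarrow> (\<forall>q. ext q p \<longrightarrow> (\<exists>r. ext r q \<and> (\<Phi> r (pr e s) \<or> (\<forall>k. bforces \<Phi> e r (Suc (pr k s))))))"
proof -
  have 0: "bforces \<Phi> e p s \<longleftrightarrow> (\<forall>q. ext q p \<longrightarrow> ind brule (bprem \<Phi>) (pr 1 (pr e (pr q s))))"
    by (subst ind.simps) (auto simp: brule_def bprem_def)
  have 1: "ind brule (bprem \<Phi>) (pr 1 (pr e (pr q s))) \<longleftrightarrow>
      (\<exists>r. ext r q \<and> (\<Phi> r (pr e s) \<or> (\<forall>k. bforces \<Phi> e r (Suc (pr k s)))))" for q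
    by (subst ind.simps) (auto simp: brule_def bprem_def)
  show ?thesis unfolding 0 1 ..
qed

context
  fixes R :: "nat \<Rightarrow> nat set \<Rightarrow> bool" and y :: "nat set"
  assumes dec: "\<And>e. decides {x. R e (join x y)}"
begin

private definition \<Phi> :: "nat \<Rightarrow> nat \<Rightarrow> bool" where
  "\<Phi> r a \<longleftrightarrow> forces r {x. R a (join x y)}"

private definition bars :: "nat \<Rightarrow> nat \<Rightarrow> nat set set" where
  "bars e s = {x. barred (\<lambda>s. R (pr e s) (join x y)) s}"

private definition out :: "nat \<Rightarrow> nat \<Rightarrow> nat \<Rightarrow> bool" where
  "out e q s \<longleftrightarrow> (\<forall>r. ext r q \<longrightarrow> \<not> bforces \<Phi> e r s)"

private lemma bforces_sound:
  assumes "ind brule (bprem \<Phi>) n"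
  shows "(\<forall>e p s. n = pr 0 (pr e (pr p s)) \<longrightarrow> forces p (bars e s)) \<and>
    (\<forall>e q s. n = pr 1 (pr e (pr q s)) \<longrightarrow> (\<exists>r. ext r q \<and> forces r (bars e s)))"
  using assms
proof induction
  case (1 n d)
  show ?case
  proof (intro conjI allI impI)
    fix e p s assume n: "n = pr 0 (pr e (pr p s))"
    have "\<exists>r. ext r q \<and> forces r (bars e s)" if "ext q p" for q
    proof -
      have "bprem \<Phi> n d (pr 1 (pr e (pr q s)))" using that n by (simp add: bprem_def)
      then show ?thesis using "1.IH" by blast
    qed
    then show "forces p (bars e s)" by (rule forces_dense)
  next
    fix e q s assume n: "n = pr 1 (pr e (pr q s))"
    have d: "ext d q" using 1(1) n by (simp add: brule_def)
    have "forces d (bars e s)"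
    proof (cases "\<Phi> d (pr e s)")
      case True
      then show ?thesis unfolding \<Phi>_def bars_def by (rule forces_mono) (auto intro: barred.bar)
    next
      case False
      have "forces d (bars e (Suc (pr k s)))" for k
      proof -
        have "bprem \<Phi> n d (pr 0 (pr e (pr d (Suc (pr k s)))))" using False n by (simp add: bprem_def)
        then show ?thesis using "1.IH" by blast
      qed
      from forces_INT[of d "\<lambda>k. bars e (Suc (pr k s))", OF this] show ?thesis
        unfolding bars_def by (rule forces_mono) (auto intro: barred.step)
    qed
    then show "\<exists>r. ext r q \<and> forces r (bars e s)" using d by blast
  qed
qed

text \<open>Negating \<open>bforces_iff\<close> gives a \<open>q\<close> such that both alternatives
  fail at every extension. As no extension forces the bar at \<open>s\<close>, its failure is
  forced, by \<open>dec\<close>; and some child is not derivably barred.\<close>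

private lemma not_bforces:
  assumes "\<not> bforces \<Phi> e p s"
  shows "\<exists>q. ext q p \<and> out e q s \<and> forces q (- {x. R (pr e s) (join x y)}) \<and> (\<exists>k. \<not> bforces \<Phi> e q (Suc (pr k s)))"
proof -
  obtain q where q: "ext q p" and no: "\<And>r. ext r q \<Longrightarrow> \<not> \<Phi> r (pr e s) \<and> (\<exists>k. \<not> bforces \<Phi> e r (Suc (pr k s)))"
    using assms unfolding bforces_iff[of _ _ p] by blast
  have "\<not> bforces \<Phi> e r s" if "ext r q" for r
    unfolding bforces_iff[of _ _ r] using no that ext_trans ext_refl by blast
  moreover have "forces q (- {x. R (pr e s) (join x y)})"
    using forces_Compl[OF dec] no unfolding \<Phi>_def by blast
  ultimately show ?thesis using q no[OF ext_refl] unfolding out_def by blast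
qed

text \<open>Outside countably many meager sets a point \<open>x\<close> is generic enough: if it
  lies in a condition that is \<open>out\<close> at \<open>s\<close>, then it misses the bar at
  \<open>s\<close> and lies in a condition that is \<open>out\<close> at some child. Induction on
  \<open>barred\<close> then shows that \<open>s\<close> is not barred for \<open>x\<close>.\<close>

private lemma out_forces:
  assumes "out e q s"
  shows "forces q (- bars e s)"
proof -
  define E where "E s = - {x. R (pr e s) (join x y)} \<inter> (\<Union>r\<in>{r. \<exists>k. out e r (Suc (pr k s))}. cyl r)" for s
  have E: "forces q (E s)" if o: "out e q s" for q s
    unfolding E_def forces_Int
  proof
    show "forces q (- {x. R (pr e s) (join x y)})"
    proof (rule forces_dense)
      fix r assume "ext r q"
      then have "\<not> bforces \<Phi> e r s" using o unfolding out_def by blast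
      from not_bforces[OF this] show "\<exists>r'. ext r' r \<and> forces r' (- {x. R (pr e s) (join x y)})" by blast
    qed
    show "forces q (\<Union>r\<in>{r. \<exists>k. out e r (Suc (pr k s))}. cyl r)"
    proof (rule forces_dense)
      fix r assume "ext r q"
      then have "\<not> bforces \<Phi> e r s" using o unfolding out_def by blast
      from not_bforces[OF this] obtain q0 k where q0: "ext q0 r" "\<not> bforces \<Phi> e q0 (Suc (pr k s))" by blast
      obtain q1 where q1: "ext q1 q0" "out e q1 (Suc (pr k s))" using not_bforces[OF q0(2)] by blast
      then have "forces q1 (\<Union>r\<in>{r. \<exists>k. out e r (Suc (pr k s))}. cyl r)" by (intro forces_cyl) blast
      then show "\<exists>r'. ext r' r \<and> forces r' (\<Union>r\<in>{r. \<exists>k. out e r (Suc (pr k s))}. cyl r)"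
        using ext_trans[OF q0(1) q1(1)] by blast
    qed
  qed
  define B where "B m = (if out e (p1 m) (p2 m) then cyl (p1 m) - E (p2 m) else {})" for m
  have "meag (B m)" for m
    unfolding B_def using E[of "p1 m" "p2 m"] meag_empty by (simp add: forces_def)
  then have "meag (\<Union>m. B m)" by (rule meag_UN)
  moreover have "cyl q - - bars e s \<subseteq> (\<Union>m. B m)"
  proof (rule ccontr)
    assume "\<not> cyl q - - bars e s \<subseteq> (\<Union>m. B m)"
    then obtain x where x: "x \<in> cyl q" "x \<in> bars e s" "\<And>m. x \<notin> B m" by blast
    have gen: "x \<in> E s" if "out e q s" "x \<in> cyl q" for q s
      using x(3)[of "pr q s"] that by (simp add: B_def)
    have "\<not> out e q s" if "barred (\<lambda>s. R (pr e s) (join x y)) s" "x \<in> cyl q" for q s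
      using that
    proof (induction arbitrary: q)
      case (bar s)
      then show ?case using gen unfolding E_def by blast
    next
      case (step s)
      then show ?case using gen unfolding E_def by blast
    qed
    then show False using x(1,2) assms unfolding bars_def by blast
  qed
  ultimately show ?thesis unfolding forces_def by (rule meag_subset)
qed

lemma forces_branches:
  "forces p {x. \<forall>g. \<exists>k. R (pr e (initial g k)) (join x y)} \<longleftrightarrow>
    bforces (\<lambda>r a. forces r {x. R a (join x y)}) e p 0"
  and decides_branches: "decides {x. \<forall>g. \<exists>k. R (pr e (initial g k)) (join x y)}"
proof -
  have eq: "{x. \<forall>g. \<exists>k. R (pr e (initial g k)) (join x y)} = bars e 0"
    unfolding bars_def barred_iff ..
  have \<Phi>: "(\<lambda>r a. forces r {x. R a (join x y)}) = \<Phi>" by (simp add: \<Phi>_def fun_eq_iff)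
  have s: "forces p (bars e 0)" if "bforces \<Phi> e p 0" for p using bforces_sound[OF that] by blast
  have n: "\<exists>q. ext q p \<and> forces q (- bars e 0)" if "\<not> bforces \<Phi> e p 0" for p
    using not_bforces[OF that] out_forces by blast
  show "decides {x. \<forall>g. \<exists>k. R (pr e (initial g k)) (join x y)}"
    unfolding eq decides_def using s n ext_refl by blast
  show "forces p {x. \<forall>g. \<exists>k. R (pr e (initial g k)) (join x y)} \<longleftrightarrow>
    bforces (\<lambda>r a. forces r {x. R a (join x y)}) e p 0"
    unfolding eq \<Phi> using s n forces_ext forces_consistent by blast
qed

end

definition dbl :: "nat \<Rightarrow> nat" where
  "dbl n = ((\<lambda>x. Suc (Suc x)) ^^ n) 0"

lemma dbl_eq: "dbl n = 2 * n"
  unfolding dbl_def by (induction n) auto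

lemma cf_dbl: "cf f \<Longrightarrow> cf (\<lambda>e. dbl (f e))"
  unfolding dbl_def by (intro cf_iterate[of "\<lambda>x. Suc (Suc x)"] cf_intros)

lemma join_iff [simp]: "2 * i \<in> join x y \<longleftrightarrow> i \<in> x" "Suc (2 * i) \<in> join x y \<longleftrightarrow> i \<in> y"
  unfolding join_def by (auto, presburger+)

text \<open>Only the even half of the oracle is generic. The odd half stays a parameter, so that the
  forcing relation is evaluated with that half alone as its oracle. For \<open>branches\<close> the
  forcing relation is the inductive definition \<open>bforces\<close>.\<close>

lemma forcing_theorem:
  assumes "definable R"
  shows "(\<forall>e y. decides {x. R e (join x y)}) \<and> definable (\<lambda>e y. forces (p1 e) {x. R (p2 e) (join x y)})"
  using assms
proof induction
  case (zero f)
  have "definable (\<lambda>e z. f (p2 e) = 0)" by (rule definable.zero[OF cf_comp[OF zero cf_p2[OF cf_id]]])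
  then show ?case unfolding forces_const using decides_const by blast
next
  case (mem f)
  have par: "(\<exists>j. n = dbl j) \<or> (\<exists>j. n = Suc (dbl j))" for n unfolding dbl_eq by presburger
  have "decides {x. n \<in> join x y}" for n y
    using par[of n] decides_const[of True] decides_const[of False] by (auto simp: dbl_eq decides_mem)
  moreover have "forces p {x. n \<in> join x y} \<longleftrightarrow>
      (\<exists>j. n = dbl j \<and> indom p j \<and> nth' p j \<noteq> 0) \<or> (\<exists>j. n = Suc (dbl j) \<and> j \<in> y)" for n p y
  proof -
    consider j where "n = dbl j" | j where "n = Suc (dbl j)" using par by blast
    then show ?thesis
    proof cases
      case (1 j)
      moreover have "2 * j \<noteq> Suc (2 * i)" for i by presburger
      ultimately show ?thesis by (auto simp: dbl_eq forces_mem)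
    next
      case (2 j)
      moreover have "Suc (2 * j) \<noteq> 2 * i" for i by presburger
      ultimately show ?thesis using forces_const[of p True] forces_const[of p False] by (auto simp: dbl_eq)
    qed
  qed
  moreover have "definable (\<lambda>e y. (\<exists>j. f (p2 e) = dbl j \<and> indom (p1 e) j \<and> nth' (p1 e) j \<noteq> 0) \<or>
      (\<exists>j. f (p2 e) = Suc (dbl j) \<and> j \<in> y))"
    by (intro definable_intros definable_indom cf_intros cf_dbl cf_comp[OF mem])
  ultimately show ?case by (simp only:) blast
next
  case (neg R)
  then have d: "decides {x. R e (join x y)}" for e y by blast
  have eq: "{x. \<not> R e (join x y)} = - {x. R e (join x y)}" for e y by blast
  have F: "definable (\<lambda>e y. forces (f e) {x. R (g e) (join x y)})" if "cf f" "cf g" for f g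
    using definable_subst[OF conjunct2[OF neg.IH] cf_pr[OF that]] by simp
  have "definable (\<lambda>e y. \<forall>q. ext q (p1 e) \<longrightarrow> \<not> forces q {x. R (p2 e) (join x y)})"
    by (intro definable_intros definable_ext F cf_intros)
  then show ?case unfolding eq forces_Compl[OF d] using decides_Compl[OF d] by blast
next
  case (conj R Q)
  have eq: "{x. R e (join x y) \<and> Q e (join x y)} = {x. R e (join x y)} \<inter> {x. Q e (join x y)}" for e y by blast
  show ?case unfolding eq forces_Int using conj decides_Int definable.conj by blast
next
  case (branches R)
  then have d: "decides {x. R e (join x y)}" for e y by blast
  let ?W = "\<lambda>n d m y. bprem (\<lambda>r a. forces r {x. R a (join x y)}) n d m"
  have F: "definable (\<lambda>e y. forces (f e) {x. R (g e) (join x y)})" if "cf f" "cf g" for f g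
    using definable_subst[OF conjunct2[OF branches.IH] cf_pr[OF that]] by simp
  have "definable (\<lambda>e y. ind brule (\<lambda>n d m. ?W n d m y) e)"
  proof (rule definable_ind)
    show "definable (\<lambda>e y. brule (p1 e) (p2 e))"
      unfolding brule_def by (intro definable_intros definable_ext cf_intros)
    show "definable (\<lambda>e y. ?W (p1 e) (p1 (p2 e)) (p2 (p2 e)) y)"
      unfolding bprem_def by (intro definable_intros definable_ext F cf_intros)
  qed
  from definable_subst[OF this, of "\<lambda>e. pr 0 (pr (p2 e) (pr (p1 e) 0))"]
  have "definable (\<lambda>e y. bforces (\<lambda>r a. forces r {x. R a (join x y)}) (p2 e) (p1 e) 0)"
    by (simp add: cf_intros)
  then show ?case using forces_branches[of R, OF d] decides_branches[of R, OF d] by simp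
qed

section \<open>Category on Cantor space\<close>

lemma topspace_cantor [simp]: "topspace cantor_topology = UNIV"
  unfolding cantor_topology_def by (simp add: topspace_pullback_topology PiE_def)

lemma openin_cantor_iff: "openin cantor_topology U \<longleftrightarrow> (\<forall>x\<in>U. \<exists>n. cyl (res x n) \<subseteq> U)"
proof
  let ?T = "product_topology (\<lambda>_. discrete_topology (UNIV :: bool set)) (UNIV :: nat set)"
  assume "openin cantor_topology U"
  then obtain W where W: "openin ?T W" "U = (\<lambda>x n. n \<in> x) -` W"
    unfolding cantor_topology_def openin_pullback_topology by auto
  show "\<forall>x\<in>U. \<exists>n. cyl (res x n) \<subseteq> U"
  proof
    fix x assume "x \<in> U"
    then have "(\<lambda>n. n \<in> x) \<in> W" using W(2) by simp
    then obtain B where B: "finite {i \<in> UNIV. B i \<noteq> topspace (discrete_topology (UNIV :: bool set))}"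
      "(\<lambda>n. n \<in> x) \<in> Pi\<^sub>E UNIV B" "Pi\<^sub>E UNIV B \<subseteq> W"
      using W(1) unfolding openin_product_topology_alt by blast
    obtain n where n: "\<And>i. B i \<noteq> UNIV \<Longrightarrow> i < n"
      using finite_nat_bounded[OF B(1)] by auto
    have "y \<in> U" if "y \<in> cyl (res x n)" for y
    proof -
      have "(\<lambda>n. n \<in> y) \<in> Pi\<^sub>E UNIV B"
      proof (rule PiE_I)
        fix i show "(i \<in> y) \<in> B i"
        proof (cases "i < n")
          case True
          then have "(i \<in> y) = (i \<in> x)" using that by (simp add: cyl_res)
          then show ?thesis using B(2) by (auto simp: PiE_def)
        next
          case False
          then show ?thesis using n[of i] by auto
        qed
      qed simp
      then show ?thesis using B(3) W(2) by auto
    qed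
    then show "\<exists>n. cyl (res x n) \<subseteq> U" by blast
  qed
next
  let ?T = "product_topology (\<lambda>_. discrete_topology (UNIV :: bool set)) (UNIV :: nat set)"
  assume U: "\<forall>x\<in>U. \<exists>n. cyl (res x n) \<subseteq> U"
  have cyl: "openin cantor_topology (cyl (res x n))" for x n
  proof -
    have "openin cantor_topology {y. i \<in> y \<longleftrightarrow> i \<in> x}" for i
    proof -
      have "openin ?T {f \<in> topspace ?T. f i \<in> {i \<in> x}}"
        by (rule openin_continuous_map_preimage[OF continuous_map_product_projection]) simp_all
      then show ?thesis
        unfolding cantor_topology_def openin_pullback_topology by (intro exI conjI) auto
    qed
    then have "openin cantor_topology (\<Inter>i\<in>{..<n}. {y. i \<in> y \<longleftrightarrow> i \<in> x})" if "n > 0"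
      using that by (intro openin_INT2) auto
    moreover have "cyl (res x n) = (\<Inter>i\<in>{..<n}. {y. i \<in> y \<longleftrightarrow> i \<in> x})" by (auto simp: cyl_res)
    moreover have "openin cantor_topology UNIV" using openin_topspace[of cantor_topology] by simp
    ultimately show ?thesis by (cases "n > 0") auto
  qed
  show "openin cantor_topology U"
  proof (subst openin_subopen, intro ballI)
    fix x assume "x \<in> U"
    then obtain n where "cyl (res x n) \<subseteq> U" using U by blast
    then show "\<exists>T. openin cantor_topology T \<and> x \<in> T \<and> T \<subseteq> U"
      using cyl[of x n] in_cyl_res[of x n] by blast
  qed
qed

lemma nowhere_dense_in_cantor_iff: "nowhere_dense_in cantor_topology N \<longleftrightarrow> nwd N"
proof
  assume N: "nowhere_dense_in cantor_topology N"
  show "nwd N"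
    unfolding nwd_def
  proof
    fix p
    obtain x where x: "x \<in> cyl p" using cyl_nonempty by blast
    let ?p = "res x (cond_len p)"
    have "openin cantor_topology (cyl ?p)"
      unfolding openin_cantor_iff by (auto simp: cyl_res intro!: exI[of _ "cond_len p"])
    then have "\<not> cyl ?p \<subseteq> cantor_topology closure_of N"
      using N in_cyl_res interior_of_maximal unfolding nowhere_dense_in_def by blast
    then obtain y where y: "y \<in> cyl ?p" "y \<notin> cantor_topology closure_of N" by blast
    have "openin cantor_topology (- (cantor_topology closure_of N))"
      using closedin_closure_of[of cantor_topology N] by (simp add: closedin_def Compl_eq_Diff_UNIV)
    then obtain n where n: "cyl (res y n) \<subseteq> - (cantor_topology closure_of N)"
      using y(2) unfolding openin_cantor_iff by blast
    define q where "q = res y (max n (cond_len p))"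
    have "y \<in> cyl p" using y(1) x cyl_mono[OF ext_res[OF x order_refl]] by blast
    then have "ext q p" unfolding q_def by (rule ext_res) simp
    moreover have "cyl q \<subseteq> cyl (res y n)" unfolding q_def by (auto simp: cyl_res)
    moreover have "N \<subseteq> cantor_topology closure_of N" by (simp add: closure_of_subset)
    ultimately show "\<exists>q. ext q p \<and> cyl q \<inter> N = {}" using n by blast
  qed
next
  assume N: "nwd N"
  have "x \<notin> cantor_topology interior_of (cantor_topology closure_of N)" for x
  proof
    assume x: "x \<in> cantor_topology interior_of (cantor_topology closure_of N)"
    have "openin cantor_topology (cantor_topology interior_of (cantor_topology closure_of N))" by simp
    then obtain n where "cyl (res x n) \<subseteq> cantor_topology interior_of (cantor_topology closure_of N)"
      using x unfolding openin_cantor_iff by blast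
    then have n: "cyl (res x n) \<subseteq> cantor_topology closure_of N"
      using interior_of_subset by (rule order_trans)
    obtain q where q: "ext q (res x n)" "cyl q \<inter> N = {}" using N unfolding nwd_def by blast
    obtain y where y: "y \<in> cyl q" using cyl_nonempty by blast
    let ?q = "res y (cond_len q)"
    have sub: "cyl ?q \<subseteq> cyl q" using cyl_mono[OF ext_res[OF y order_refl]] .
    have "openin cantor_topology (cyl ?q)"
      unfolding openin_cantor_iff by (auto simp: cyl_res intro!: exI[of _ "cond_len q"])
    moreover have "y \<in> cantor_topology closure_of N" using n y cyl_mono[OF q(1)] by blast
    ultimately have "\<exists>w. w \<in> N \<and> w \<in> cyl ?q"
      using in_cyl_res[of y "cond_len q"] unfolding in_closure_of by meson
    then show False using q(2) sub by auto
  qed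
  then show "nowhere_dense_in cantor_topology N" unfolding nowhere_dense_in_def by auto
qed

lemma meager_in_cantor_iff: "meager_in cantor_topology S \<longleftrightarrow> meag S"
proof
  assume "meager_in cantor_topology S"
  then obtain \<N> where N: "countable \<N>" "\<And>N. N \<in> \<N> \<Longrightarrow> nwd N" "S = \<Union>\<N>"
    unfolding meager_in_def nowhere_dense_in_cantor_iff by blast
  show "meag S"
  proof (cases "\<N> = {}")
    case True
    then show ?thesis using N(3) meag_empty by simp
  next
    case False
    have r: "range (from_nat_into \<N>) = \<N>" using False N(1) by (rule range_from_nat_into)
    then show ?thesis
      unfolding meag_def using N(2,3) by (intro exI[of _ "from_nat_into \<N>"]) auto
  qed
next
  assume "meag S"
  then obtain F where F: "\<And>n::nat. nwd (F n)" "S \<subseteq> (\<Union>n. F n)" unfolding meag_def by blast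
  have "nwd (F n \<inter> S)" for n using F(1)[of n] unfolding nwd_def by blast
  moreover have "S = \<Union>(range (\<lambda>n. F n \<inter> S))" using F(2) by blast
  ultimately show "meager_in cantor_topology S"
    unfolding meager_in_def nowhere_dense_in_cantor_iff by (intro exI[of _ "range (\<lambda>n. F n \<inter> S)"]) auto
qed

section \<open>Category in the product\<close>

definition left :: "nat set \<Rightarrow> nat set" where "left z = {n. dbl n \<in> z}"
definition right :: "nat set \<Rightarrow> nat set" where "right z = {n. Suc (dbl n) \<in> z}"

lemma left_join [simp]: "left (join x y) = x" and right_join [simp]: "right (join x y) = y"
  by (simp_all add: left_def right_def dbl_eq)

lemma join_left_right [simp]: "join (left z) (right z) = z"
proof (rule set_eqI)
  fix n show "n \<in> join (left z) (right z) \<longleftrightarrow> n \<in> z"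
    by (cases "even n") (auto elim!: evenE oddE simp: left_def right_def dbl_eq)
qed

lemma join_agree:
  assumes "\<And>i. i < m \<Longrightarrow> i \<in> y \<longleftrightarrow> i \<in> y'" "\<And>i. i < m \<Longrightarrow> i \<in> x \<longleftrightarrow> i \<in> x'" "n < 2 * m"
  shows "n \<in> join y x \<longleftrightarrow> n \<in> join y' x'"
  using assms(3) by (cases "even n") (auto elim!: evenE oddE simp: assms(1,2))

lemma cyl_iff: "x \<in> cyl p \<longleftrightarrow> (\<forall>i<cond_len p. i \<in> x \<longleftrightarrow> nth' p i \<noteq> 0)"
  by (auto simp: cyl_def indom_iff)

lemma cyl_agree: "x \<in> cyl p \<Longrightarrow> (\<And>i. i < cond_len p \<Longrightarrow> i \<in> y \<longleftrightarrow> i \<in> x) \<Longrightarrow> y \<in> cyl p"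
  by (simp add: cyl_iff)

lemma join_in_cyl:
  assumes "z \<in> cyl t" "cond_len t \<le> m" "y \<in> cyl (res (left z) m)" "x \<in> cyl (res (right z) m)"
  shows "join y x \<in> cyl t"
proof (rule cyl_agree[OF assms(1)])
  fix i assume "i < cond_len t"
  then have "i < 2 * m" using assms(2) by simp
  then have "i \<in> join y x \<longleftrightarrow> i \<in> join (left z) (right z)"
    using assms(3,4) by (intro join_agree[of m]) (auto simp: cyl_res)
  then show "i \<in> join y x \<longleftrightarrow> i \<in> z" by simp
qed

lemma left_right_in_cyl:
  assumes "z \<in> cyl (res (join y x) (2 * m))"
  shows "cond_len s \<le> m \<Longrightarrow> y \<in> cyl s \<Longrightarrow> left z \<in> cyl s" "cond_len s \<le> m \<Longrightarrow> x \<in> cyl s \<Longrightarrow> right z \<in> cyl s"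
proof -
  have z: "i \<in> z \<longleftrightarrow> i \<in> join y x" if "i < 2 * m" for i using assms that by (simp add: cyl_res)
  have "i \<in> left z \<longleftrightarrow> i \<in> y" "i \<in> right z \<longleftrightarrow> i \<in> x" if "i < m" for i
    using z[of "2 * i"] z[of "Suc (2 * i)"] that by (simp_all add: left_def right_def dbl_eq)
  then show "cond_len s \<le> m \<Longrightarrow> y \<in> cyl s \<Longrightarrow> left z \<in> cyl s" "cond_len s \<le> m \<Longrightarrow> x \<in> cyl s \<Longrightarrow> right z \<in> cyl s"
    using cyl_agree by (meson less_le_trans)+
qed

lemma nwd_left:
  assumes "nwd N"
  shows "nwd {z. left z \<in> N}"
  unfolding nwd_def
proof
  fix t
  obtain z where z: "z \<in> cyl t" using cyl_nonempty by blast
  obtain s where s: "ext s (res (left z) (cond_len t))" "cyl s \<inter> N = {}" using assms unfolding nwd_def by blast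
  obtain w where w: "w \<in> cyl s" using cyl_nonempty by blast
  have wt: "join w (right z) \<in> cyl t"
    by (rule join_in_cyl[OF z order_refl]) (use w cyl_mono[OF s(1)] in auto)
  define t' where "t' = res (join w (right z)) (2 * max (cond_len s) (cond_len t))"
  have "ext t' t" unfolding t'_def using wt by (rule ext_res) simp
  moreover have "left z' \<in> cyl s" if "z' \<in> cyl t'" for z'
    using left_right_in_cyl(1)[OF that[unfolded t'_def] _ w] by simp
  ultimately show "\<exists>q. ext q t \<and> cyl q \<inter> {z. left z \<in> N} = {}" using s(2) by blast
qed

lemma meag_left:
  assumes "meag M"
  shows "meag {z. left z \<in> M}"
proof -
  obtain F where F: "\<And>n::nat. nwd (F n)" "M \<subseteq> (\<Union>n. F n)" using assms unfolding meag_def by blast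
  have "nwd {z. left z \<in> F n}" for n using F(1) by (rule nwd_left)
  then show ?thesis
    unfolding meag_def using F(2) by (intro exI[of _ "\<lambda>n. {z. left z \<in> F n}"]) auto
qed

text \<open>One half of the Kuratowski-Ulam theorem.\<close>

lemma section_not_meag:
  assumes q: "meag (cyl q - Y)"
  shows "\<exists>y. \<not> meag {x. join y x \<in> Y}"
proof (rule ccontr)
  assume "\<not> (\<exists>y. \<not> meag {x. join y x \<in> Y})"
  then have sec: "meag {x. join y x \<in> Y}" for y by blast
  obtain F where F: "\<And>n::nat. nwd (F n)" "cyl q - Y \<subseteq> (\<Union>n. F n)" using q unfolding meag_def by blast
  \<comment> \<open>The \<open>y\<close> for which the section of \<open>F n\<close> is dense in
    \<open>cyl p\<close>. They form a nowhere dense set, because a condition avoiding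
    \<open>F n\<close> can be split into a left and a right half.\<close>
  define B where "B n p = {y. \<not> (\<exists>p'. ext p' p \<and> (\<forall>x\<in>cyl p'. join y x \<notin> F n))}" for n p
  have "nwd (B n p)" for n p
    unfolding nwd_def
  proof
    fix s
    obtain y0 x0 where 0: "y0 \<in> cyl s" "x0 \<in> cyl p" using cyl_nonempty by meson
    define m where "m = max (cond_len s) (cond_len p)"
    obtain t where t: "ext t (res (join y0 x0) (2 * m))" "cyl t \<inter> F n = {}" using F(1) unfolding nwd_def by blast
    obtain z where z: "z \<in> cyl t" using cyl_nonempty by blast
    then have z': "z \<in> cyl (res (join y0 x0) (2 * m))" using cyl_mono[OF t(1)] by blast
    define k where "k = max m (cond_len t)"
    have "left z \<in> cyl s" "right z \<in> cyl p"
      using left_right_in_cyl[OF z'] 0 by (auto simp: m_def)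
    then have e: "ext (res (left z) k) s" "ext (res (right z) k) p"
      by (auto intro!: ext_res simp: k_def m_def)
    have "join y x \<notin> F n" if "y \<in> cyl (res (left z) k)" "x \<in> cyl (res (right z) k)" for x y
      using join_in_cyl[OF z _ that] t(2) by (auto simp: k_def)
    then have "cyl (res (left z) k) \<inter> B n p = {}" unfolding B_def using e(2) by blast
    then show "\<exists>r. ext r s \<and> cyl r \<inter> B n p = {}" using e(1) by blast
  qed
  then have B: "meag (\<Union>n. \<Union>p. B n p)" by (intro meag_UN nwd_meag)
  obtain z where z: "z \<in> cyl q" using cyl_nonempty by blast
  have "\<not> cyl (res (left z) (cond_len q)) \<subseteq> (\<Union>n. \<Union>p. B n p)"
  proof
    assume "cyl (res (left z) (cond_len q)) \<subseteq> (\<Union>n. \<Union>p. B n p)"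
    with B have "meag (cyl (res (left z) (cond_len q)))" by (rule meag_subset)
    then show False using baire by simp
  qed
  \<comment> \<open>Outside all \<open>B n p\<close> the sections of every \<open>F n\<close> are
    nowhere dense. As \<open>y\<close> agrees with the left half of a point of \<open>cyl q\<close>,
    these sections and that of \<open>Y\<close> cover a whole cylinder.\<close>
  then obtain y where y: "y \<in> cyl (res (left z) (cond_len q))" and "y \<notin> (\<Union>n. \<Union>p. B n p)" by (meson subsetI)
  then have yB: "y \<notin> B n p" for n p by simp
  have "nwd {x. join y x \<in> F n}" for n
    using yB[of n] unfolding B_def nwd_def by blast
  then have "meag (\<Union>n. {x. join y x \<in> F n})" by (intro meag_UN nwd_meag)
  then have "meag ((\<Union>n. {x. join y x \<in> F n}) \<union> {x. join y x \<in> Y})" using sec by (rule meag_Un)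
  moreover have "cyl (res (right z) (cond_len q)) \<subseteq> (\<Union>n. {x. join y x \<in> F n}) \<union> {x. join y x \<in> Y}"
    using join_in_cyl[OF z order_refl y] F(2) by blast
  ultimately have "meag (cyl (res (right z) (cond_len q)))" by (rule meag_subset)
  then show False using baire by simp
qed

section \<open>Randomness of joins\<close>

text \<open>All registers initially contain 0, so 0 is the number argument that the compiled command
  receives.\<close>

lemma definable_itrm_decidable:
  assumes "definable R"
  shows "itrm_decidable {z. R 0 z}"
proof -
  obtain C where C: "computes C (\<lambda>e z. of_bool (R e z))"
    using definable_decidable[OF assms] by (auto simp: decidable_def computable_def)
  have "itrm_computes (compile (C 0) 0) z (if z \<in> {z. R 0 z} then 1 else 0)" for z
  proof -
    have "wp z (frame 0 (\<lambda>_. 0)) (C 0) (\<lambda>S. S 0 = of_bool (R 0 z)) (\<lambda>_. 0)"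
      using C[unfolded computes_def, rule_format, of z 0 "\<lambda>_. 0"] by simp
    then obtain M S where "exec z (C 0) (\<lambda>_. 0) M S" "S 0 = of_bool (R 0 z)" unfolding wp_def by blast
    then show ?thesis using itrm_computes_compile[of z "C 0" M S] by (simp add: of_bool_def)
  qed
  then show ?thesis unfolding itrm_decidable_def by blast
qed

lemma itrm_computes_char:
  "itrm_computes P z (if b then 1 else 0) \<Longrightarrow> itrm_computes P z 1 \<longleftrightarrow> b"
  using itrm_computes_unique by (cases b) fastforce+

text \<open>The first component runs through 1, 0, 3, 2, and so on. Exchanging the halves turns the
  oracle \<open>y \<oplus> x\<close> of the set \<open>Y\<close> into the oracle
  \<open>x \<oplus> y\<close> that \<open>P\<close> expects.\<close>

definition swap :: "nat \<Rightarrow> nat" where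
  "swap n = p1 (((\<lambda>q. pr (p2 q) (Suc (Suc (p1 q)))) ^^ n) (pr 1 0))"

lemma cf_swap: "cf swap"
  unfolding swap_def
  by (intro cf_intros cf_iterate[of "\<lambda>q. pr (p2 q) (Suc (Suc (p1 q)))"])

lemma swap_eq: "swap (2 * n) = Suc (2 * n)" "swap (Suc (2 * n)) = 2 * n"
proof -
  let ?s = "\<lambda>q. pr (p2 q) (Suc (Suc (p1 q)))"
  have "(?s ^^ (2 * n)) (pr 1 0) = pr (Suc (2 * n)) (2 * n)"
    by (induction n) auto
  then show "swap (2 * n) = Suc (2 * n)" "swap (Suc (2 * n)) = 2 * n" by (simp_all add: swap_def)
qed

lemma swap_set: "{n. swap n \<in> z} = join (right z) (left z)"
proof (rule set_eqI)
  fix n show "n \<in> {n. swap n \<in> z} \<longleftrightarrow> n \<in> join (right z) (left z)"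
    by (cases "even n") (auto elim!: evenE oddE simp: swap_eq left_def right_def dbl_eq)
qed

lemma definable_left:
  assumes "definable R"
  shows "definable (\<lambda>e z. R e (left z))"
  using definable_oracle_subst[OF assms cf_dbl[OF cf_id]] unfolding left_def .

lemma definable_meag_or_forced:
  assumes "definable R" "\<And>q. \<not> forces q {z. R 0 z}"
  shows "meag {z. R 0 z}"
proof -
  \<comment> \<open>The forcing theorem speaks of joins; \<open>left (join x {})\<close>, which is
    \<open>x\<close>, carries it over to the set itself.\<close>
  have "decides {x. R 0 (left (join x {}))}" using forcing_theorem[OF definable_left[OF assms(1)]] by blast
  then have "decides {z. R 0 z}" by simp
  then have "forces 0 (- {z. R 0 z})" using forces_Compl assms(2) by blast
  then show ?thesis unfolding forces_def by simp
qed

text \<open>Rather than rewriting \<open>P\<close> for the oracle \<open>left z\<close>, the proof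
  uses that \<open>P\<close> has a definable halting relation, in which the oracle can be
  substituted.\<close>

lemma random_left:
  assumes "itrm_random (join a b)"
  shows "itrm_random a"
  unfolding itrm_random_def
proof
  assume "\<exists>X. itrm_decidable X \<and> meager_in cantor_topology X \<and> a \<in> X"
  then obtain X P where X: "meag X" "a \<in> X" and P: "\<And>x. itrm_computes P x (if x \<in> X then 1 else 0)"
    unfolding itrm_decidable_def meager_in_cantor_iff by blast
  have eq: "itrm_computes P x 1 \<longleftrightarrow> x \<in> X" for x using itrm_computes_char[OF P] .
  have "itrm_decidable {z. left z \<in> X}"
    using definable_itrm_decidable[OF definable_left[OF halting_definable[of P]]] unfolding eq .
  moreover have "meag {z. left z \<in> X}" using X(1) by (rule meag_left)
  ultimately show False
    using assms X(2) unfolding itrm_random_def meager_in_cantor_iff by auto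
qed

lemma random_right:
  assumes "itrm_random (join a b)"
  shows "itrm_random_rel b a"
  unfolding itrm_random_rel_def
proof
  assume "\<exists>X. meager_in cantor_topology X \<and> b \<in> X \<and> itrm_decidable_in a X"
  then obtain X P where X: "meag X" "b \<in> X" and P: "\<And>x. itrm_computes P (join x a) (if x \<in> X then 1 else 0)"
    unfolding itrm_decidable_in_def meager_in_cantor_iff by blast
  \<comment> \<open>For \<open>y\<close> other than \<open>a\<close> divergence counts as rejection.
    The sets \<open>S y\<close> still have the Baire property, by the forcing theorem.\<close>
  define S where "S y = {x. itrm_computes P (join x y) 1}" for y
  have Sa: "S a = X" unfolding S_def using itrm_computes_char[OF P] by simp
  have ft: "decides (S y)" "definable (\<lambda>e y. forces (p1 e) (S y))" for y
    using forcing_theorem[OF halting_definable[of P]] unfolding S_def by blast+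
  define Y where "Y e z \<longleftrightarrow> right z \<in> S (left z) \<and> \<not> (\<exists>p. right z \<in> cyl p \<and> forces p (S (left z)))" for e :: nat and z
  have "definable Y"
  proof -
    have 1: "definable (\<lambda>e z. right z \<in> S (left z))"
      using definable_oracle_subst[OF halting_definable[of P] cf_swap] unfolding swap_set S_def by simp
    have F: "definable (\<lambda>e z. forces (p2 e) (S (left z)))"
      using definable_subst[OF definable_left[OF ft(2)] cf_pr[OF cf_p2[OF cf_id] cf_id]] by simp
    have 2: "definable (\<lambda>e z. right z \<in> cyl (p2 e))"
      unfolding cyl_def right_def mem_Collect_eq
      by (intro definable_intros definable_indom cf_intros cf_dbl)
    show ?thesis unfolding Y_def by (intro definable_intros 1 2 F)
  qed
  then have dec: "itrm_decidable {z. Y 0 z}" by (rule definable_itrm_decidable)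
  have sections: "meag {x. Y 0 (join y x)}" for y
  proof -
    \<comment> \<open>Conditions deciding \<open>S y\<close> are dense. Below one that forces
      \<open>S y\<close> the section is empty by definition of \<open>Y\<close>; below one that
      forces the complement it lies in the meager set \<open>S y\<close> there.\<close>
    have "meag (cyl 0 \<inter> {x. Y 0 (join y x)})"
    proof (rule meag_local)
      fix q
      obtain r where r: "ext r q" "forces r (S y) \<or> forces r (- S y)" using ft(1) unfolding decides_def by blast
      have "meag (cyl r \<inter> {x. Y 0 (join y x)})"
      proof (cases "forces r (S y)")
        case True
        then have "cyl r \<inter> {x. Y 0 (join y x)} = {}" by (auto simp: Y_def)
        then show ?thesis using meag_empty by simp
      next
        case False
        then have "meag (cyl r - - S y)" using r(2) unfolding forces_def by blast
        then show ?thesis by (rule meag_subset) (auto simp: Y_def)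
      qed
      then show "\<exists>r. ext r q \<and> meag (cyl r \<inter> {x. Y 0 (join y x)})" using r(1) by blast
    qed
    then show ?thesis by simp
  qed
  have "\<not> forces q {z. Y 0 z}" for q
    using section_not_meag[of q "{z. Y 0 z}"] sections unfolding forces_def by auto
  then have "meag {z. Y 0 z}" using definable_meag_or_forced[OF \<open>definable Y\<close>] by blast
  moreover have "Y 0 (join a b)"
  proof -
    have "\<not> forces p X" for p
    proof
      assume "forces p X"
      then have "meag ((cyl p - X) \<union> X)" using X(1) unfolding forces_def by (rule meag_Un)
      then have "meag (cyl p)" by (rule meag_subset) blast
      then show False using baire by blast
    qed
    then show ?thesis using X(2) Sa by (simp add: Y_def)
  qed
  ultimately show False
    using assms dec unfolding itrm_random_def meager_in_cantor_iff by blast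
qed

theorem theorem18:
  fixes a b :: "nat set"
  assumes "itrm_random (join a b)"
  shows "itrm_random a \<and> itrm_random_rel b a"
  using random_left[OF assms] random_right[OF assms] ..

end
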